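(* Let $A:[0,\infty)\to\mathbb{R}^{d\times d}$ be continuous and bounded, let $1\le L\le d$, and assume that the system $\dot x=A(t)x$ is regular and $L$-dimensionally strongly fast invertible. Let $\Phi$ be a one-step method for this system that is consistent of order $p>0$, and let $(h_n)_{n\ge1}$ be stepsizes with $0<h_n\le h_{\max}$ and $t_n=h_1+\dots+h_n\to\infty$. If $$\sum_{n=1}^\infty h_n^{p+1}<\infty,$$ then for Lebesgue-almost every tuple of initial vectors $(v_1,\dots,v_d)\in(\mathbb{R}^d)^d$ the outputs $\mu_i(n)$ of Benettin's algorithm satisfy $$\limsup_{n\to\infty}\big(\mu_1(n)+\dots+\mu_L(n)\big)=\Lambda_1+\dots+\Lambda_L .$$
   Context: Norms are Euclidean norms and associated operator norms. $X(t)$ denotes a fundamental matrix of $\dot x=A(t)x$ and $X(t,s)=X(t)X(s)^{-1}$ the Cauchy matrix. Lyapunov exponents: for a solution $x$ put $\chi[x]=\limsup_{t\to\infty}\frac1t\log\|x(t)\|$. The distinct values of $\chi$ on non-trivial solutions are $\lambda_1>\dots>\lambda_q$; with $V_i=\{x \text{ solution}:\chi[x]\le\lambda_i\}$, $V_{q+1}=\{0\}$, the multiplicity of $\lambda_i$ is $d_i=\dim V_i-\dim V_{i+1}$. Counted with multiplicity: $\Lambda_1\ge\dots\ge\Lambda_d$ (each $\lambda_i$ repeated $d_i$ times). The system is regular if $\sum_{i=1}^d\Lambda_i=\liminf_{t\to\infty}\frac1t\log|\det X(t)|$. The system is $L$-dimensionally strongly fast invertible if $\sup_{t\ge s\ge\tau\ge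 0}\prod_{k=1}^L\frac{\sigma_k(X(t,s))\sigma_k(X(s,\tau))}{\sigma_k(X(t,\tau))}<\infty$, where $\sigma_1\ge\dots\ge\sigma_d$ denote singular values. One-step method: fix $0<h_{\max}<\infty$. A (linear) one-step method is a map $\Phi:[0,\infty)\times[0,h_{\max}]\to GL(d,\mathbb{R})$. It is consistent of order $p>0$ if there is a constant $c_\Phi>0$ with $\|\Phi(t,h)-X(t+h,t)\|\le c_\Phi h^{p+1}$ for all $t\ge0$, $0\le h\le h_{\max}$. Given stepsizes, put $t_0=0$, $t_n=h_1+\dots+h_n$, $\Phi_n=\Phi(t_{n-1},h_n)$. Benettin's algorithm: start with $V_0=[v_1,\dots,v_d]$ (invertible for almost every tuple). For $n\ge1$ compute the QR-decomposition $\Phi_nV_{n-1}=Q_nR_n$ ($Q_n$ orthogonal, $R_n$ upper triangular with positive diagonal) and set $V_n=Q_n$. The output after $n$ steps is $\mu_i(n)=\frac1{t_n}\sum_{k=1}^n\log (R_k)_{ii}$, $i=1,\dots,d$. *)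

theory Defs
  imports "HOL-Analysis.Analysis" "HOL-Library.Function_Algebras"
begin

text \<open>The space \<open>\<real>\<^sup>d\<close> is \<open>real ^ 'n\<close> with \<open>'n\<close> finite and linearly ordered; the order is used for
  upper triangularity and to number the coordinates.\<close>

text \<open>The \<open>i\<close>-th coordinate index, counting from 1.\<close>
definition nth_index :: "nat \<Rightarrow> 'n::{finite,linorder}" where
  "nth_index i = sorted_list_of_set (UNIV :: 'n set) ! (i - 1)"

section \<open>Solutions and Lyapunov exponents\<close>

text \<open>Functions on \<open>[0,\<infinity>)\<close> are encoded as functions on \<open>\<real>\<close> that vanish on \<open>(-\<infinity>,0)\<close>, so that
  the solutions form a vector space under the pointwise operations.\<close>
definition solution :: "(real \<Rightarrow> real^'n^'n) \<Rightarrow> (real \<Rightarrow> real^'n) \<Rightarrow> bool" where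
  "solution A x \<longleftrightarrow>
     (\<forall>t\<ge>0. (x has_vector_derivative (A t *v x t)) (at t within {0..})) \<and> (\<forall>t<0. x t = 0)"

definition fundamental_matrix ::
    "(real \<Rightarrow> real^'n^'n) \<Rightarrow> (real \<Rightarrow> real^'n^'n) \<Rightarrow> bool" where
  "fundamental_matrix A X \<longleftrightarrow>
     (\<forall>t\<ge>0. (X has_vector_derivative (A t ** X t)) (at t within {0..}) \<and> invertible (X t))"

definition cauchy_matrix :: "(real \<Rightarrow> real^'n^'n) \<Rightarrow> real \<Rightarrow> real \<Rightarrow> real^'n^'n" where
  "cauchy_matrix X t s = X t ** matrix_inv (X s)"

text \<open>Here \<open>log 0 = -\<infinity>\<close>, so the trivial solution has exponent \<open>-\<infinity>\<close> (the library has \<open>ln 0 = 0\<close>).\<close>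
definition lyapunov_exponent :: "(real \<Rightarrow> real^'n) \<Rightarrow> ereal" where
  "lyapunov_exponent x =
     Limsup at_top (\<lambda>t. if x t = 0 then - \<infinity> else ereal (1 / t * ln (norm (x t))))"

definition fun_scale :: "real \<Rightarrow> (real \<Rightarrow> real^'n) \<Rightarrow> (real \<Rightarrow> real^'n)" where
  "fun_scale c x = (\<lambda>t. c *\<^sub>R x t)"

interpretation fun_space: vector_space "fun_scale :: real \<Rightarrow> (real \<Rightarrow> real^'n) \<Rightarrow> _"
  by unfold_locales
     (auto simp: fun_scale_def fun_eq_iff scaleR_add_right scaleR_add_left)

definition lyapunov_spectrum :: "(real \<Rightarrow> real^'n^'n) \<Rightarrow> ereal set" where
  "lyapunov_spectrum A = lyapunov_exponent ` {x. solution A x \<and> x \<noteq> 0}"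

text \<open>\<open>\<lambda>\<^sub>1 > \<dots> > \<lambda>\<^sub>q\<close>, with index starting at 1.\<close>
definition lyapunov_value :: "(real \<Rightarrow> real^'n^'n) \<Rightarrow> nat \<Rightarrow> ereal" where
  "lyapunov_value A i = rev (sorted_list_of_set (lyapunov_spectrum A)) ! (i - 1)"

definition lyapunov_space :: "(real \<Rightarrow> real^'n^'n) \<Rightarrow> nat \<Rightarrow> (real \<Rightarrow> real^'n) set" where
  "lyapunov_space A i =
     (if i \<le> card (lyapunov_spectrum A)
      then {x. solution A x \<and> lyapunov_exponent x \<le> lyapunov_value A i} else {0})"

definition lyapunov_multiplicity :: "(real \<Rightarrow> real^'n^'n) \<Rightarrow> nat \<Rightarrow> nat" where
  "lyapunov_multiplicity A i =
     fun_space.dim (lyapunov_space A i) - fun_space.dim (lyapunov_space A (i + 1))"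

text \<open>\<open>\<Lambda>\<^sub>1 \<ge> \<dots> \<ge> \<Lambda>\<^sub>d\<close>, with index starting at 1.\<close>
definition lyapunov_counted :: "(real \<Rightarrow> real^'n^'n) \<Rightarrow> nat \<Rightarrow> ereal" where
  "lyapunov_counted A i =
     concat (map (\<lambda>j. replicate (lyapunov_multiplicity A j) (lyapunov_value A j))
                 [1..<Suc (card (lyapunov_spectrum A))]) ! (i - 1)"

text \<open>In this and the next section \<open>X\<close> is a fundamental matrix of \<open>A\<close>; the notions do not depend
  on which one is chosen.\<close>
definition regular_system :: "(real \<Rightarrow> real^'n^'n) \<Rightarrow> (real \<Rightarrow> real^'n^'n) \<Rightarrow> bool" where
  "regular_system A X \<longleftrightarrow>
     (\<Sum>i=1..CARD('n). lyapunov_counted A i) =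
       Liminf at_top (\<lambda>t. ereal (1 / t * ln \<bar>det (X t)\<bar>))"

section \<open>Singular values and strong fast invertibility\<close>

text \<open>Square roots of the eigenvalues of \<open>M\<^sup>T M\<close>, repeated according to multiplicity and sorted
  in decreasing order, with index starting at 1. Since \<open>M\<^sup>T M\<close> is symmetric, geometric and
  algebraic multiplicities agree.\<close>
definition singular_value :: "nat \<Rightarrow> real^'n^'n \<Rightarrow> real" where
  "singular_value k M =
     concat (map (\<lambda>s. replicate (dim {v. (transpose M ** M) *v v = s\<^sup>2 *\<^sub>R v}) s)
       (rev (sorted_list_of_set
          {s. s \<ge> 0 \<and> (\<exists>v. v \<noteq> 0 \<and> (transpose M ** M) *v v = s\<^sup>2 *\<^sub>R v)}))) ! (k - 1)"

definition strongly_fast_invertible :: "nat \<Rightarrow> (real \<Rightarrow> real^'n^'n) \<Rightarrow> bool" where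
  "strongly_fast_invertible L X \<longleftrightarrow>
     bdd_above {(\<Prod>k=1..L. singular_value k (cauchy_matrix X t s) *
                           singular_value k (cauchy_matrix X s \<tau>) /
                           singular_value k (cauchy_matrix X t \<tau>))
                | t s \<tau>. t \<ge> s \<and> s \<ge> \<tau> \<and> \<tau> \<ge> 0}"

section \<open>One-step methods\<close>

definition one_step_method :: "real \<Rightarrow> (real \<Rightarrow> real \<Rightarrow> real^'n^'n) \<Rightarrow> bool" where
  "one_step_method hmax \<Phi> \<longleftrightarrow> (\<forall>t\<ge>0. \<forall>h\<in>{0..hmax}. invertible (\<Phi> t h))"

text \<open>The operator norm is spelled out via \<open>onorm\<close>; \<open>norm\<close> on matrices is the Frobenius norm.\<close>
definition consistent_of_order ::
    "real \<Rightarrow> (real \<Rightarrow> real^'n^'n) \<Rightarrow> (real \<Rightarrow> real \<Rightarrow> real^'n^'n) \<Rightarrow> real \<Rightarrow> bool" where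
  "consistent_of_order hmax X \<Phi> p \<longleftrightarrow>
     (\<exists>c>0. \<forall>t\<ge>0. \<forall>h\<in>{0..hmax}.
        onorm ((*v) (\<Phi> t h - cauchy_matrix X (t + h) t)) \<le> c * h powr (p + 1))"

text \<open>Stepsizes are \<open>h 1, h 2, \<dots>\<close>; the value \<open>h 0\<close> is never used.\<close>
definition grid_time :: "(nat \<Rightarrow> real) \<Rightarrow> nat \<Rightarrow> real" where
  "grid_time h n = (\<Sum>k=1..n. h k)"

definition step_matrix ::
    "(real \<Rightarrow> real \<Rightarrow> real^'n^'n) \<Rightarrow> (nat \<Rightarrow> real) \<Rightarrow> nat \<Rightarrow> real^'n^'n" where
  "step_matrix \<Phi> h n = \<Phi> (grid_time h (n - 1)) (h n)"

section \<open>Benettin's algorithm\<close>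

type_synonym 'n square = "real^'n^'n"

definition is_QR ::
    "'n::{finite,linorder} square \<Rightarrow> 'n square \<Rightarrow> 'n square \<Rightarrow> bool" where
  "is_QR M Q R \<longleftrightarrow> M = Q ** R \<and> orthogonal_matrix Q \<and>
     (\<forall>i j. j < i \<longrightarrow> R $ i $ j = 0) \<and> (\<forall>i. R $ i $ i > 0)"

text \<open>For invertible \<open>M\<close> the decomposition exists and is unique; otherwise the value is unspecified.\<close>
definition QR :: "'n::{finite,linorder} square \<Rightarrow> 'n square \<times> 'n square" where
  "QR M = (THE (Q, R). is_QR M Q R)"

text \<open>The initial vectors are the columns of \<open>V\<^sub>0\<close>, hence the transposition: \<open>v $ j\<close> is \<open>v\<^sub>j\<close>.\<close>
primrec benettin_V ::
    "(real \<Rightarrow> real \<Rightarrow> 'n::{finite,linorder} square) \<Rightarrow> (nat \<Rightarrow> real) \<Rightarrow> 'n square \<Rightarrow> nat \<Rightarrow>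
       'n square" where
  "benettin_V \<Phi> h v 0 = transpose v"
| "benettin_V \<Phi> h v (Suc n) = fst (QR (step_matrix \<Phi> h (Suc n) ** benettin_V \<Phi> h v n))"

text \<open>Meaningful for \<open>n \<ge> 1\<close>.\<close>
definition benettin_R ::
    "(real \<Rightarrow> real \<Rightarrow> 'n::{finite,linorder} square) \<Rightarrow> (nat \<Rightarrow> real) \<Rightarrow> 'n square \<Rightarrow> nat \<Rightarrow>
       'n square" where
  "benettin_R \<Phi> h v n = snd (QR (step_matrix \<Phi> h n ** benettin_V \<Phi> h v (n - 1)))"

definition benettin_output ::
    "(real \<Rightarrow> real \<Rightarrow> 'n::{finite,linorder} square) \<Rightarrow> (nat \<Rightarrow> real) \<Rightarrow> 'n square \<Rightarrow>
       nat \<Rightarrow> nat \<Rightarrow> real" where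
  "benettin_output \<Phi> h v i n =
     1 / grid_time h n *
       (\<Sum>k=1..n. ln (benettin_R \<Phi> h v k $ nth_index i $ nth_index i))"

end

theory Submission
  imports Defs
begin

text \<open>The sum of the first \<open>L\<close> outputs is \<open>1 / t\<^sub>n\<close> times the logarithm of the \<open>L\<close>-dimensional
  volume spanned by the images of \<open>v\<^sub>1, \<dots>, v\<^sub>L\<close> under \<open>\<Phi>\<^sub>n \<cdots> \<Phi>\<^sub>1\<close>, that is, of the norm of
  \<open>C(\<Phi>\<^sub>n \<cdots> \<Phi>\<^sub>1) (v\<^sub>1 \<and> \<dots> \<and> v\<^sub>L)\<close>, where \<open>C\<close> denotes the \<open>L\<close>-th compound matrix.

  Strong fast invertibility says that \<open>\<parallel>C(X(t,s))\<parallel> \<parallel>C(X(s,\<tau>))\<parallel>\<close> is at most a constant times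
  \<open>\<parallel>C(X(t,\<tau>))\<parallel>\<close>. Hence every term in the expansion of the product of the perturbed factors
  \<open>C(X(t\<^sub>k,t\<^sub>k\<^sub>-\<^sub>1)) + O(h\<^sub>k powr (p + 1))\<close> is controlled by \<open>\<parallel>C(X(t\<^sub>n,t\<^sub>N))\<parallel>\<close>, and summability of the
  errors makes the norms of \<open>C(\<Phi>\<^sub>n \<cdots> \<Phi>\<^sub>1)\<close> and \<open>C(X(t\<^sub>n))\<close> comparable.

  The norm of \<open>C(X(t))\<close> grows with exponent \<open>\<Lambda>\<^sub>1 + \<dots> + \<Lambda>\<^sub>L\<close>: in a basis of solutions adapted to
  the Lyapunov filtration the upper bound is Hadamard's inequality, and the lower bound follows from
  regularity because the full determinant is at most the volume of the first \<open>L\<close> solutions times the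
  norms of the others.

  Some fixed coordinate minor of \<open>\<Phi>\<^sub>n \<cdots> \<Phi>\<^sub>1\<close> attains this growth for infinitely many \<open>n\<close>. Along a
  line of tuples in the direction of its coordinate tuple it is the leading coefficient of a
  polynomial of degree \<open>L\<close>, so at most \<open>L\<close> tuples on the line can have a smaller exponent. A closed
  set with this property is a null set.\<close>

section \<open>Minors and compound matrices\<close>

text \<open>Volumes spanned by columns, products of singular values and norms of compounds are
  compared only up to constant factors, which vanish after taking logarithms and dividing by the
  grid time.

  A term of the perturbation expansion omits the time interval of the perturbed step, whereas fast
  invertibility concerns adjacent intervals. The exact step is put back by means of a lower bound
  for its compound, which is uniform because \<open>A\<close> and the stepsizes are bounded. The
  product of the errors is close to 1 only from some index \<open>N\<close> on; the fixed invertible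
  matrices before \<open>N\<close> cost a constant factor.

  The minor that realises the growth may change with \<open>n\<close>, so a fixed one is large for
  infinitely many \<open>n\<close> only, which is enough for a limsup. Exceptional tuples have
  minors that are small but need not vanish. Counting roots is therefore replaced by an estimate of
  the leading coefficient whose constant does not depend on \<open>n\<close>. The upper bound for
  the limsup holds for every invertible tuple.\<close>

definition minor :: "'n::finite set \<Rightarrow> ('n \<Rightarrow> 'n) \<Rightarrow> ('n \<Rightarrow> 'n) \<Rightarrow> real^'n^'n \<Rightarrow> real" where
  "minor S f g M = (\<Sum>\<sigma> | \<sigma> permutes S. of_int (sign \<sigma>) * (\<Prod>i\<in>S. M $ f i $ g (\<sigma> i)))"

text \<open>Distributivity; the values of \<open>g\<close> outside \<open>S\<close> do not enter the
  product and are free, which produces the power of \<open>CARD('n)\<close>.\<close>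

lemma prod_sum_functions:
  fixes a :: "'n::finite \<Rightarrow> 'n \<Rightarrow> real"
  shows "(\<Sum>g\<in>UNIV. \<Prod>i\<in>S. a i (g i)) = real CARD('n) ^ card (- S) * (\<Prod>i\<in>S. \<Sum>k\<in>UNIV. a i k)"
proof -
  define b where "b i k = (if i \<in> S then a i k else 1)" for i k
  have 1: "(\<Prod>i\<in>S. a i (g i)) = (\<Prod>i\<in>UNIV. b i (g i))" for g
    unfolding b_def by (intro prod.mono_neutral_cong_left) auto
  have "(\<Sum>g\<in>UNIV. \<Prod>i\<in>UNIV. b i (g i)) = (\<Prod>i\<in>UNIV. \<Sum>k\<in>UNIV. b i k)"
    using prod_sum_PiE[of UNIV "\<lambda>_. UNIV" b] by simp
  also have "\<dots> = (\<Prod>i\<in>S. \<Sum>k\<in>UNIV. b i k) * (\<Prod>i\<in>-S. \<Sum>k\<in>UNIV. b i k)"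
    by (subst prod.union_disjoint[symmetric]) auto
  also have "(\<Prod>i\<in>S. \<Sum>k\<in>UNIV. b i k) = (\<Prod>i\<in>S. \<Sum>k\<in>UNIV. a i k)"
    unfolding b_def by simp
  also have "(\<Prod>i\<in>-S. \<Sum>k\<in>UNIV. b i k) = real CARD('n) ^ card (- S)"
    unfolding b_def by simp
  finally show ?thesis using 1 by simp
qed

lemma minor_alt:
  "minor S f g M = (\<Sum>\<sigma> | \<sigma> permutes S. of_int (sign \<sigma>) * (\<Prod>i\<in>S. M $ f (\<sigma> i) $ g i))"
proof -
  have "minor S f g M =
      (\<Sum>\<sigma> | \<sigma> permutes S. of_int (sign (inv \<sigma>)) * (\<Prod>i\<in>S. M $ f i $ g (inv \<sigma> i)))"
    unfolding minor_def by (rule sum_permutations_inverse)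
  also have "\<dots> = (\<Sum>\<sigma> | \<sigma> permutes S. of_int (sign \<sigma>) * (\<Prod>i\<in>S. M $ f (\<sigma> i) $ g i))"
  proof (intro sum.cong refl, clarsimp)
    fix \<sigma> assume s: "\<sigma> permutes S"
    have "sign (inv \<sigma>) = sign \<sigma>"
      using s sign_inverse permutation_permutes by (metis finite)
    moreover have "(\<Prod>i\<in>S. M $ f i $ g (inv \<sigma> i)) = (\<Prod>i\<in>S. M $ f (\<sigma> i) $ g i)"
      using prod.permute[OF s, of "\<lambda>i. M $ f i $ g (inv \<sigma> i)"] s
      by (simp add: o_def permutes_inverses)
    ultimately show "real_of_int (sign (inv \<sigma>)) * (\<Prod>i\<in>S. M $ f i $ g (inv \<sigma> i)) =
         real_of_int (sign \<sigma>) * (\<Prod>i\<in>S. M $ f (\<sigma> i) $ g i)" by simp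
  qed
  finally show ?thesis .
qed

lemma minor_transpose: "minor S f g (transpose M) = minor S g f M"
  by (subst minor_alt) (simp add: minor_def transpose_def)

lemma minor_permute_rows:
  assumes "\<tau> permutes S"
  shows "minor S (f \<circ> \<tau>) g M = of_int (sign \<tau>) * minor S f g M"
proof -
  have "minor S f g M = (\<Sum>\<sigma> | \<sigma> permutes S. of_int (sign (\<tau> \<circ> \<sigma>)) * (\<Prod>i\<in>S. M $ f ((\<tau> \<circ> \<sigma>) i) $ g i))"
    unfolding minor_alt by (rule setum_permutations_compose_left[OF assms])
  also have "\<dots> = (\<Sum>\<sigma> | \<sigma> permutes S. of_int (sign \<tau>) * (of_int (sign \<sigma>) * (\<Prod>i\<in>S. M $ (f \<circ> \<tau>) (\<sigma> i) $ g i)))"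
    using assms permutes_imp_permutation[of S] by (intro sum.cong refl) (auto simp: sign_compose)
  also have "\<dots> = of_int (sign \<tau>) * minor S (f \<circ> \<tau>) g M"
    by (simp add: minor_alt sum_distrib_left)
  finally show ?thesis by (cases \<tau> rule: sign_cases) auto
qed

text \<open>Swapping two labels with the same row leaves \<open>f\<close> unchanged but reverses the
  sign of the minor.\<close>

lemma minor_not_inj_rows:
  assumes "\<not> inj_on f S"
  shows "minor S f g M = 0"
proof -
  from assms obtain a b where ab: "a \<in> S" "b \<in> S" "a \<noteq> b" "f a = f b"
    by (auto simp: inj_on_def)
  have "f \<circ> Transposition.transpose a b = f"
    using ab by (auto simp: fun_eq_iff Transposition.transpose_def)
  with minor_permute_rows[OF permutes_swap_id[OF ab(1,2)], of f g M] ab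
  show ?thesis by (simp add: sign_swap_id)
qed

lemma minor_not_inj_cols: "\<not> inj_on g S \<Longrightarrow> minor S f g M = 0"
  by (metis minor_not_inj_rows minor_transpose)

text \<open>Half of the Cauchy-Binet formula: after multiplying out, \<open>N\<close> contributes
  whole minors, but \<open>M\<close> still contributes single monomials.\<close>

lemma minor_mult_expand:
  fixes M N :: "real^'n^'n"
  shows "real CARD('n) ^ card (- S) * minor S f h (M ** N) =
    (\<Sum>g\<in>UNIV. (\<Prod>i\<in>S. M $ f i $ g i) * minor S g h N)"
proof -
  have "(\<Sum>g\<in>UNIV. (\<Prod>i\<in>S. M $ f i $ g i) * minor S g h N) =
    (\<Sum>g\<in>UNIV. \<Sum>\<sigma> | \<sigma> permutes S. of_int (sign \<sigma>) * (\<Prod>i\<in>S. M $ f i $ g i * N $ g i $ h (\<sigma> i)))"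
    by (simp add: minor_def sum_distrib_left prod.distrib mult_ac)
  also have "\<dots> = (\<Sum>\<sigma> | \<sigma> permutes S. of_int (sign \<sigma>) *
      (\<Sum>g\<in>UNIV. \<Prod>i\<in>S. M $ f i $ g i * N $ g i $ h (\<sigma> i)))"
    by (subst sum.swap) (simp add: sum_distrib_left)
  also have "\<dots> = real CARD('n) ^ card (- S) * minor S f h (M ** N)"
    unfolding prod_sum_functions[where a = "\<lambda>i k. M $ f i $ k * N $ k $ h (\<sigma> i)" for \<sigma>]
    by (simp add: minor_def matrix_matrix_mult_def sum_distrib_left mult_ac)
  finally show ?thesis by simp
qed

definition minor_weight :: "'n::finite set \<Rightarrow> real" where
  "minor_weight S = fact (card S) * real CARD('n) ^ card (- S)"

lemma minor_weight_pos: "minor_weight S > 0"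
  unfolding minor_weight_def by simp

text \<open>Replacing \<open>g\<close> by \<open>g \<circ> \<tau>\<close> only reorders the
  expansion and multiplies the minor of \<open>N\<close> by the sign of \<tau>. Adding up over all
  permutations \<tau> of \<open>S\<close> collects the monomials in \<open>M\<close> into a minor,
  at the price of the factor \<open>fact (card S)\<close>.\<close>

lemma Cauchy_Binet:
  fixes M N :: "real^'n^'n"
  shows "minor_weight S * minor S f h (M ** N) = (\<Sum>g\<in>UNIV. minor S f g M * minor S g h N)"
proof -
  have bij: "bij (\<lambda>g::'n\<Rightarrow>'n. g \<circ> \<tau>)" if "\<tau> permutes S" for \<tau>
  proof (rule o_bij)
    show "(\<lambda>g. g \<circ> inv \<tau>) \<circ> (\<lambda>g::'n\<Rightarrow>'n. g \<circ> \<tau>) = id"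
      using that by (auto simp: fun_eq_iff permutes_inverses)
    show "(\<lambda>g. g \<circ> \<tau>) \<circ> (\<lambda>g::'n\<Rightarrow>'n. g \<circ> inv \<tau>) = id"
      using that by (auto simp: fun_eq_iff permutes_inverses)
  qed
  have *: "real CARD('n) ^ card (- S) * minor S f h (M ** N) =
      (\<Sum>g\<in>UNIV. of_int (sign \<tau>) * (\<Prod>i\<in>S. M $ f i $ g (\<tau> i)) * minor S g h N)"
    if t: "\<tau> permutes S" for \<tau>
  proof -
    have "(\<Sum>g\<in>UNIV. (\<Prod>i\<in>S. M $ f i $ g i) * minor S g h N) =
      (\<Sum>g\<in>UNIV. (\<Prod>i\<in>S. M $ f i $ (g \<circ> \<tau>) i) * minor S (g \<circ> \<tau>) h N)"
      using sum.reindex_bij_betw[OF bij[OF t], of "\<lambda>g. (\<Prod>i\<in>S. M $ f i $ g i) * minor S g h N"]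
      by simp
    thus ?thesis
      unfolding minor_mult_expand minor_permute_rows[OF t] by (simp add: mult_ac)
  qed
  have "minor_weight S * minor S f h (M ** N) =
      (\<Sum>\<tau> | \<tau> permutes S. real CARD('n) ^ card (- S) * minor S f h (M ** N))"
    by (simp add: minor_weight_def card_permutations)
  also have "\<dots> = (\<Sum>\<tau> | \<tau> permutes S. \<Sum>g\<in>UNIV. of_int (sign \<tau>) * (\<Prod>i\<in>S. M $ f i $ g (\<tau> i)) * minor S g h N)"
    by (intro sum.cong refl *) simp
  also have "\<dots> = (\<Sum>g\<in>UNIV. minor S f g M * minor S g h N)"
    by (subst sum.swap) (simp add: minor_def[of S f _ M] sum_distrib_right)
  finally show ?thesis .
qed

text \<open>The compound matrix is indexed by all functions rather than by increasing index tuples,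
  so every minor occurs \<open>minor_weight S\<close> times up to sign; dividing by this number makes the
  map multiplicative.\<close>
definition compound :: "'n::finite set \<Rightarrow> real^'n^'n \<Rightarrow> real^('n\<Rightarrow>'n)^('n\<Rightarrow>'n)" where
  "compound S M = (\<chi> f g. minor S f g M / minor_weight S)"

text \<open>Coordinates of the exterior product of those columns of \<open>U\<close> whose index
  lies in \<open>S\<close>, each repeated up to sign. The weight in \<open>compound\<close> alone
  makes \<open>wedge_mult\<close> hold.\<close>

definition wedge :: "'n::finite set \<Rightarrow> real^'n^'n \<Rightarrow> real^('n\<Rightarrow>'n)" where
  "wedge S U = (\<chi> f. minor S f id U)"

text \<open>This is Cauchy-Binet after normalisation. The identity is in general not preserved: with
  all functions as indices \<open>compound S (mat 1)\<close> is a projection, and later arguments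
  have to respect this.\<close>

lemma compound_mult: "compound S (M ** N) = compound S M ** compound S N"
  using Cauchy_Binet[of S _ _ M N, symmetric] minor_weight_pos[of S]
  by (simp add: vec_eq_iff compound_def matrix_matrix_mult_def sum_divide_distrib[symmetric])

lemma wedge_mult: "wedge S (M ** N) = compound S M *v wedge S N"
  using Cauchy_Binet[of S _ _ M N, symmetric] minor_weight_pos[of S]
  by (simp add: vec_eq_iff compound_def wedge_def matrix_vector_mult_def sum_divide_distrib[symmetric])

lemma compound_transpose: "compound S (transpose M) = transpose (compound S M)"
  by (simp add: vec_eq_iff compound_def minor_transpose) (simp add: transpose_def compound_def)

section \<open>Norm bounds and Lipschitz estimates for compounds\<close>

lemma norm_matrix_vector_le:
  fixes A :: "real^'n^'m"
  shows "norm (A *v x) \<le> norm A * norm x"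
proof -
  have "norm (A *v x) = L2_set (\<lambda>i. norm (A $ i \<bullet> x)) UNIV"
    by (simp add: norm_vec_def matrix_vector_mul_component)
  also have "\<dots> \<le> L2_set (\<lambda>i. norm (A $ i) * norm x) UNIV"
    by (intro L2_set_mono) (auto simp: Cauchy_Schwarz_ineq2)
  also have "\<dots> = norm A * norm x"
    unfolding norm_vec_def[of A] by (rule L2_set_left_distrib[symmetric]) simp
  finally show ?thesis .
qed

lemma norm_matrix_transpose: "norm (transpose A) = norm (A :: real^'n^'m)"
proof -
  have "(norm (transpose A))\<^sup>2 = (norm A)\<^sup>2"
    unfolding power2_norm_eq_inner inner_vec_def transpose_def
    by simp (rule sum.swap)
  thus ?thesis by simp
qed

lemma norm_matrix_mult_le:
  fixes A :: "real^'n^'m" and B :: "real^'k^'n"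
  shows "norm (A ** B) \<le> norm A * norm B"
proof -
  have row: "(A ** B) $ i = transpose B *v (A $ i)" for i
    by (simp add: vec_eq_iff matrix_matrix_mult_def matrix_vector_mult_def transpose_def mult.commute)
  have "norm (A ** B) = L2_set (\<lambda>i. norm (transpose B *v (A $ i))) UNIV"
    by (simp add: norm_vec_def[of "A ** B"] row)
  also have "\<dots> \<le> L2_set (\<lambda>i. norm (A $ i) * norm B) UNIV"
  proof (rule L2_set_mono)
    show "norm (transpose B *v (A $ i)) \<le> norm (A $ i) * norm B" for i
      using norm_matrix_vector_le[of "transpose B" "A $ i"]
      unfolding norm_matrix_transpose by (simp only: mult.commute)
  qed simp
  also have "\<dots> = norm A * norm B"
    unfolding norm_vec_def[of A] by (rule L2_set_left_distrib[symmetric]) simp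
  finally show ?thesis .
qed

lemma norm_vec_le_card:
  fixes x :: "'a::real_normed_vector^'n"
  assumes "\<And>i. norm (x $ i) \<le> b"
  shows "norm x \<le> real CARD('n) * b"
proof -
  have "norm x \<le> (\<Sum>i\<in>UNIV. norm (x $ i))"
    unfolding norm_vec_def by (rule L2_set_le_sum) simp
  also have "\<dots> \<le> (\<Sum>i\<in>(UNIV::'n set). b)" using assms by (rule sum_mono)
  finally show ?thesis by simp
qed

lemma minor_le_norm_compound: "\<bar>minor S f g M\<bar> \<le> minor_weight S * norm (compound S M)"
proof -
  have "\<bar>minor S f g M\<bar> / minor_weight S = \<bar>compound S M $ f $ g\<bar>"
    using minor_weight_pos[of S] by (simp add: compound_def abs_div)
  also have "\<dots> \<le> norm (compound S M)"
    by (meson component_le_norm_cart Finite_Cartesian_Product.norm_nth_le order_trans)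
  finally show ?thesis using minor_weight_pos[of S] by (simp add: field_simps)
qed

lemma norm_compound_le:
  fixes M :: "real^'n^'n"
  assumes "\<And>f g. \<bar>minor S f g M\<bar> \<le> b"
  shows "norm (compound S M) \<le> (real CARD('n\<Rightarrow>'n))\<^sup>2 / minor_weight S * b"
proof -
  have "norm (compound S M $ f) \<le> real CARD('n\<Rightarrow>'n) * (b / minor_weight S)" for f
    using assms minor_weight_pos[of S]
    by (intro norm_vec_le_card) (auto simp: compound_def abs_div divide_right_mono)
  from norm_vec_le_card[OF this] show ?thesis
    by (simp add: power2_eq_square)
qed

lemma abs_minor_le:
  assumes "\<And>\<sigma>. \<sigma> permutes S \<Longrightarrow> (\<Prod>i\<in>S. \<bar>M $ f i $ g (\<sigma> i)\<bar>) \<le> b"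
  shows "\<bar>minor S f g M\<bar> \<le> fact (card S) * b"
proof -
  have "\<bar>minor S f g M\<bar> \<le> (\<Sum>\<sigma> | \<sigma> permutes S. \<bar>of_int (sign \<sigma>) * (\<Prod>i\<in>S. M $ f i $ g (\<sigma> i))\<bar>)"
    unfolding minor_def by (rule sum_abs)
  also have "\<dots> \<le> (\<Sum>\<sigma> | \<sigma> permutes S. b)"
    using assms by (intro sum_mono) (auto simp: abs_mult abs_prod sign_def)
  finally show ?thesis by (simp add: card_permutations)
qed

lemma minor_entry_bound:
  assumes "\<And>i j. \<bar>M $ i $ j\<bar> \<le> b"
  shows "\<bar>minor S f g M\<bar> \<le> fact (card S) * b ^ card S"
proof (rule abs_minor_le)
  fix \<sigma>
  have "(\<Prod>i\<in>S. \<bar>M $ f i $ g (\<sigma> i)\<bar>) \<le> (\<Prod>i\<in>S. b)"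
    using assms by (intro prod_mono) auto
  thus "(\<Prod>i\<in>S. \<bar>M $ f i $ g (\<sigma> i)\<bar>) \<le> b ^ card S" by simp
qed

text \<open>Hadamard's inequality up to a factor: every Leibniz monomial takes one entry from each
  selected column, and \<open>fact (card S)\<close> counts the monomials.\<close>

lemma minor_column_bound:
  "\<bar>minor S f g M\<bar> \<le> fact (card S) * (\<Prod>i\<in>S. norm (column (g i) M))"
proof (rule abs_minor_le)
  fix \<sigma> assume s: "\<sigma> permutes S"
  have "(\<Prod>i\<in>S. \<bar>M $ f i $ g (\<sigma> i)\<bar>) \<le> (\<Prod>i\<in>S. norm (column (g (\<sigma> i)) M))"
    using component_le_norm_cart[of "column (g (\<sigma> _)) M" "f _"]
    by (intro prod_mono) (auto simp: column_def)
  also have "\<dots> = (\<Prod>i\<in>S. norm (column (g i) M))"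
    using prod.permute[OF s, of "\<lambda>i. norm (column (g i) M)"] by (simp add: o_def)
  finally show "(\<Prod>i\<in>S. \<bar>M $ f i $ g (\<sigma> i)\<bar>) \<le> (\<Prod>i\<in>S. norm (column (g i) M))" .
qed

text \<open>The factors are exchanged one at a time. Since \<open>1 \<le> b\<close>, missing powers
  of \<open>b\<close> can be filled up, so all exchanges get the same bound.\<close>

lemma abs_prod_diff_le:
  fixes x y :: "'i \<Rightarrow> real"
  assumes "finite I" "1 \<le> b" "0 \<le> e"
    and "\<And>i. i \<in> I \<Longrightarrow> \<bar>x i\<bar> \<le> b" "\<And>i. i \<in> I \<Longrightarrow> \<bar>y i\<bar> \<le> b" "\<And>i. i \<in> I \<Longrightarrow> \<bar>x i - y i\<bar> \<le> e"
  shows "\<bar>(\<Prod>i\<in>I. x i) - (\<Prod>i\<in>I. y i)\<bar> \<le> real (card I) * b ^ card I * e"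
  using assms(1,4-6)
proof (induction I)
  case (insert a I)
  have "(\<Prod>i\<in>insert a I. x i) - (\<Prod>i\<in>insert a I. y i) =
      x a * ((\<Prod>i\<in>I. x i) - (\<Prod>i\<in>I. y i)) + (x a - y a) * (\<Prod>i\<in>I. y i)"
    using insert.hyps by (simp add: algebra_simps)
  also have "\<bar>\<dots>\<bar> \<le> b * (real (card I) * b ^ card I * e) + e * b ^ card I"
  proof (intro order_trans[OF abs_triangle_ineq] add_mono)
    show "\<bar>x a * ((\<Prod>i\<in>I. x i) - (\<Prod>i\<in>I. y i))\<bar> \<le> b * (real (card I) * b ^ card I * e)"
      unfolding abs_mult using insert assms(2) by (intro mult_mono) auto
    have "(\<Prod>i\<in>I. \<bar>y i\<bar>) \<le> (\<Prod>i\<in>I. b)" using insert by (intro prod_mono) auto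
    thus "\<bar>(x a - y a) * (\<Prod>i\<in>I. y i)\<bar> \<le> e * b ^ card I"
      unfolding abs_mult abs_prod using insert assms(3) by (intro mult_mono) (auto intro: prod_nonneg)
  qed
  also have "\<dots> \<le> real (card (insert a I)) * b ^ card (insert a I) * e"
  proof -
    have "b ^ card I \<le> b ^ Suc (card I)" using assms(2) by (intro power_increasing) auto
    hence "e * b ^ card I \<le> e * b ^ Suc (card I)" using assms(3) by (rule mult_left_mono)
    thus ?thesis using insert.hyps by (simp add: algebra_simps)
  qed
  finally show ?case .
qed simp

lemma minor_lipschitz:
  assumes "1 \<le> b" "0 \<le> e"
    and M: "\<And>i j. \<bar>M $ i $ j\<bar> \<le> b" and N: "\<And>i j. \<bar>N $ i $ j\<bar> \<le> b"
    and d: "\<And>i j. \<bar>M $ i $ j - N $ i $ j\<bar> \<le> e"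
  shows "\<bar>minor S f g M - minor S f g N\<bar> \<le> fact (card S) * (real (card S) * b ^ card S * e)"
proof -
  have "\<bar>minor S f g M - minor S f g N\<bar> \<le>
    (\<Sum>\<sigma> | \<sigma> permutes S. \<bar>of_int (sign \<sigma>) * ((\<Prod>i\<in>S. M $ f i $ g (\<sigma> i)) - (\<Prod>i\<in>S. N $ f i $ g (\<sigma> i)))\<bar>)"
    unfolding minor_def sum_subtractf[symmetric] right_diff_distrib[symmetric] by (rule sum_abs)
  also have "\<dots> \<le> (\<Sum>\<sigma> | \<sigma> permutes S. real (card S) * b ^ card S * e)"
  proof (rule sum_mono)
    fix \<sigma>
    show "\<bar>of_int (sign \<sigma>) * ((\<Prod>i\<in>S. M $ f i $ g (\<sigma> i)) - (\<Prod>i\<in>S. N $ f i $ g (\<sigma> i)))\<bar>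
        \<le> real (card S) * b ^ card S * e"
      using abs_prod_diff_le[of S b e "\<lambda>i. M $ f i $ g (\<sigma> i)" "\<lambda>i. N $ f i $ g (\<sigma> i)"] assms
      by (auto simp: abs_mult sign_def)
  qed
  finally show ?thesis by (simp add: card_permutations)
qed

text \<open>Carries the local error of a one-step method over to compounds: the bound is linear in
  \<open>e\<close>, and its constant depends on the matrices only through \<open>b\<close>.\<close>

lemma compound_lipschitz:
  fixes M N :: "real^'n^'n"
  assumes "1 \<le> b" "0 \<le> e"
    and "\<And>i j. \<bar>M $ i $ j\<bar> \<le> b" "\<And>i j. \<bar>N $ i $ j\<bar> \<le> b"
    and "\<And>i j. \<bar>M $ i $ j - N $ i $ j\<bar> \<le> e"
  shows "norm (compound S M - compound S N) \<le>
    (real CARD('n\<Rightarrow>'n))\<^sup>2 / minor_weight S * (fact (card S) * (real (card S) * b ^ card S * e))"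
proof -
  let ?b = "fact (card S) * (real (card S) * b ^ card S * e)"
  have "norm ((compound S M - compound S N) $ f) \<le> real CARD('n\<Rightarrow>'n) * (?b / minor_weight S)" for f
    using minor_lipschitz[OF assms, of S] minor_weight_pos[of S]
    by (intro norm_vec_le_card)
      (auto simp: compound_def diff_divide_distrib[symmetric] abs_div intro!: divide_right_mono)
  from norm_vec_le_card[OF this] show ?thesis
    by (simp add: power2_eq_square)
qed

lemma norm_compound_entry_bound:
  fixes M :: "real^'n^'n"
  assumes "\<And>i j. \<bar>M $ i $ j\<bar> \<le> b"
  shows "norm (compound S M) \<le> (real CARD('n\<Rightarrow>'n))\<^sup>2 / minor_weight S * (fact (card S) * b ^ card S)"
  by (rule norm_compound_le) (rule minor_entry_bound[OF assms])

lemma minor_diagonal: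
  assumes "\<And>i j. i \<noteq> j \<Longrightarrow> M $ i $ j = 0"
  shows "minor S f f M = (if inj_on f S then \<Prod>i\<in>S. M $ f i $ f i else 0)"
proof (cases "inj_on f S")
  case True
  have "minor S f f M = (\<Sum>\<sigma>\<in>{id}. of_int (sign \<sigma>) * (\<Prod>i\<in>S. M $ f i $ f (\<sigma> i)))"
    unfolding minor_def
  proof (rule sum.mono_neutral_right)
    show "\<forall>\<sigma>\<in>{\<sigma>. \<sigma> permutes S} - {id}. of_int (sign \<sigma>) * (\<Prod>i\<in>S. M $ f i $ f (\<sigma> i)) = 0"
    proof
      fix \<sigma> assume s: "\<sigma> \<in> {\<sigma>. \<sigma> permutes S} - {id}"
      then obtain i where i: "i \<in> S" "\<sigma> i \<noteq> i"
        by (metis Diff_iff eq_id_iff insertI1 mem_Collect_eq permutes_not_in)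
      with s have "\<sigma> i \<in> S" by (simp add: permutes_in_image)
      with i True have "f i \<noteq> f (\<sigma> i)" by (metis inj_onD)
      with assms i have "M $ f i $ f (\<sigma> i) = 0" by blast
      with i show "of_int (sign \<sigma>) * (\<Prod>i\<in>S. M $ f i $ f (\<sigma> i)) = 0"
        by (auto intro: prod_zero)
    qed
  qed (auto simp: finite_permutations)
  with True show ?thesis by (simp add: sign_id)
qed (simp add: minor_not_inj_rows)

text \<open>Worth checking because this matrix is only a projection; it is the source of the
  positivity of all compounds of invertible matrices.\<close>

lemma compound_mat_1_nonzero: "compound S (mat 1 :: real^'n^'n) \<noteq> 0"
proof
  assume "compound S (mat 1 :: real^'n^'n) = 0"
  hence "minor S id id (mat 1 :: real^'n^'n) = 0"
    using minor_le_norm_compound[of S id id "mat 1 :: real^'n^'n"] by simp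
  thus False by (subst (asm) minor_diagonal) (auto simp: mat_def)
qed

section \<open>QR decompositions\<close>

lemma permutes_ge_imp_id:
  fixes \<sigma> :: "'n::{finite,linorder} \<Rightarrow> 'n"
  assumes s: "\<sigma> permutes S" and ge: "\<And>i. i \<in> S \<Longrightarrow> i \<le> \<sigma> i"
  shows "\<sigma> = id"
proof (rule ccontr)
  assume "\<sigma> \<noteq> id"
  hence ne: "{i. \<sigma> i \<noteq> i} \<noteq> {}" by (auto simp: fun_eq_iff)
  \<comment> \<open>The largest moved index is sent to a larger one, which is then fixed; this
    contradicts injectivity.\<close>
  define i where "i = Max {i. \<sigma> i \<noteq> i}"
  have i: "\<sigma> i \<noteq> i" using Max_in[OF _ ne] by (simp add: i_def)
  hence "i \<in> S" using s permutes_not_in by metis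
  with ge i have "i < \<sigma> i" by (metis order_le_imp_less_or_eq)
  hence "\<sigma> (\<sigma> i) = \<sigma> i"
    using Max_ge[of "{i. \<sigma> i \<noteq> i}" "\<sigma> i"] unfolding i_def by fastforce
  with i permutes_inj[OF s] show False by (auto dest: injD)
qed

definition upper_triangular :: "'n::{finite,linorder} square \<Rightarrow> bool" where
  "upper_triangular R \<longleftrightarrow> (\<forall>i j. j < i \<longrightarrow> R $ i $ j = 0)"

lemma minor_upper_triangular:
  fixes R :: "'n::{finite,linorder} square"
  assumes "upper_triangular R"
  shows "minor S id id R = (\<Prod>i\<in>S. R $ i $ i)"
proof -
  have "minor S id id R = (\<Sum>\<sigma>\<in>{id}. of_int (sign \<sigma>) * (\<Prod>i\<in>S. R $ id i $ id (\<sigma> i)))"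
    unfolding minor_def
  proof (rule sum.mono_neutral_right)
    show "\<forall>\<sigma>\<in>{\<sigma>. \<sigma> permutes S} - {id}. of_int (sign \<sigma>) * (\<Prod>i\<in>S. R $ id i $ id (\<sigma> i)) = 0"
    proof
      fix \<sigma> assume s: "\<sigma> \<in> {\<sigma>. \<sigma> permutes S} - {id}"
      then obtain i where "i \<in> S" "\<not> i \<le> \<sigma> i" using permutes_ge_imp_id by blast
      with assms show "of_int (sign \<sigma>) * (\<Prod>i\<in>S. R $ id i $ id (\<sigma> i)) = 0"
        by (auto intro!: prod_zero bexI[of _ i] simp: upper_triangular_def)
    qed
  qed (auto simp: finite_permutations)
  thus ?thesis by (simp add: sign_id)
qed

definition down_closed :: "'n::{finite,linorder} set \<Rightarrow> bool" where
  "down_closed S \<longleftrightarrow> (\<forall>i\<in>S. \<forall>j\<le>i. j \<in> S)"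

text \<open>The columns of \<open>R\<close> with index in an initial segment \<open>S\<close> are
  supported in the rows of \<open>S\<close>. Hence only row selections that permute \<open>S\<close>
  contribute, and these give the diagonal product up to sign.\<close>

lemma abs_minor_upper_triangular_le:
  fixes R :: "'n::{finite,linorder} square"
  assumes R: "upper_triangular R" and S: "down_closed S" and pos: "\<And>i. R $ i $ i \<ge> 0"
  shows "\<bar>minor S g id R\<bar> \<le> (\<Prod>i\<in>S. R $ i $ i)"
proof -
  have nn: "0 \<le> (\<Prod>i\<in>S. R $ i $ i)" using pos by (simp add: prod_nonneg)
  consider "\<not> inj_on g S" | i where "i \<in> S" "g i \<notin> S" | "inj_on g S" "g ` S \<subseteq> S" by auto
  thus ?thesis
  proof cases
    case 1
    thus ?thesis using nn by (simp add: minor_not_inj_rows)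
  next
    case (2 i)
    have "(\<Prod>i\<in>S. R $ g i $ id (\<sigma> i)) = 0" if "\<sigma> permutes S" for \<sigma>
    proof -
      have "\<sigma> i \<in> S" using that 2 by (simp add: permutes_in_image)
      hence "\<sigma> i < g i" using S 2 unfolding down_closed_def by (meson not_le)
      thus ?thesis using R 2 by (auto intro!: prod_zero simp: upper_triangular_def)
    qed
    hence "minor S g id R = 0" unfolding minor_def by (intro sum.neutral) simp
    thus ?thesis using nn by simp
  next
    case 3
    define \<tau> where "\<tau> i = (if i \<in> S then g i else i)" for i
    have "g ` S = S" using 3 by (simp add: endo_inj_surj)
    hence "bij_betw \<tau> S S"
      using 3 unfolding bij_betw_def \<tau>_def inj_on_def by auto
    hence \<tau>: "\<tau> permutes S" by (intro bij_imp_permutes) (auto simp: \<tau>_def)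
    have "minor S g id R = minor S (id \<circ> \<tau>) id R"
      unfolding minor_def by (intro sum.cong refl) (simp add: \<tau>_def cong: prod.cong)
    thus ?thesis
      unfolding minor_permute_rows[OF \<tau>] minor_upper_triangular[OF R]
      using nn by (simp add: abs_mult sign_def)
  qed
qed

text \<open>Gram-Schmidt: \<open>z i\<close> is the component of column \<open>i\<close> orthogonal
  to the span of the earlier columns; normalised, these vectors are the columns of
  \<open>Q\<close>.\<close>

lemma is_QR_exists:
  fixes M :: "'n::{finite,linorder} square"
  assumes "invertible M"
  shows "\<exists>Q R. is_QR M Q R"
proof -
  let ?c = "\<lambda>i. column i M"
  let ?S = "\<lambda>i. ?c ` {j. j < i}"
  obtain B where B: "B ** M = mat 1" using assms by (auto simp: invertible_def)
  have Bc: "B *v ?c j = axis j 1" for j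
  proof -
    have "B *v ?c j = column j (B ** M)"
      by (simp add: vec_eq_iff column_def matrix_matrix_mult_def matrix_vector_mult_def)
    thus ?thesis by (simp add: B vec_eq_iff column_def mat_def axis_def)
  qed
  have "\<exists>y z. y \<in> span (?S i) \<and> (\<forall>w \<in> span (?S i). orthogonal z w) \<and> ?c i = y + z" for i
    by (metis orthogonal_subspace_decomp_exists)
  then obtain y z where y: "\<And>i. y i \<in> span (?S i)"
    and z: "\<And>i w. w \<in> span (?S i) \<Longrightarrow> z i \<bullet> w = 0" and yz: "\<And>i. ?c i = y i + z i"
    unfolding orthogonal_def by metis
  have z0: "z i \<noteq> 0" for i
  proof
    assume "z i = 0"
    hence "?c i \<in> span (?S i)" using y[of i] yz[of i] by simp
    \<comment> \<open>\<open>B\<close> sends the columns of \<open>M\<close> to unit coordinate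
      vectors, so the \<open>i\<close>-th coordinate of \<open>B *v x\<close> is 0 on all earlier
      columns but 1 on column \<open>i\<close>.\<close>
    also have "span (?S i) \<subseteq> {x. (B *v x) $ i = 0}"
      by (intro span_minimal)
        (auto simp: Bc subspace_def matrix_vector_right_distrib matrix_vector_mult_scaleR axis_def)
    finally show False by (simp add: Bc)
  qed
  define q where "q i = (1 / norm (z i)) *\<^sub>R z i" for i
  define Q where "Q = (\<chi> k i. q i $ k)"
  have c_in: "?c j \<in> span (?S i)" if "j < i" for i j
    using that by (intro span_base) auto
  have z_in: "z j \<in> span (?S i)" if "j < i" for i j
  proof -
    have "y j \<in> span (?S i)"
      using y[of j] that span_mono[of "?S j" "?S i"] by fastforce
    moreover have "z j = ?c j - y j" using yz[of j] by simp
    ultimately show ?thesis using c_in[OF that] by (simp add: span_diff)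
  qed
  have colQ: "column i Q = q i" for i by (simp add: Q_def column_def vec_eq_iff)
  have orth: "z i \<bullet> z j = 0" if "i \<noteq> j" for i j
    using that z[OF z_in, of j i] z[OF z_in, of i j]
    by (cases i j rule: linorder_cases) (auto simp: inner_commute)
  have Q: "orthogonal_matrix Q"
    using orth z0 unfolding orthogonal_matrix_orthonormal_columns colQ
    by (auto simp: q_def orthogonal_def)
  define R where "R = transpose Q ** M"
  have Rij: "R $ i $ j = z i \<bullet> ?c j / norm (z i)" for i j
    by (simp add: R_def Q_def q_def matrix_matrix_mult_def transpose_def inner_vec_def column_def
        sum_divide_distrib)
  have "z i \<bullet> ?c i = (norm (z i))\<^sup>2" for i
    using z[OF y, of i] by (subst yz) (simp add: inner_add_right power2_norm_eq_inner)
  hence "R $ i $ i > 0" for i using z0[of i] by (simp add: Rij)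
  moreover have "R $ i $ j = 0" if "j < i" for i j
    using z[OF c_in[OF that]] by (simp add: Rij)
  moreover have "M = Q ** R"
    using Q by (simp add: R_def orthogonal_matrix_def matrix_mul_assoc)
  ultimately show ?thesis using Q unfolding is_QR_def by blast
qed

text \<open>\<open>T\<close> is orthogonal with \<open>T ** R1 = R2\<close>. Column by column it is
  the identity: below the diagonal by triangularity, above it by orthogonality to the columns
  already known, and on it by positivity.\<close>

lemma is_QR_unique:
  fixes M :: "'n::{finite,linorder} square"
  assumes 1: "is_QR M Q1 R1" and 2: "is_QR M Q2 R2"
  shows "Q1 = Q2 \<and> R1 = R2"
proof -
  define T where "T = transpose Q2 ** Q1"
  have o1: "orthogonal_matrix Q1" and o2: "orthogonal_matrix Q2"
    using 1 2 by (auto simp: is_QR_def)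
  have q2: "transpose Q2 ** Q2 = mat 1" "Q2 ** transpose Q2 = mat 1"
    using o2 by (auto simp: orthogonal_matrix_def)
  have u1: "R1 $ i $ j = 0" and u2: "R2 $ i $ j = 0" if "j < i" for i j
    using 1 2 that by (auto simp: is_QR_def)
  have p1: "R1 $ i $ i > 0" and p2: "R2 $ i $ i > 0" for i
    using 1 2 by (auto simp: is_QR_def)
  have TR: "T ** R1 = R2"
    using 1 2 q2 unfolding is_QR_def T_def
    by (metis matrix_mul_assoc matrix_mul_lid)
  have oT: "transpose T ** T = mat 1"
    using o1 q2 unfolding T_def orthogonal_matrix_def
    by (metis matrix_mul_assoc matrix_mul_rid matrix_transpose_mul transpose_transpose)
  \<comment> \<open>The columns are treated in increasing order; the number of smaller indices is
    the induction measure.\<close>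
  have T_col: "T $ i $ j = (if i = j then 1 else 0)" for i j
  proof (induction j arbitrary: i rule: measure_induct_rule[of "\<lambda>j. card {k. k < j}"])
    case (less j)
    have IH: "T $ i $ k = (if i = k then 1 else 0)" if "k < j" for i k
    proof -
      have "card {l. l < k} < card {l. l < j}"
        using that by (intro psubset_card_mono) auto
      thus ?thesis by (rule less)
    qed
    have TRij: "R2 $ i $ j = (if i < j then R1 $ i $ j else 0) + T $ i $ j * R1 $ j $ j" for i
    proof -
      have "R2 $ i $ j = (\<Sum>k\<in>UNIV. T $ i $ k * R1 $ k $ j)"
        by (simp add: TR[symmetric] matrix_matrix_mult_def)
      also have "\<dots> = (\<Sum>k\<in>UNIV. (if k = i then (if i < j then R1 $ i $ j else 0) else 0) +
          (if k = j then T $ i $ j * R1 $ j $ j else 0))"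
      proof (rule sum.cong[OF refl])
        fix k
        show "T $ i $ k * R1 $ k $ j = (if k = i then (if i < j then R1 $ i $ j else 0) else 0) +
          (if k = j then T $ i $ j * R1 $ j $ j else 0)"
          using IH[of k i] u1[of j k] by (cases k j rule: linorder_cases) auto
      qed
      finally show ?thesis by (simp add: sum.distrib)
    qed
    have off: "T $ i $ j = 0" if "i \<noteq> j" for i
    proof (cases "i < j")
      case True
      have "0 = (transpose T ** T) $ i $ j" using oT that by (simp add: mat_def)
      also have "\<dots> = (\<Sum>k\<in>UNIV. T $ k $ i * T $ k $ j)"
        by (simp add: matrix_matrix_mult_def transpose_def)
      also have "\<dots> = (\<Sum>k\<in>UNIV. if k = i then T $ k $ j else 0)"
        by (intro sum.cong) (auto simp: IH[OF True])
      also have "\<dots> = T $ i $ j" by simp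
      finally show ?thesis by simp
    next
      case False
      with that TRij[of i] u2[of j i] p1[of j] show ?thesis by auto
    qed
    have "1 = (transpose T ** T) $ j $ j" using oT by (simp add: mat_def)
    also have "\<dots> = (\<Sum>k\<in>UNIV. T $ k $ j * T $ k $ j)"
      by (simp add: matrix_matrix_mult_def transpose_def)
    also have "\<dots> = (\<Sum>k\<in>UNIV. if k = j then T $ j $ j * T $ j $ j else 0)"
      using off by (intro sum.cong) auto
    finally have "(T $ j $ j)\<^sup>2 = 1" by (simp add: power2_eq_square)
    moreover have "T $ j $ j > 0"
      using TRij[of j] p1[of j] p2[of j] by (simp add: zero_less_mult_iff)
    ultimately have "T $ j $ j = 1" by (simp add: power2_eq_1_iff)
    with off show ?case by auto
  qed
  hence "T = mat 1" by (simp add: vec_eq_iff mat_def)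
  with TR have "R1 = R2" by simp
  moreover have "Q2 ** T = Q1" unfolding T_def matrix_mul_assoc q2 by simp
  ultimately show ?thesis using \<open>T = mat 1\<close> by simp
qed

lemma is_QR_QR:
  assumes "invertible M"
  shows "is_QR M (fst (QR M)) (snd (QR M))"
proof -
  obtain Q R where "is_QR M Q R" using is_QR_exists[OF assms] by blast
  hence "case THE (Q, R). is_QR M Q R of (Q, R) \<Rightarrow> is_QR M Q R"
    by (intro theI[where P = "\<lambda>(Q, R). is_QR M Q R" and a = "(Q, R)"])
      (auto dest: is_QR_unique)
  thus ?thesis unfolding QR_def by (simp add: case_prod_unfold)
qed

lemma is_QR_upper: "is_QR M Q R \<Longrightarrow> upper_triangular R"
  by (simp add: is_QR_def upper_triangular_def)

text \<open>Both quantities measure the volume spanned by the columns in \<open>S\<close>.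
  Orthogonal matrices have entries of modulus at most 1, so their compounds are bounded;
  \<open>Q\<close> and its transpose then translate between \<open>M\<close> and \<open>R\<close>
  with a constant independent of \<open>M\<close>.\<close>

lemma prod_diagonal_QR_comparable:
  fixes S :: "'n::{finite,linorder} set"
  assumes S: "down_closed S"
  shows "\<exists>c>0. \<forall>M Q R. is_QR M Q R \<longrightarrow>
    (\<Prod>i\<in>S. R $ i $ i) \<le> c * norm (wedge S M) \<and> norm (wedge S M) \<le> c * (\<Prod>i\<in>S. R $ i $ i)"
proof -
  define a where "a = (real CARD('n\<Rightarrow>'n))\<^sup>2 / minor_weight S * (fact (card S) * 1 ^ card S)"
  define b where "b = real CARD('n\<Rightarrow>'n)"
  have ab: "a \<ge> 0" "b \<ge> 0" using minor_weight_pos[of S] by (auto simp: a_def b_def)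
  have na: "norm (compound S Q) \<le> a" if "orthogonal_matrix Q" for Q :: "'n square"
    unfolding a_def
  proof (rule norm_compound_entry_bound)
    fix i j
    have "\<bar>Q $ i $ j\<bar> \<le> norm (column j Q)"
      using component_le_norm_cart[of "column j Q" i] by (simp add: column_def)
    also have "norm (column j Q) = 1"
      using that by (simp add: orthogonal_matrix_orthonormal_columns)
    finally show "\<bar>Q $ i $ j\<bar> \<le> 1" .
  qed
  have "(\<Prod>i\<in>S. R $ i $ i) \<le> a * norm (wedge S M) \<and> norm (wedge S M) \<le> a * b * (\<Prod>i\<in>S. R $ i $ i)"
    if qr: "is_QR M Q R" for M Q R
  proof
    have M: "M = Q ** R" and o: "orthogonal_matrix Q" using qr by (auto simp: is_QR_def)
    have pos: "R $ i $ i \<ge> 0" for i using qr by (auto simp: is_QR_def less_imp_le)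
    have "R = transpose Q ** M"
      using o unfolding M orthogonal_matrix_def by (simp add: matrix_mul_assoc)
    hence w: "wedge S R = compound S (transpose Q) *v wedge S M" by (simp add: wedge_mult)
    have "(\<Prod>i\<in>S. R $ i $ i) = \<bar>wedge S R $ id\<bar>"
      using pos by (simp add: wedge_def minor_upper_triangular[OF is_QR_upper[OF qr]] prod_nonneg)
    also have "\<dots> \<le> norm (wedge S R)" by (rule component_le_norm_cart)
    also have "\<dots> \<le> norm (compound S (transpose Q)) * norm (wedge S M)"
      unfolding w by (rule norm_matrix_vector_le)
    also have "\<dots> \<le> a * norm (wedge S M)"
      using na[of "transpose Q"] o by (intro mult_right_mono) (auto simp: orthogonal_matrix_transpose)
    finally show "(\<Prod>i\<in>S. R $ i $ i) \<le> a * norm (wedge S M)" .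
    have "norm (wedge S M) \<le> norm (compound S Q) * norm (wedge S R)"
      unfolding M wedge_mult by (rule norm_matrix_vector_le)
    also have "\<dots> \<le> a * (b * (\<Prod>i\<in>S. R $ i $ i))"
      using na[OF o] ab abs_minor_upper_triangular_le[OF is_QR_upper[OF qr] S pos]
      unfolding b_def by (intro mult_mono norm_vec_le_card) (auto simp: wedge_def)
    finally show "norm (wedge S M) \<le> a * b * (\<Prod>i\<in>S. R $ i $ i)" by (simp add: mult_ac)
  qed
  note * = this
  show ?thesis
  proof (intro exI[of _ "a + a * b + 1"] conjI allI impI)
    show "0 < a + a * b + 1" using ab by (simp add: add_nonneg_pos)
    fix M Q R :: "'n square" assume qr: "is_QR M Q R"
    have pos: "(\<Prod>i\<in>S. R $ i $ i) \<ge> 0"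
      using qr by (auto simp: is_QR_def less_imp_le intro!: prod_nonneg)
    have "a * norm (wedge S M) \<le> (a + a * b + 1) * norm (wedge S M)"
      using ab by (intro mult_right_mono) auto
    with * qr show "(\<Prod>i\<in>S. R $ i $ i) \<le> (a + a * b + 1) * norm (wedge S M)"
      by (meson order_trans)
    have "a * b * (\<Prod>i\<in>S. R $ i $ i) \<le> (a + a * b + 1) * (\<Prod>i\<in>S. R $ i $ i)"
      using ab pos by (intro mult_right_mono) auto
    with * qr show "norm (wedge S M) \<le> (a + a * b + 1) * (\<Prod>i\<in>S. R $ i $ i)"
      by (meson order_trans)
  qed
qed

text \<open>A diagonal entry of \<open>R\<close> is at most the length of its column, and
  \<open>Q\<close> preserves lengths. Using this only outside \<open>S\<close> isolates the volume
  of the columns in \<open>S\<close>, which is what the lower growth bound needs.\<close>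

lemma abs_det_le_QR:
  fixes M :: "'n::{finite,linorder} square"
  assumes qr: "is_QR M Q R"
  shows "\<bar>det M\<bar> \<le> (\<Prod>i\<in>S. R $ i $ i) * (\<Prod>i\<in>-S. norm (column i M))"
proof -
  have M: "M = Q ** R" and o: "orthogonal_matrix Q" using qr by (auto simp: is_QR_def)
  have pos: "R $ i $ i \<ge> 0" for i using qr by (auto simp: is_QR_def less_imp_le)
  have "det R = minor UNIV id id R" by (simp add: det_def minor_def)
  also have "\<dots> = (\<Prod>i\<in>UNIV. R $ i $ i)" by (rule minor_upper_triangular[OF is_QR_upper[OF qr]])
  finally have "\<bar>det M\<bar> = (\<Prod>i\<in>UNIV. R $ i $ i)"
    using det_orthogonal_matrix[OF o] pos by (auto simp: M det_mul abs_mult prod_nonneg)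
  also have "\<dots> = (\<Prod>i\<in>S. R $ i $ i) * (\<Prod>i\<in>-S. R $ i $ i)"
    by (subst prod.union_disjoint[symmetric]) auto
  also have "\<dots> \<le> (\<Prod>i\<in>S. R $ i $ i) * (\<Prod>i\<in>-S. norm (column i M))"
  proof (intro mult_left_mono prod_mono conjI prod_nonneg pos)
    fix i
    have "column i M = Q *v column i R"
      by (simp add: M vec_eq_iff column_def matrix_matrix_mult_def matrix_vector_mult_def)
    moreover have "orthogonal_transformation ((*v) Q)"
      using o by (simp add: orthogonal_transformation_matrix)
    ultimately have "norm (column i M) = norm (column i R)"
      by (simp add: orthogonal_transformation_norm)
    thus "R $ i $ i \<le> norm (column i M)"
      using component_le_norm_cart[of "column i R" i] by (simp add: column_def)
  qed
  finally show ?thesis .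
qed

section \<open>Singular values\<close>

text \<open>A maximiser \<open>x\<close> of the Rayleigh quotient on the unit sphere of
  \<open>V\<close> works: with the maximum \<open>c\<close>, the form
  \<open>c * (y \<bullet> y) - y \<bullet> T y\<close> is nonnegative on \<open>V\<close> and
  vanishes at \<open>x\<close>, so its derivative in the direction of the residual \<open>r\<close>
  is 0, which forces \<open>r = 0\<close>.\<close>

lemma symmetric_eigenvector_exists:
  fixes T :: "real^'n \<Rightarrow> real^'n"
  assumes lin: "linear T" and sym: "\<And>x y. T x \<bullet> y = x \<bullet> T y"
    and V: "subspace V" "T ` V \<subseteq> V" "V \<noteq> {0}"
  shows "\<exists>x\<in>V. norm x = 1 \<and> (\<exists>c. T x = c *\<^sub>R x)"
proof -
  let ?K = "V \<inter> sphere 0 1"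
  have "compact ?K" using V(1) by (intro closed_Int_compact closed_subspace) auto
  moreover obtain v where v: "v \<in> V" "v \<noteq> 0" using V subspace_0 by fastforce
  hence "(1 / norm v) *\<^sub>R v \<in> ?K" using V by (simp add: subspace_scale)
  hence "?K \<noteq> {}" by blast
  moreover have "continuous_on ?K (\<lambda>x. x \<bullet> T x)"
    using lin by (intro continuous_intros linear_continuous_on) (simp add: linear_conv_bounded_linear)
  ultimately have "\<exists>x\<in>?K. \<forall>y\<in>?K. y \<bullet> T y \<le> x \<bullet> T x"
    by (rule continuous_attains_sup)
  then obtain x where x: "x \<in> ?K" and mx: "\<And>y. y \<in> ?K \<Longrightarrow> y \<bullet> T y \<le> x \<bullet> T x"
    by blast
  define c where "c = x \<bullet> T x"
  have xV: "x \<in> V" and xn: "x \<bullet> x = 1" using x by (auto simp: norm_eq_1)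
  have q: "y \<bullet> T y \<le> c * (y \<bullet> y)" if "y \<in> V" for y
  proof (cases "y = 0")
    case False
    let ?u = "(1 / norm y) *\<^sub>R y"
    have "?u \<in> ?K" using that False V by (simp add: subspace_scale)
    from mx[OF this] have "(y \<bullet> T y) / (norm y * norm y) \<le> c"
      using lin by (simp add: linear_scale c_def)
    thus ?thesis using False by (simp add: divide_le_eq flip: power2_eq_square power2_norm_eq_inner)
  qed (use lin in \<open>simp add: linear_0\<close>)
  define r where "r = c *\<^sub>R x - T x"
  have rV: "r \<in> V" using V xV by (auto simp: r_def intro!: subspace_diff subspace_scale)
  define b where "b = c * (r \<bullet> r) - r \<bullet> T r"
  have b: "b \<ge> 0" using q[OF rV] by (simp add: b_def)
  have ineq: "0 \<le> 2 * s * (r \<bullet> r) + s\<^sup>2 * b" for s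
  proof -
    have "x + s *\<^sub>R r \<in> V" using V xV rV by (simp add: subspace_add subspace_scale)
    from q[OF this] have "0 \<le> c * ((x + s *\<^sub>R r) \<bullet> (x + s *\<^sub>R r)) - (x + s *\<^sub>R r) \<bullet> T (x + s *\<^sub>R r)"
      by simp
    also have "\<dots> = 2 * s * (r \<bullet> (c *\<^sub>R x - T x)) + s\<^sup>2 * b"
      using lin sym[of r x] xn
      by (simp add: linear_add linear_scale inner_add_left inner_add_right inner_diff_right b_def
          inner_commute c_def power2_eq_square algebra_simps)
    finally show ?thesis by (simp add: r_def)
  qed
  have "r \<bullet> r = 0"
  proof (rule ccontr)
    assume "r \<bullet> r \<noteq> 0"
    hence rr: "r \<bullet> r > 0" by simp
    \<comment> \<open>\<open>b\<close> may be 0, hence the shift by 1. At the parameter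
      \<open>?s\<close> the linear term outweighs the quadratic one.\<close>
    define d where "d = b + 1"
    have d: "d > 0" "b \<le> d" using b by (auto simp: d_def)
    let ?s = "- (r \<bullet> r) / d"
    have "2 * ?s * (r \<bullet> r) + ?s\<^sup>2 * b \<le> 2 * ?s * (r \<bullet> r) + ?s\<^sup>2 * d"
      using d by (intro add_left_mono mult_left_mono) auto
    also have "\<dots> = - ((r \<bullet> r)\<^sup>2 / d)" using d by (simp add: field_simps power2_eq_square)
    also have "\<dots> < 0" using rr d by simp
    finally show False using ineq[of ?s] by simp
  qed
  hence "T x = c *\<^sub>R x" by (simp add: r_def)
  with x show ?thesis by auto
qed

text \<open>Induction on the dimension: by symmetry the orthogonal complement of an eigenvector
  inside \<open>V\<close> is again invariant. This is why general invariant subspaces occur.\<close>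

lemma symmetric_orthonormal_eigenbasis:
  fixes T :: "real^'n \<Rightarrow> real^'n"
  assumes lin: "linear T" and sym: "\<And>x y. T x \<bullet> y = x \<bullet> T y"
  shows "subspace V \<Longrightarrow> T ` V \<subseteq> V \<Longrightarrow>
    \<exists>B\<subseteq>V. pairwise orthogonal B \<and> (\<forall>b\<in>B. norm b = 1 \<and> (\<exists>c. T b = c *\<^sub>R b)) \<and> finite B \<and> card B = dim V"
proof (induction "dim V" arbitrary: V rule: less_induct)
  case less
  show ?case
  proof (cases "V = {0}")
    case True
    thus ?thesis by (intro exI[of _ "{}"]) (auto simp: pairwise_def)
  next
    case False
    obtain x c where x: "x \<in> V" "norm x = 1" "T x = c *\<^sub>R x"
      using symmetric_eigenvector_exists[OF lin sym less.prems False] by blast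
    define W where "W = V \<inter> {y. x \<bullet> y = 0}"
    have W: "subspace W"
      unfolding W_def by (rule subspace_inter[OF less.prems(1) subspace_hyperplane])
    have TW: "T ` W \<subseteq> W"
    proof safe
      fix y assume y: "y \<in> W"
      have "x \<bullet> T y = c * (x \<bullet> y)" using sym[of x y] x by simp
      thus "T y \<in> W" using y less.prems by (auto simp: W_def)
    qed
    have span_x: "y - (x \<bullet> y) *\<^sub>R x \<in> W" if "y \<in> V" for y
      using that x less.prems
      by (auto simp: W_def inner_diff_right norm_eq_1 intro!: subspace_diff subspace_scale)
    have xW: "x \<notin> W" using x by (auto simp: W_def)
    have "dim V = dim (insert x W)"
    proof -
      have "span V = span (insert x W)"
      proof
        have "y \<in> span (insert x W)" if "y \<in> V" for y
          using span_x[OF that] by (auto simp: span_insert intro: span_base)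
        thus "span V \<subseteq> span (insert x W)" by (intro span_minimal) auto
        show "span (insert x W) \<subseteq> span V" using x by (intro span_mono) (auto simp: W_def)
      qed
      thus ?thesis by (metis dim_span)
    qed
    hence dV: "dim V = Suc (dim W)" using xW W by (simp add: dim_insert span_eq_iff[THEN iffD2])
    obtain B where B: "B \<subseteq> W" "pairwise orthogonal B" "\<forall>b\<in>B. norm b = 1 \<and> (\<exists>c. T b = c *\<^sub>R b)"
      "finite B" "card B = dim W"
      using less.hyps[of W] dV W TW by auto
    show ?thesis
    proof (intro exI[of _ "insert x B"] conjI)
      show "insert x B \<subseteq> V" using B x by (auto simp: W_def)
      show "pairwise orthogonal (insert x B)"
        using B by (auto simp: pairwise_insert W_def orthogonal_def inner_commute)
      show "\<forall>b\<in>insert x B. norm b = 1 \<and> (\<exists>c. T b = c *\<^sub>R b)" using B x by auto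
      show "card (insert x B) = dim V" using B xW dV by (subst card_insert_disjoint) auto
    qed (use B in auto)
  qed
qed

lemma count_concat_replicate:
  assumes "distinct xs"
  shows "count (mset (concat (map (\<lambda>s. replicate (m s) s) xs))) v = (if v \<in> set xs then m v else 0)"
  using assms by (induction xs) auto

lemma sorted_wrt_replicate: "sorted_wrt (\<ge>) (replicate m (s :: 'a::linorder))"
  by (induction m) auto

lemma sorted_concat_replicate:
  "sorted_wrt (\<ge>) xs \<Longrightarrow> sorted_wrt (\<ge>) (concat (map (\<lambda>s. replicate (m s) s) (xs :: 'a::linorder list)))"
  by (induction xs) (auto simp: sorted_wrt_append sorted_wrt_replicate)

section \<open>Initial segments of the coordinate indices\<close>

lemma bij_betw_nth_index:
  "bij_betw nth_index {1..CARD('n)} (UNIV :: 'n::{finite,linorder} set)"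
proof -
  let ?l = "sorted_list_of_set (UNIV :: 'n set)"
  have "bij_betw ((!) ?l) {..<length ?l} (set ?l)"
    by (rule bij_betw_nth) auto
  hence "bij_betw ((!) ?l) {..<CARD('n)} UNIV" by simp
  moreover have "bij_betw (\<lambda>k. k - 1) {1..CARD('n)} {..<CARD('n)}"
    by (rule bij_betw_byWitness[of _ Suc]) auto
  ultimately have "bij_betw ((!) ?l \<circ> (\<lambda>k. k - 1)) {1..CARD('n)} UNIV"
    by (rule bij_betw_trans[rotated])
  thus ?thesis by (simp add: nth_index_def o_def cong: bij_betw_cong)
qed

lemma nth_index_le_iff:
  assumes "i \<in> {1..CARD('n)}" "j \<in> {1..CARD('n)}"
  shows "(nth_index i :: 'n::{finite,linorder}) \<le> nth_index j \<longleftrightarrow> i \<le> j"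
proof -
  let ?l = "sorted_list_of_set (UNIV :: 'n set)"
  have s: "sorted_wrt (<) ?l" by simp
  have lt: "(nth_index i :: 'n) < nth_index j" if "i < j" "i \<in> {1..CARD('n)}" "j \<in> {1..CARD('n)}" for i j
    unfolding nth_index_def using that by (intro sorted_wrt_nth_less[OF s]) auto
  show ?thesis
  proof (cases i j rule: linorder_cases)
    case less
    thus ?thesis using lt[of i j] assms by auto
  next
    case greater
    thus ?thesis using lt[of j i] assms by auto
  qed auto
qed

text \<open>Positions start at 1 as for \<open>nth_index\<close>, hence the many accesses to lists
  at \<open>index_pos i - 1\<close>.\<close>

definition index_pos :: "'n::{finite,linorder} \<Rightarrow> nat" where
  "index_pos = inv_into {1..CARD('n)} nth_index"

lemma index_pos_in: "index_pos (i :: 'n) \<in> {1..CARD('n::{finite,linorder})}"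
  and nth_index_index_pos [simp]: "nth_index (index_pos i) = i"
  using bij_betw_nth_index[where 'n='n] unfolding index_pos_def bij_betw_def
  by (simp_all only: inv_into_into f_inv_into_f UNIV_I)

lemma index_pos_nth_index:
  "k \<in> {1..CARD('n)} \<Longrightarrow> index_pos (nth_index k :: 'n::{finite,linorder}) = k"
  using bij_betw_nth_index[where 'n='n] unfolding index_pos_def bij_betw_def
  by (simp only: inv_into_f_f)

lemma index_pos_le_iff: "index_pos i \<le> index_pos j \<longleftrightarrow> i \<le> j"
  using nth_index_le_iff[OF index_pos_in index_pos_in, of i j] by simp

lemma index_pos_less: "index_pos (i :: 'n) - 1 < CARD('n::{finite,linorder})"
  using index_pos_in[of i] by auto

definition first_indices :: "nat \<Rightarrow> 'n::{finite,linorder} set" where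
  "first_indices L = nth_index ` {1..L}"

lemma bij_betw_first_indices:
  "L \<le> CARD('n) \<Longrightarrow> bij_betw nth_index {1..L} (first_indices L :: 'n::{finite,linorder} set)"
  unfolding first_indices_def
  using bij_betw_nth_index[where 'n='n]
  by (intro inj_on_imp_bij_betw) (auto simp: bij_betw_def elim!: inj_on_subset)

lemma down_closed_first_indices:
  assumes "L \<le> CARD('n)"
  shows "down_closed (first_indices L :: 'n::{finite,linorder} set)"
  unfolding down_closed_def
proof (intro ballI allI impI)
  fix i j :: 'n assume i: "i \<in> first_indices L" and j: "j \<le> i"
  obtain k where k: "k \<in> {1..L}" "i = nth_index k" using i by (auto simp: first_indices_def)
  have "j \<in> nth_index ` {1..CARD('n)}"
    using bij_betw_nth_index[where 'n='n] by (simp only: bij_betw_def UNIV_I)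
  then obtain l where l: "l \<in> {1..CARD('n)}" "j = nth_index l" by blast
  have "l \<le> k" using j k l nth_index_le_iff[of l k, where 'n='n] assms by auto
  thus "j \<in> first_indices L" using k l by (auto simp: first_indices_def)
qed

text \<open>Elements of \<open>T - S\<close> lie above all of the initial segment \<open>S\<close>, so any bijection from
  \<open>S - T\<close> to \<open>T - S\<close>, extended by the identity, is increasing.\<close>
lemma down_closed_dominated:
  fixes S T :: "'n::{finite,linorder} set"
  assumes S: "down_closed S" and c: "card T = card S"
  shows "\<exists>\<pi>. bij_betw \<pi> S T \<and> (\<forall>i\<in>S. i \<le> \<pi> i)"
proof -
  have "card (S - T) = card (T - S)" using c card_Diff_subset_Int[of S T] card_Diff_subset_Int[of T S]
    by (simp add: Int_commute)
  then obtain \<tau> where \<tau>: "bij_betw \<tau> (S - T) (T - S)"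
    using finite_same_card_bij[of "S - T" "T - S"] by auto
  define \<pi> where "\<pi> i = (if i \<in> T then i else \<tau> i)" for i
  have 1: "bij_betw \<pi> (S \<inter> T) (S \<inter> T)" by (auto simp: \<pi>_def bij_betw_def inj_on_def)
  have 2: "bij_betw \<pi> (S - T) (T - S)"
    using \<tau> by (rule bij_betw_cong[THEN iffD1, rotated]) (auto simp: \<pi>_def)
  have "bij_betw \<pi> ((S \<inter> T) \<union> (S - T)) ((S \<inter> T) \<union> (T - S))"
    by (rule bij_betw_combine[OF 1 2]) auto
  moreover have "(S \<inter> T) \<union> (S - T) = S" "(S \<inter> T) \<union> (T - S) = T" by auto
  ultimately have "bij_betw \<pi> S T" by simp
  moreover have "i \<le> \<pi> i" if "i \<in> S" for i
  proof (cases "i \<in> T")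
    case False
    have "\<tau> i \<notin> S" using False \<tau> that by (auto simp: bij_betw_def)
    hence "\<not> \<tau> i \<le> i" using S that unfolding down_closed_def by blast
    thus ?thesis using False by (simp add: \<pi>_def)
  qed (simp add: \<pi>_def)
  ultimately show ?thesis by blast
qed


section \<open>Norms of compounds in terms of singular values\<close>

lemma sorted_desc_unique:
  fixes xs ys :: "'a::linorder list"
  assumes "sorted_wrt (\<ge>) xs" "sorted_wrt (\<ge>) ys" "mset xs = mset ys"
  shows "xs = ys"
proof -
  have "sorted (rev xs)" "sorted (rev ys)" using assms by (auto simp: sorted_wrt_rev)
  hence "rev xs = rev ys" using assms(3) by (metis mset_rev properties_for_sort)
  thus ?thesis by simp
qed

text \<open>Links the list in \<open>singular_value\<close> to an orthonormal eigenbasis. The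
  eigenspace for \<open>s\<^sup>2\<close> is spanned by the basis vectors \<open>b\<close> with
  \<open>norm (M *v b) = s\<close>, so its dimension counts them. Two decreasing lists with the same
  multiset coincide.\<close>

lemma singular_vectors_exist:
  fixes M :: "'n::{finite,linorder} square"
  shows "\<exists>(b :: 'n \<Rightarrow> (real, 'n) vec) s. (\<forall>i j. b i \<bullet> b j = (if i = j then 1 else 0)) \<and> (\<forall>i. s i \<ge> 0) \<and> antimono s \<and>
    (\<forall>i. (transpose M ** M) *v b i = (s i)\<^sup>2 *\<^sub>R b i) \<and>
    (\<forall>k\<in>{1..CARD('n)}. singular_value k M = s (nth_index k))"
proof -
  let ?T = "(*v) (transpose M ** M)"
  have TM: "?T x \<bullet> y = (M *v x) \<bullet> (M *v y)" for x y
    by (metis dot_lmul_matrix inner_commute matrix_vector_mul_assoc transpose_matrix_vector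
        transpose_transpose)
  have lin: "linear ?T" by simp
  have sym: "?T x \<bullet> y = x \<bullet> ?T y" for x y
    by (metis TM inner_commute)
  obtain B where ortho: "pairwise orthogonal B"
    and eig: "\<forall>b\<in>B. norm b = 1 \<and> (\<exists>c. ?T b = c *\<^sub>R b)"
    and fin: "finite B" and card: "card B = dim (UNIV :: (real, 'n) vec set)"
    using symmetric_orthonormal_eigenbasis[OF lin sym, of UNIV] by auto
  have cardB: "card B = CARD('n)" using card by simp
  define sv where "sv v = norm (M *v v)" for v
  have Tb: "?T b = (sv b)\<^sup>2 *\<^sub>R b" if b: "b \<in> B" for b
  proof -
    obtain c where c: "?T b = c *\<^sub>R b" using eig b by blast
    have "c = ?T b \<bullet> b" using c eig b by (simp add: norm_eq_1)
    also have "\<dots> = (sv b)\<^sup>2" unfolding TM sv_def by (simp add: power2_norm_eq_inner)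
    finally show ?thesis using c by simp
  qed
  have ind: "independent B"
    using ortho eig by (intro pairwise_orthogonal_independent) auto
  have spanB: "span B = UNIV"
    using ind card by (metis card_eq_dim fin subset_UNIV top.extremum_uniqueI)
  have expand: "(\<Sum>b\<in>B. (v \<bullet> b) *\<^sub>R b) = v" for v
    using orthonormal_basis_expand[OF ortho _ _ fin] eig spanB by auto
  have coord: "sv b = s" if v: "?T v = s\<^sup>2 *\<^sub>R v" and s: "s \<ge> 0" and b: "b \<in> B" and nz: "v \<bullet> b \<noteq> 0" for v s b
  proof -
    have "s\<^sup>2 * (v \<bullet> b) = (sv b)\<^sup>2 * (v \<bullet> b)" using sym[of v b] v Tb[OF b] by simp
    hence "s\<^sup>2 = (sv b)\<^sup>2" using nz by simp
    thus ?thesis using s by (simp add: sv_def)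
  qed
  let ?E = "\<lambda>s. {v. (transpose M ** M) *v v = s\<^sup>2 *\<^sub>R v}"
  have E: "?E s = span {b \<in> B. sv b = s}" if s: "s \<ge> 0" for s
  proof
    show "?E s \<subseteq> span {b \<in> B. sv b = s}"
    proof
      fix v assume v: "v \<in> ?E s"
      have "v = (\<Sum>b\<in>B. (v \<bullet> b) *\<^sub>R b)" using expand by simp
      also have "\<dots> = (\<Sum>b | b \<in> B \<and> sv b = s. (v \<bullet> b) *\<^sub>R b)"
        using coord[OF _ s, of v] v fin by (intro sum.mono_neutral_right) auto
      also have "\<dots> \<in> span {b \<in> B. sv b = s}" by (intro span_sum span_scale span_base) auto
      finally show "v \<in> span {b \<in> B. sv b = s}" .
    qed
    have "subspace (?E s)"
      by (auto simp: subspace_def matrix_vector_right_distrib matrix_vector_mult_scaleR scaleR_add_right)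
    thus "span {b \<in> B. sv b = s} \<subseteq> ?E s" using Tb by (intro span_minimal) auto
  qed
  have dimE: "dim (?E s) = card {b \<in> B. sv b = s}" if s: "s \<ge> 0" for s
    unfolding E[OF s] dim_span by (rule dim_eq_card_independent) (rule independent_mono[OF ind], auto)
  let ?Sp = "{s. s \<ge> 0 \<and> (\<exists>v. v \<noteq> 0 \<and> (transpose M ** M) *v v = s\<^sup>2 *\<^sub>R v)}"
  have Sp: "?Sp = sv ` B"
  proof
    show "?Sp \<subseteq> sv ` B"
    proof safe
      fix s v assume s: "s \<ge> (0::real)" and v: "v \<noteq> 0" "?T v = s\<^sup>2 *\<^sub>R v"
      have "\<exists>b\<in>B. v \<bullet> b \<noteq> 0" using expand[of v] v(1) by (metis (no_types, lifting) scale_eq_0_iff sum.neutral)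
      thus "s \<in> sv ` B" using coord[OF v(2) s] by blast
    qed
    show "sv ` B \<subseteq> ?Sp"
    proof safe
      fix b assume b: "b \<in> B"
      show "sv b \<ge> 0" by (simp add: sv_def)
      show "\<exists>v. v \<noteq> 0 \<and> (transpose M ** M) *v v = (sv b)\<^sup>2 *\<^sub>R v"
        using b Tb eig by (intro exI[of _ b]) auto
    qed
  qed
  define l where "l = concat (map (\<lambda>s. replicate (dim (?E s)) s) (rev (sorted_list_of_set ?Sp)))"
  obtain bs where bs: "set bs = B" "distinct bs" using finite_distinct_list[OF fin] by blast
  \<comment> \<open>Negating the key turns the ascending sort into decreasing order of the singular
    values.\<close>
  define xs where "xs = sort_key (\<lambda>b. - sv b) bs"
  have xs: "set xs = B" "distinct xs" "length xs = CARD('n)"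
    using bs cardB by (auto simp: xs_def distinct_card[symmetric])
  have "sorted_wrt (\<lambda>a b. - sv a \<le> - sv b) xs"
    using sorted_sort_key[of "\<lambda>b. - sv b" bs] by (simp add: xs_def sorted_map)
  hence sx: "sorted_wrt (\<ge>) (map sv xs)" by (simp add: sorted_wrt_map)
  have "sorted_wrt (\<ge>) (rev (sorted_list_of_set ?Sp))"
    by (simp add: sorted_wrt_rev)
  hence sl: "sorted_wrt (\<ge>) l" unfolding l_def by (rule sorted_concat_replicate)
  have "mset l = mset (map sv xs)"
  proof (rule multiset_eqI)
    fix v
    have "count (mset l) v = (if v \<in> sv ` B then dim (?E v) else 0)"
      unfolding l_def Sp using fin by (subst count_concat_replicate) auto
    also have "\<dots> = card {b \<in> B. sv b = v}"
    proof (cases "v \<in> sv ` B")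
      case True
      hence "v \<ge> 0" by (auto simp: sv_def)
      with True show ?thesis using dimE by simp
    next
      case False
      hence "{b \<in> B. sv b = v} = {}" by auto
      with False show ?thesis by (simp only: if_False card.empty)
    qed
    also have "\<dots> = count (image_mset sv (mset_set B)) v"
    proof -
      have "count (image_mset sv (mset_set B)) v = (\<Sum>x | x \<in># mset_set B \<and> v = sv x. count (mset_set B) x)"
        by (rule count_image_mset')
      also have "\<dots> = (\<Sum>x | x \<in> B \<and> sv x = v. 1)"
        using fin by (intro sum.cong) auto
      finally show ?thesis by simp
    qed
    also have "mset_set B = mset xs" using xs by (simp add: mset_set_set[symmetric])
    finally show "count (mset l) v = count (mset (map sv xs)) v" by simp
  qed
  with sl sx have l: "l = map sv xs" by (intro sorted_desc_unique)
  define b where "b i = xs ! (index_pos i - 1)" for i :: 'n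
  have lt: "index_pos i - 1 < length xs" for i :: 'n using index_pos_less[of i] xs(3) by simp
  have bB: "b i \<in> B" for i using lt[of i] xs(1) by (auto simp: b_def)
  have b_inj: "b i \<noteq> b j" if "i \<noteq> j" for i j
  proof -
    have "index_pos i \<noteq> index_pos j" using that nth_index_index_pos by metis
    thus ?thesis using index_pos_in[of i] index_pos_in[of j] nth_eq_iff_index_eq[OF xs(2) lt lt, of i j]
      by (auto simp: b_def)
  qed
  show ?thesis
  proof (intro exI[of _ b] exI[of _ "\<lambda>i. sv (b i)"] conjI allI ballI)
    fix i j show "b i \<bullet> b j = (if i = j then 1 else 0)"
      using bB b_inj[of i j] ortho eig by (auto simp: pairwise_def orthogonal_def norm_eq_1)
  next
    fix i show "sv (b i) \<ge> 0" by (simp add: sv_def)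
    show "(transpose M ** M) *v b i = (sv (b i))\<^sup>2 *\<^sub>R b i" by (rule Tb[OF bB])
  next
    show "antimono (\<lambda>i. sv (b i))"
    proof (rule antimonoI)
      fix i j :: 'n assume "i \<le> j"
      hence le: "index_pos i - 1 \<le> index_pos j - 1" by (simp add: index_pos_le_iff diff_le_mono)
      show "sv (b j) \<le> sv (b i)"
      proof (cases "index_pos i - 1 = index_pos j - 1")
        case False
        with le have "index_pos i - 1 < index_pos j - 1" by simp
        from sorted_wrt_nth_less[OF sx this] lt[of i] lt[of j] show ?thesis by (simp add: b_def)
      qed (simp add: b_def)
    qed
  next
    fix k assume k: "k \<in> {1..CARD('n)}"
    have "singular_value k M = l ! (k - 1)" by (simp add: singular_value_def l_def)
    thus "singular_value k M = sv (b (nth_index k))"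
      using k lt[of "nth_index k"] by (simp add: l b_def index_pos_nth_index)
  qed
qed

lemma norm_compound_square:
  "(norm (compound S M))\<^sup>2 = trace (compound S (transpose M ** M))"
proof -
  have "(norm A)\<^sup>2 = trace (transpose A ** A)" for A :: "real^'m^'m"
    unfolding power2_norm_eq_inner inner_vec_def trace_def matrix_matrix_mult_def
    by (simp add: transpose_def) (rule sum.swap)
  thus ?thesis by (simp add: compound_mult compound_transpose)
qed

text \<open>The squared Frobenius norm is the trace of the compound of
  \<open>transpose M ** M\<close>. In the eigenbasis this matrix becomes the diagonal
  \<open>D\<close>, the trace is unchanged by cyclicity, and the diagonal minors of \<open>D\<close>
  are the squared products.\<close>

lemma norm_compound_singular_values:
  fixes M :: "real^'n^'n" and S :: "'n set" and b :: "'n \<Rightarrow> real^'n" and s :: "'n \<Rightarrow> real"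
  assumes b: "\<And>i j. b i \<bullet> b j = (if i = j then 1 else 0)"
    and ev: "\<And>i. (transpose M ** M) *v b i = (s i)\<^sup>2 *\<^sub>R b i"
  shows "(norm (compound S M))\<^sup>2 = (\<Sum>f | inj_on f S. (\<Prod>i\<in>S. s (f i))\<^sup>2) / minor_weight S"
proof -
  define W where "W = (\<chi> i. b i)"
  define D where "D = W ** (transpose M ** M) ** transpose W"
  have W: "W ** transpose W = mat 1"
    using b by (simp add: vec_eq_iff W_def matrix_matrix_mult_def transpose_def mat_def inner_vec_def)
  hence W': "transpose W ** W = mat 1" by (simp add: matrix_left_right_inverse)
  have "D $ i $ j = b i \<bullet> ((transpose M ** M) *v b j)" for i j
    unfolding D_def W_def
    by (simp add: matrix_matrix_mult_def matrix_vector_mult_def transpose_def inner_vec_def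
        sum_distrib_left sum_distrib_right mult.assoc) (rule sum.swap)
  hence D: "D $ i $ j = (if i = j then (s i)\<^sup>2 else 0)" for i j by (simp add: ev b)
  have "transpose M ** M = transpose W ** D ** W"
    unfolding D_def using W' by (metis matrix_mul_assoc matrix_mul_lid matrix_mul_rid)
  hence "(norm (compound S M))\<^sup>2 = trace (compound S (transpose W ** D ** W))"
    by (simp add: norm_compound_square)
  also have "\<dots> = trace (compound S W ** (compound S (transpose W) ** compound S D))"
    unfolding compound_mult by (rule trace_mul_sym)
  also have "\<dots> = trace (compound S D)"
    by (simp add: compound_mult[symmetric] matrix_mul_assoc W)
  also have "\<dots> = (\<Sum>f\<in>UNIV. if inj_on f S then (\<Prod>i\<in>S. s (f i))\<^sup>2 else 0) / minor_weight S"
    unfolding trace_def compound_def sum_divide_distrib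
    by (intro sum.cong refl) (simp add: minor_diagonal D prod_power_distrib)
  finally show ?thesis by (simp add: sum.If_cases)
qed

text \<open>Among the products in the preceding sum, the one for \<open>id\<close> belongs to the
  \<open>L\<close> largest singular values and dominates all others; there are at most
  \<open>CARD('n \<Rightarrow> 'n)\<close> terms.\<close>

lemma singular_values_comparable_norm_compound:
  assumes L: "L \<le> CARD('n::{finite,linorder})"
  defines "S \<equiv> first_indices L :: 'n set"
  shows "\<exists>c>0. \<forall>M :: 'n square. (\<Prod>k=1..L. singular_value k M) \<le> c * norm (compound S M) \<and>
    norm (compound S M) \<le> c * (\<Prod>k=1..L. singular_value k M)"
proof -
  define w where "w = minor_weight S"
  define C where "C = real CARD('n\<Rightarrow>'n)"
  have w: "w > 0" unfolding w_def by (rule minor_weight_pos)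
  have C: "C > 0" by (simp add: C_def)
  have S: "down_closed S" unfolding S_def by (rule down_closed_first_indices[OF L])
  have main: "\<exists>p\<ge>0. (\<Prod>k=1..L. singular_value k M) = p \<and> p\<^sup>2 \<le> w * (norm (compound S M))\<^sup>2 \<and>
      (norm (compound S M))\<^sup>2 \<le> C / w * p\<^sup>2" for M :: "'n square"
  proof -
    obtain b :: "'n \<Rightarrow> (real, 'n) vec" and s :: "'n \<Rightarrow> real"
      where b: "\<And>i j. b i \<bullet> b j = (if i = j then 1 else 0)" and s: "\<And>i. s i \<ge> 0"
      and anti: "antimono s" and ev: "\<And>i. (transpose M ** M) *v b i = (s i)\<^sup>2 *\<^sub>R b i"
      and sv: "\<And>k. k \<in> {1..CARD('n)} \<Longrightarrow> singular_value k M = s (nth_index k)"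
      using singular_vectors_exist[of M] by blast
    define p where "p = (\<Prod>i\<in>S. s i)"
    have p0: "p \<ge> 0" unfolding p_def using s by (intro prod_nonneg) auto
    have "(\<Prod>k=1..L. singular_value k M) = (\<Prod>k=1..L. s (nth_index k))"
      using sv L by (intro prod.cong) auto
    also have "\<dots> = p" unfolding p_def S_def
      by (rule prod.reindex_bij_betw[OF bij_betw_first_indices[OF L]])
    finally have 1: "(\<Prod>k=1..L. singular_value k M) = p" .
    note n = norm_compound_singular_values[of b M s S, OF b ev, folded w_def]
    have "p\<^sup>2 \<le> (\<Sum>f | inj_on f S. (\<Prod>i\<in>S. s (f i))\<^sup>2)"
    proof -
      have "(\<Sum>f\<in>{id}. (\<Prod>i\<in>S. s (f i))\<^sup>2) \<le> (\<Sum>f | inj_on f S. (\<Prod>i\<in>S. s (f i))\<^sup>2)"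
        by (intro sum_mono2) auto
      thus ?thesis by (simp add: p_def)
    qed
    hence 2: "p\<^sup>2 \<le> w * (norm (compound S M))\<^sup>2" using w by (simp add: n)
    have le: "(\<Prod>i\<in>S. s (f i)) \<le> p" if f: "inj_on f S" for f
    proof -
      have c: "card (f ` S) = card S" using f by (rule card_image)
      obtain \<pi> where \<pi>: "bij_betw \<pi> S (f ` S)" "\<And>i. i \<in> S \<Longrightarrow> i \<le> \<pi> i"
        using down_closed_dominated[OF S c] by blast
      have "(\<Prod>i\<in>S. s (f i)) = (\<Prod>j\<in>f ` S. s j)" using f by (simp add: prod.reindex)
      also have "\<dots> = (\<Prod>i\<in>S. s (\<pi> i))" by (rule prod.reindex_bij_betw[OF \<pi>(1), symmetric])
      also have "\<dots> \<le> p" unfolding p_def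
        using s anti \<pi>(2) by (intro prod_mono) (auto dest: antimonoD)
      finally show ?thesis .
    qed
    have "(\<Sum>f | inj_on f S. (\<Prod>i\<in>S. s (f i))\<^sup>2) \<le> (\<Sum>f\<in>{f :: 'n \<Rightarrow> 'n. inj_on f S}. p\<^sup>2)"
    proof (rule sum_mono)
      fix f :: "'n \<Rightarrow> 'n" assume "f \<in> {f. inj_on f S}"
      thus "(\<Prod>i\<in>S. s (f i))\<^sup>2 \<le> p\<^sup>2"
        using le[of f] s by (simp add: power_mono prod_nonneg)
    qed
    also have "\<dots> = real (card {f :: 'n \<Rightarrow> 'n. inj_on f S}) * p\<^sup>2" by (rule sum_constant)
    also have "\<dots> \<le> C * p\<^sup>2"
      unfolding C_def
      by (rule mult_right_mono[OF of_nat_mono[OF card_mono]]) simp_all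
    finally have "(norm (compound S M))\<^sup>2 \<le> C / w * p\<^sup>2"
      using w unfolding n by (simp add: divide_right_mono)
    with 1 2 p0 show ?thesis by blast
  qed
  have Cw: "0 \<le> C / w" using C w by (intro divide_nonneg_pos) simp_all
  define c where "c = sqrt w + sqrt (C / w)"
  show ?thesis
  proof (intro exI[of _ c] conjI allI)
    show "0 < c" using w C by (simp add: c_def add_pos_pos)
    fix M :: "'n square"
    obtain p where p: "p \<ge> 0" "(\<Prod>k=1..L. singular_value k M) = p"
      "p\<^sup>2 \<le> w * (norm (compound S M))\<^sup>2" "(norm (compound S M))\<^sup>2 \<le> C / w * p\<^sup>2"
      using main by blast
    have "p \<le> sqrt w * norm (compound S M)"
    proof (rule power2_le_imp_le)
      show "p\<^sup>2 \<le> (sqrt w * norm (compound S M))\<^sup>2"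
        unfolding power_mult_distrib real_sqrt_pow2[OF less_imp_le[OF w]] by (rule p(3))
      show "0 \<le> sqrt w * norm (compound S M)" using w by (intro mult_nonneg_nonneg) simp_all
    qed
    also have "\<dots> \<le> c * norm (compound S M)"
      using Cw by (intro mult_right_mono) (simp_all add: c_def)
    finally show "(\<Prod>k=1..L. singular_value k M) \<le> c * norm (compound S M)" by (simp only: p(2))
    have "norm (compound S M) \<le> sqrt (C / w) * p"
    proof (rule power2_le_imp_le)
      show "(norm (compound S M))\<^sup>2 \<le> (sqrt (C / w) * p)\<^sup>2"
        unfolding power_mult_distrib real_sqrt_pow2[OF Cw] by (rule p(4))
      show "0 \<le> sqrt (C / w) * p" using Cw p(1) by (intro mult_nonneg_nonneg) simp_all
    qed
    also have "\<dots> \<le> c * p"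
      using w p(1) by (intro mult_right_mono) (simp_all add: c_def)
    finally show "norm (compound S M) \<le> c * (\<Prod>k=1..L. singular_value k M)" by (simp only: p(2))
  qed
qed

section \<open>Solutions of a bounded system\<close>

lemma matrix_inv_right: "invertible M \<Longrightarrow> M ** matrix_inv M = mat 1"
  and matrix_inv_left: "invertible M \<Longrightarrow> matrix_inv M ** M = mat 1"
  for M :: "real^'n^'n"
  unfolding matrix_inv_def invertible_def by (metis (mono_tags, lifting) someI_ex)+

lemma has_vector_derivative_matrix_vector:
  fixes X :: "real \<Rightarrow> real^'n^'m"
  assumes "(X has_vector_derivative D) F"
  shows "((\<lambda>t. X t *v c) has_vector_derivative D *v c) F"
proof -
  have "linear (\<lambda>M :: real^'n^'m. M *v c)"
    by (auto intro!: linearI simp: matrix_vector_mult_add_rdistrib scaleR_matrix_vector_assoc)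
  hence "bounded_linear (\<lambda>M :: real^'n^'m. M *v c)" by (simp add: linear_conv_bounded_linear)
  from bounded_linear.has_vector_derivative[OF this assms] show ?thesis .
qed

locale bounded_system =
  fixes A X :: "real \<Rightarrow> real^'n^'n" and a :: real
  assumes fund: "fundamental_matrix A X"
    and bound: "\<And>t x. t \<ge> 0 \<Longrightarrow> norm (A t *v x) \<le> a * norm x"
begin

lemma a_nonneg: "a \<ge> 0"
proof -
  have "0 \<le> norm (A 0 *v axis undefined 1)" by simp
  also have "\<dots> \<le> a" using bound[of 0 "axis undefined 1"] by simp
  finally show ?thesis .
qed

lemma invertible_X: "t \<ge> 0 \<Longrightarrow> invertible (X t)"
  using fund by (auto simp: fundamental_matrix_def)

text \<open>Gronwall in both time directions: the derivative
  \<open>2 * (x t \<bullet> (A t *v x t))\<close> of the squared norm is at most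
  \<open>2 * a\<close> times the squared norm in modulus, so multiplying the latter by
  \<open>exp (- 2 * a * t)\<close> or \<open>exp (2 * a * t)\<close> gives a decreasing or an
  increasing function.\<close>

lemma growth_bounds:
  assumes x: "\<And>t. t \<ge> 0 \<Longrightarrow> (x has_vector_derivative A t *v x t) (at t within {0..})"
    and st: "0 \<le> s" "s \<le> t"
  shows "norm (x t) \<le> exp (a * (t - s)) * norm (x s)" "norm (x s) \<le> exp (a * (t - s)) * norm (x t)"
proof -
  define g where "g c \<tau> = exp (c * \<tau>) * (x \<tau> \<bullet> x \<tau>)" for c \<tau>
  have cont: "continuous_on {s..t} (g c)" for c
  proof -
    have "continuous_on {0..} x"
      using x by (auto simp: continuous_on_eq_continuous_within intro!: has_vector_derivative_continuous)
    hence "continuous_on {s..t} x" by (rule continuous_on_subset) (use st in auto)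
    thus ?thesis unfolding g_def by (intro continuous_intros)
  qed
  have der: "(g c has_real_derivative exp (c * \<tau>) * (2 * (x \<tau> \<bullet> (A \<tau> *v x \<tau>)) + c * (x \<tau> \<bullet> x \<tau>))) (at \<tau>)"
    if "s < \<tau>" for c \<tau>
  proof -
    have "at \<tau> within {0..} = at \<tau>"
      using that st by (intro at_within_interior) auto
    hence *: "(x has_derivative (\<lambda>h. h *\<^sub>R (A \<tau> *v x \<tau>))) (at \<tau>)"
      using x[of \<tau>] that st by (simp add: has_vector_derivative_def)
    show ?thesis unfolding g_def has_field_derivative_def
      by (rule derivative_eq_intros refl * | simp add: algebra_simps inner_commute fun_eq_iff)+
  qed
  have ip: "\<bar>x \<tau> \<bullet> (A \<tau> *v x \<tau>)\<bar> \<le> a * (x \<tau> \<bullet> x \<tau>)" if "\<tau> \<ge> 0" for \<tau>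
  proof -
    have "\<bar>x \<tau> \<bullet> (A \<tau> *v x \<tau>)\<bar> \<le> norm (x \<tau>) * norm (A \<tau> *v x \<tau>)" by (rule Cauchy_Schwarz_ineq2)
    also have "\<dots> \<le> norm (x \<tau>) * (a * norm (x \<tau>))" by (intro mult_left_mono bound that) simp
    finally show ?thesis by (simp add: power2_norm_eq_inner[symmetric] power2_eq_square mult_ac)
  qed
  have sq: "u \<le> exp (a * (t - s)) * v" if "u\<^sup>2 \<le> exp (2 * a * (t - s)) * v\<^sup>2" "v \<ge> 0" for u v :: real
  proof (rule power2_le_imp_le)
    have "(exp (a * (t - s)))\<^sup>2 = exp (2 * a * (t - s))"
      by (simp add: power2_eq_square flip: exp_add)
    thus "u\<^sup>2 \<le> (exp (a * (t - s)) * v)\<^sup>2" using that by (simp add: power_mult_distrib)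
  qed (use that in simp)
  have "g (- 2 * a) s \<ge> g (- 2 * a) t"
  proof (rule DERIV_nonpos_imp_decreasing_open[OF st(2) _ cont])
    fix \<tau> assume "s < \<tau>" "\<tau> < t"
    thus "\<exists>y. DERIV (g (- 2 * a)) \<tau> :> y \<and> y \<le> 0"
      using der[of \<tau> "- 2 * a"] ip[of \<tau>] st by (intro exI conjI) (auto simp: mult_le_0_iff)
  qed
  hence "exp (2 * a * t) * (exp (- 2 * a * t) * (x t \<bullet> x t)) \<le> exp (2 * a * t) * (exp (- 2 * a * s) * (x s \<bullet> x s))"
    unfolding g_def by (intro mult_left_mono) auto
  hence "x t \<bullet> x t \<le> exp (2 * a * (t - s)) * (x s \<bullet> x s)"
    unfolding mult.assoc[symmetric] exp_add[symmetric] by (simp add: algebra_simps)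
  thus "norm (x t) \<le> exp (a * (t - s)) * norm (x s)"
    by (intro sq) (auto simp: power2_norm_eq_inner)
  have "g (2 * a) s \<le> g (2 * a) t"
  proof (rule DERIV_nonneg_imp_increasing_open[OF st(2) _ cont])
    fix \<tau> assume "s < \<tau>" "\<tau> < t"
    thus "\<exists>y. DERIV (g (2 * a)) \<tau> :> y \<and> y \<ge> 0"
      using der[of \<tau> "2 * a"] ip[of \<tau>] st
      by (intro exI[of _ "exp (2 * a * \<tau>) * (2 * (x \<tau> \<bullet> (A \<tau> *v x \<tau>)) + 2 * a * (x \<tau> \<bullet> x \<tau>))"] conjI)
        (auto simp: zero_le_mult_iff)
  qed
  hence "exp (- 2 * a * s) * (exp (2 * a * s) * (x s \<bullet> x s)) \<le> exp (- 2 * a * s) * (exp (2 * a * t) * (x t \<bullet> x t))"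
    unfolding g_def by (intro mult_left_mono) auto
  hence "x s \<bullet> x s \<le> exp (2 * a * (t - s)) * (x t \<bullet> x t)"
    unfolding mult.assoc[symmetric] exp_add[symmetric] by (simp add: algebra_simps)
  thus "norm (x s) \<le> exp (a * (t - s)) * norm (x t)"
    by (intro sq) (auto simp: power2_norm_eq_inner)
qed

text \<open>Parametrises the solutions by coefficient vectors; the first branch follows the
  convention of \<open>solution\<close> for negative times.\<close>

definition sol :: "real^'n \<Rightarrow> real \<Rightarrow> real^'n" where
  "sol c t = (if t < 0 then 0 else X t *v c)"

lemma X_derivative:
  "t \<ge> 0 \<Longrightarrow> ((\<lambda>t. X t *v c) has_vector_derivative A t *v (X t *v c)) (at t within {0..})"
  using has_vector_derivative_matrix_vector[of X "A t ** X t" "at t within {0..}" c] fund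
  by (simp add: fundamental_matrix_def matrix_vector_mul_assoc)

lemmas X_growth = growth_bounds[OF X_derivative]

lemma solution_sol: "solution A (sol c)"
  unfolding solution_def
proof (intro conjI allI impI)
  fix t :: real assume t: "0 \<le> t"
  show "(sol c has_vector_derivative A t *v sol c t) (at t within {0..})"
    using has_vector_derivative_transform[of t "{0..}" "sol c" "\<lambda>t. X t *v c"] X_derivative[OF t] t
    by (simp add: sol_def)
qed (simp add: sol_def)

text \<open>Uniqueness: the difference of both sides is a solution that vanishes at time 0, and the
  growth bound keeps it 0.\<close>

lemma solution_eq_sol:
  assumes "solution A x"
  shows "x = sol (matrix_inv (X 0) *v x 0)"
proof
  fix t
  let ?c = "matrix_inv (X 0) *v x 0"
  let ?y = "\<lambda>t. x t - sol ?c t"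
  show "x t = sol ?c t"
  proof (cases "t < 0")
    case True
    thus ?thesis using assms by (simp add: solution_def sol_def)
  next
    case False
    have "(?y has_vector_derivative A t *v ?y t) (at t within {0..})" if "t \<ge> 0" for t
      using assms solution_sol[of ?c] that
      by (auto simp: solution_def matrix_vector_mult_diff_distrib intro!: has_vector_derivative_diff)
    from growth_bounds(1)[OF this, of 0 t] False
    have "norm (?y t) \<le> exp (a * t) * norm (?y 0)" by simp
    also have "?y 0 = 0"
      using invertible_X[of 0] by (simp add: sol_def matrix_vector_mul_assoc matrix_inv_right)
    finally show ?thesis by simp
  qed
qed

lemma cauchy_matrix_trans:
  "s \<ge> 0 \<Longrightarrow> cauchy_matrix X t s ** cauchy_matrix X s r = cauchy_matrix X t r"
  unfolding cauchy_matrix_def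
  by (metis invertible_X matrix_inv_left matrix_mul_assoc matrix_mul_rid)

lemma cauchy_matrix_refl: "s \<ge> 0 \<Longrightarrow> cauchy_matrix X s s = mat 1"
  unfolding cauchy_matrix_def by (simp add: invertible_X matrix_inv_right)

text \<open>Column \<open>j\<close> is the value at time \<open>t\<close> of the solution that
  equals the unit vector at time \<open>s\<close>. The case \<open>t < s\<close> is included because
  bounded backward steps later give lower bounds for forward steps.\<close>

lemma cauchy_matrix_bound:
  assumes "s \<ge> 0" "t \<ge> 0"
  shows "\<bar>cauchy_matrix X t s $ i $ j\<bar> \<le> exp (a * \<bar>t - s\<bar>)"
proof -
  let ?c = "matrix_inv (X s) *v axis j 1"
  have Xs: "X s *v ?c = axis j 1"
    using assms by (simp add: matrix_vector_mul_assoc matrix_inv_right invertible_X)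
  have Xt: "X t *v ?c = column j (cauchy_matrix X t s)"
    by (simp only: cauchy_matrix_def matrix_vector_mul_assoc matrix_vector_mult_basis[symmetric])
  have "norm (X t *v ?c) \<le> exp (a * \<bar>t - s\<bar>) * norm (X s *v ?c)"
    using X_growth[of s t ?c] X_growth[of t s ?c] assms by (cases "s \<le> t") auto
  hence "norm (column j (cauchy_matrix X t s)) \<le> exp (a * \<bar>t - s\<bar>)" by (simp add: Xs Xt)
  moreover have "\<bar>cauchy_matrix X t s $ i $ j\<bar> \<le> norm (column j (cauchy_matrix X t s))"
    using component_le_norm_cart[of "column j (cauchy_matrix X t s)" i] by (simp add: column_def)
  ultimately show ?thesis by linarith
qed

end

section \<open>Lyapunov exponents\<close>

text \<open>Trades the limsup of logarithms for exponential estimates, in which zeros of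
  \<open>x\<close> need no special treatment.\<close>

lemma lyapunov_exponent_le_iff:
  "lyapunov_exponent x \<le> ereal l \<longleftrightarrow>
    (\<forall>e>0. eventually (\<lambda>t. norm (x t) \<le> exp ((l + e) * t)) at_top)"
proof
  assume le: "lyapunov_exponent x \<le> ereal l"
  show "\<forall>e>0. eventually (\<lambda>t. norm (x t) \<le> exp ((l + e) * t)) at_top"
  proof (intro allI impI)
    fix e :: real assume "e > 0"
    hence "ereal l < ereal (l + e)" by simp
    with le have "eventually (\<lambda>t. (if x t = 0 then - \<infinity> else ereal (1 / t * ln (norm (x t)))) < ereal (l + e)) at_top"
      unfolding lyapunov_exponent_def Limsup_le_iff by blast
    thus "eventually (\<lambda>t. norm (x t) \<le> exp ((l + e) * t)) at_top"
      using eventually_gt_at_top[of 0]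
    proof eventually_elim
      case (elim t)
      show ?case
      proof (cases "x t = 0")
        case False
        hence "ln (norm (x t)) \<le> (l + e) * t" using elim by (simp add: field_simps)
        hence "exp (ln (norm (x t))) \<le> exp ((l + e) * t)" by simp
        thus ?thesis using False by simp
      qed simp
    qed
  qed
next
  assume *: "\<forall>e>0. eventually (\<lambda>t. norm (x t) \<le> exp ((l + e) * t)) at_top"
  show "lyapunov_exponent x \<le> ereal l"
    unfolding lyapunov_exponent_def Limsup_le_iff
  proof (intro allI impI)
    fix y assume "ereal l < y"
    then obtain r where r: "l < r" "ereal r < y" using ereal_dense2 by force
    have "eventually (\<lambda>t. norm (x t) \<le> exp ((l + (r - l)) * t)) at_top" using * r by (metis diff_gt_0_iff_gt)
    thus "eventually (\<lambda>t. (if x t = 0 then - \<infinity> else ereal (1 / t * ln (norm (x t)))) < y) at_top"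
      using eventually_gt_at_top[of 0]
    proof eventually_elim
      case (elim t)
      show ?case
      proof (cases "x t = 0")
        case True
        thus ?thesis using r by (auto intro: le_less_trans)
      next
        case False
        hence "ln (norm (x t)) \<le> ln (exp (r * t))" using elim by (subst ln_le_cancel_iff) auto
        hence "1 / t * ln (norm (x t)) \<le> r" using elim by (simp add: field_simps)
        hence "ereal (1 / t * ln (norm (x t))) \<le> ereal r" by simp
        hence "ereal (1 / t * ln (norm (x t))) < y" using r(2) by (rule le_less_trans)
        thus ?thesis using False by simp
      qed
    qed
  qed
qed

text \<open>The device by which constant factors are absorbed into an arbitrarily small change of
  the exponent.\<close>

lemma eventually_scaled_exp_le:
  assumes "u < (v :: real)"
  shows "eventually (\<lambda>t. c * exp (u * t) \<le> exp (v * t)) at_top"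
proof -
  have "filterlim (\<lambda>t. (v - u) * t) at_top at_top"
    using assms by (intro filterlim_tendsto_pos_mult_at_top[OF tendsto_const _ filterlim_ident]) auto
  hence "filterlim (\<lambda>t. exp ((v - u) * t)) at_top at_top"
    by (rule filterlim_compose[OF exp_at_top])
  hence "eventually (\<lambda>t. c \<le> exp ((v - u) * t)) at_top"
    by (auto simp: filterlim_at_top)
  thus ?thesis
  proof eventually_elim
    case (elim t)
    hence "c * exp (u * t) \<le> exp ((v - u) * t) * exp (u * t)" by (intro mult_right_mono) auto
    thus ?case by (simp add: left_diff_distrib flip: exp_add)
  qed
qed

section \<open>The Lyapunov filtration in coefficient space\<close>

context bounded_system
begin

lemma sol_add: "sol (c + d) = sol c + sol d"
  by (auto simp: sol_def fun_eq_iff matrix_vector_right_distrib)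

lemma sol_scaleR: "sol (r *\<^sub>R c) = fun_scale r (sol c)"
  by (auto simp: sol_def fun_eq_iff fun_scale_def matrix_vector_mult_scaleR)

lemma sol_eq_0_iff: "sol c = 0 \<longleftrightarrow> c = 0"
proof
  assume "sol c = 0"
  hence "X 0 *v c = 0" by (metis less_irrefl sol_def zero_fun_apply)
  hence "matrix_inv (X 0) *v (X 0 *v c) = 0" by simp
  thus "c = 0" by (simp add: matrix_vector_mul_assoc matrix_inv_left invertible_X)
qed (auto simp: sol_def fun_eq_iff)

lemma sol_0 [simp]: "sol 0 = 0"
  by (simp add: sol_eq_0_iff)

lemma inj_sol: "inj sol"
proof (rule injI)
  fix c d assume "sol c = sol d"
  hence "sol (c - d) = 0"
    using sol_add[of c "- d"] sol_scaleR[of "-1" d] by (auto simp: fun_eq_iff fun_scale_def)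
  thus "c = d" by (simp add: sol_eq_0_iff)
qed

lemma solutions_eq_range: "{x. solution A x} = range sol"
  using solution_sol solution_eq_sol by blast

definition chi :: "real^'n \<Rightarrow> ereal" where "chi c = lyapunov_exponent (sol c)"

lemma eventually_sol: "eventually (\<lambda>t. sol c t = X t *v c) at_top"
  using eventually_ge_at_top[of 0] by eventually_elim (simp add: sol_def)

lemma chi_le_iff:
  "chi c \<le> ereal l \<longleftrightarrow> (\<forall>e>0. eventually (\<lambda>t. norm (X t *v c) \<le> exp ((l + e) * t)) at_top)"
proof -
  have "eventually (\<lambda>t. norm (sol c t) \<le> exp ((l + e) * t)) at_top \<longleftrightarrow>
      eventually (\<lambda>t. norm (X t *v c) \<le> exp ((l + e) * t)) at_top" for e
    by (intro eventually_cong[OF eventually_sol[of c]]) simp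
  thus ?thesis unfolding chi_def lyapunov_exponent_le_iff by simp
qed

lemma chi_0: "chi 0 = - \<infinity>"
  by (simp add: chi_def lyapunov_exponent_def Limsup_const)

text \<open>The two growth bounds prevent a non-trivial solution from growing or decaying faster
  than exponentially, so its exponent is finite.\<close>

lemma chi_real:
  assumes c: "c \<noteq> 0"
  shows "chi c = ereal (real_of_ereal (chi c))"
proof -
  have "chi c \<le> ereal a"
    unfolding chi_le_iff
  proof (intro allI impI)
    fix e :: real assume "e > 0"
    hence "a < a + e" by simp
    from eventually_scaled_exp_le[OF this, of "norm (X 0 *v c)"] eventually_ge_at_top[of 0]
    show "eventually (\<lambda>t. norm (X t *v c) \<le> exp ((a + e) * t)) at_top"
    proof eventually_elim
      case (elim t)
      have "norm (X t *v c) \<le> exp (a * (t - 0)) * norm (X 0 *v c)" using elim by (intro X_growth(1)) auto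
      also have "\<dots> = norm (X 0 *v c) * exp (a * t)" by simp
      also note elim(1)
      finally show ?case .
    qed
  qed
  hence 1: "chi c \<noteq> \<infinity>" by auto
  have X0: "norm (X 0 *v c) > 0"
    using c by (metis invertible_X matrix_inv_left matrix_vector_mul_assoc matrix_vector_mul_lid
        matrix_vector_mult_0_right order_refl zero_less_norm_iff)
  \<comment> \<open>With slack 1, such an exponent would beat the lower growth bound by the factor
    \<open>exp (- t)\<close>. The factor 2 in the second estimate makes the contradiction
    strict.\<close>
  have "\<not> chi c \<le> ereal (- a - 2)"
  proof
    assume "chi c \<le> ereal (- a - 2)"
    hence "eventually (\<lambda>t. norm (X t *v c) \<le> exp ((- a - 2 + 1) * t)) at_top"
      unfolding chi_le_iff by (metis zero_less_one)
    moreover have "eventually (\<lambda>t. 2 / norm (X 0 *v c) * exp (- 1 * t) \<le> exp (0 * t)) at_top"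
      by (intro eventually_scaled_exp_le) simp
    ultimately have "eventually (\<lambda>t::real. False) at_top"
      using eventually_ge_at_top[of 0]
    proof eventually_elim
      case (elim t)
      have "norm (X 0 *v c) \<le> exp (a * (t - 0)) * norm (X t *v c)"
        using elim by (intro X_growth(2)) auto
      also have "\<dots> \<le> exp (a * (t - 0)) * exp ((- a - 2 + 1) * t)"
        using elim by (intro mult_left_mono) auto
      also have "\<dots> = exp (- t)" unfolding exp_add[symmetric] by (simp add: algebra_simps)
      finally have "norm (X 0 *v c) \<le> exp (- t)" .
      moreover have "2 * exp (- t) \<le> norm (X 0 *v c)" using elim(2) X0 by (simp add: field_simps)
      ultimately show ?case using X0 exp_gt_zero[of "-t"] by linarith
    qed
    thus False by simp
  qed
  hence "chi c \<noteq> - \<infinity>" by auto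
  with 1 show ?thesis by (cases "chi c") auto
qed

lemma subspace_chi_le:
  assumes v: "\<bar>v\<bar> \<noteq> \<infinity>"
  shows "subspace {c. chi c \<le> v}"
proof -
  obtain l where l: "v = ereal l" using v by (cases v) auto
  show ?thesis unfolding subspace_def
  proof (intro conjI ballI allI, goal_cases)
    case 1
    show ?case by (simp add: chi_0)
  next
    case (2 c d)
    hence c: "\<And>e. e > 0 \<Longrightarrow> eventually (\<lambda>t. norm (X t *v c) \<le> exp ((l + e) * t)) at_top"
      and d: "\<And>e. e > 0 \<Longrightarrow> eventually (\<lambda>t. norm (X t *v d) \<le> exp ((l + e) * t)) at_top"
      by (auto simp: l chi_le_iff)
    have "eventually (\<lambda>t. norm (X t *v (c + d)) \<le> exp ((l + e) * t)) at_top" if e: "e > 0" for e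
    proof -
      have "l + e / 2 < l + e" "e / 2 > 0" using e by auto
      from eventually_scaled_exp_le[OF this(1), of 2] c[OF this(2)] d[OF this(2)]
      show ?thesis
      proof eventually_elim
        case (elim t)
        have "norm (X t *v (c + d)) \<le> norm (X t *v c) + norm (X t *v d)"
          unfolding matrix_vector_right_distrib by (rule norm_triangle_ineq)
        with elim show ?case by linarith
      qed
    qed
    thus ?case by (simp add: l chi_le_iff)
  next
    case (3 r c)
    hence c: "\<And>e. e > 0 \<Longrightarrow> eventually (\<lambda>t. norm (X t *v c) \<le> exp ((l + e) * t)) at_top"
      by (auto simp: l chi_le_iff)
    have "eventually (\<lambda>t. norm (X t *v (r *\<^sub>R c)) \<le> exp ((l + e) * t)) at_top" if e: "e > 0" for e
    proof -
      have "l + e / 2 < l + e" "e / 2 > 0" using e by auto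
      from eventually_scaled_exp_le[OF this(1), of "\<bar>r\<bar>"] c[OF this(2)]
      show ?thesis
      proof eventually_elim
        case (elim t)
        have "norm (X t *v (r *\<^sub>R c)) = \<bar>r\<bar> * norm (X t *v c)"
          by (simp add: matrix_vector_mult_scaleR)
        also have "\<dots> \<le> \<bar>r\<bar> * exp ((l + e / 2) * t)" using elim by (intro mult_left_mono) auto
        also note elim(1)
        finally show ?case .
      qed
    qed
    thus ?case by (simp add: l chi_le_iff)
  qed
qed

lemma spectrum_eq: "lyapunov_spectrum A = chi ` {c. c \<noteq> 0}"
proof -
  have "{x. solution A x \<and> x \<noteq> 0} = sol ` {c. c \<noteq> 0}"
    using solutions_eq_range sol_eq_0_iff by auto
  thus ?thesis by (simp add: lyapunov_spectrum_def chi_def image_image)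
qed

lemma spectrum_real: "v \<in> lyapunov_spectrum A \<Longrightarrow> \<bar>v\<bar> \<noteq> \<infinity>"
proof -
  assume "v \<in> lyapunov_spectrum A"
  then obtain c where "c \<noteq> 0" "v = chi c" by (auto simp: spectrum_eq)
  with chi_real[of c] show ?thesis by (metis abs_ereal.simps(1) PInfty_neq_ereal(1))
qed

text \<open>Sublevel spaces of different exponents are strictly nested, so their dimensions, which
  are at most \<open>CARD('n)\<close>, tell the exponents apart.\<close>

lemma finite_spectrum: "finite (lyapunov_spectrum A)"
proof (rule finite_imageD)
  let ?d = "\<lambda>v. dim {c. chi c \<le> v}"
  have "?d ` lyapunov_spectrum A \<subseteq> {..CARD('n)}"
  proof (rule image_subsetI)
    fix v show "?d v \<in> {..CARD('n)}" using dim_subset_UNIV[of "{c. chi c \<le> v}"] by simp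
  qed
  thus "finite (?d ` lyapunov_spectrum A)" by (rule finite_subset) simp
  have less: "?d v < ?d w" if vw: "v \<in> lyapunov_spectrum A" "w \<in> lyapunov_spectrum A" "v < w" for v w
  proof (rule dim_psubset)
    obtain c where c: "chi c = w" using vw by (auto simp: spectrum_eq)
    have "c \<in> {c. chi c \<le> w}" "c \<notin> {c. chi c \<le> v}" using c vw by auto
    moreover have "{c. chi c \<le> v} \<subseteq> {c. chi c \<le> w}" using vw by auto
    ultimately have "{c. chi c \<le> v} \<subset> {c. chi c \<le> w}" by blast
    thus "span {c. chi c \<le> v} \<subset> span {c. chi c \<le> w}"
      using subspace_chi_le[OF spectrum_real] vw by (simp add: span_eq_iff[THEN iffD2])
  qed
  show "inj_on ?d (lyapunov_spectrum A)"
    by (rule inj_onI) (metis less less_irrefl linorder_less_linear)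
qed

text \<open>\<open>sol\<close> is linear and injective, so multiplicities, defined in the function
  space, can be computed from coefficient vectors.\<close>

lemma dim_sol_image: "fun_space.dim (sol ` V) = dim V"
proof -
  interpret pair: finite_dimensional_vector_space_pair_1 "(*\<^sub>R)" "Basis :: (real^'n) set" fun_scale
    by unfold_locales
  have "Vector_Spaces.linear (*\<^sub>R) fun_scale sol"
    by unfold_locales (auto simp: sol_add sol_scaleR)
  from pair.dim_image_eq[OF this, of V] show ?thesis
    by (simp add: inj_on_subset[OF inj_sol] dim_raw_def)
qed

abbreviation "spectrum_size \<equiv> card (lyapunov_spectrum A)"

text \<open>The preimage of \<open>lyapunov_space\<close> under \<open>sol\<close>.\<close>

definition filtration :: "nat \<Rightarrow> (real^'n) set" where
  "filtration i = (if i \<le> spectrum_size then {c. chi c \<le> lyapunov_value A i} else {0})"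

lemma lyapunov_value_in: "1 \<le> i \<Longrightarrow> i \<le> spectrum_size \<Longrightarrow> lyapunov_value A i \<in> lyapunov_spectrum A"
  unfolding lyapunov_value_def
  using nth_mem[of "i - 1" "rev (sorted_list_of_set (lyapunov_spectrum A))"] finite_spectrum
  by auto

lemma lyapunov_value_ex: "v \<in> lyapunov_spectrum A \<Longrightarrow> \<exists>i. 1 \<le> i \<and> i \<le> spectrum_size \<and> v = lyapunov_value A i"
proof -
  assume "v \<in> lyapunov_spectrum A"
  hence "v \<in> set (rev (sorted_list_of_set (lyapunov_spectrum A)))" using finite_spectrum by simp
  then obtain k where "k < spectrum_size" "rev (sorted_list_of_set (lyapunov_spectrum A)) ! k = v"
    unfolding in_set_conv_nth by auto
  thus ?thesis by (intro exI[of _ "Suc k"]) (auto simp: lyapunov_value_def)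
qed

lemma lyapunov_value_less:
  assumes "1 \<le> i" "i < j" "j \<le> spectrum_size"
  shows "lyapunov_value A j < lyapunov_value A i"
proof -
  have "sorted_wrt (>) (rev (sorted_list_of_set (lyapunov_spectrum A)))"
    by (simp add: sorted_wrt_rev)
  from sorted_wrt_nth_less[OF this, of "i - 1" "j - 1"] assms show ?thesis
    by (simp add: lyapunov_value_def)
qed

lemma subspace_filtration: "1 \<le> i \<Longrightarrow> subspace (filtration i)"
  unfolding filtration_def using subspace_chi_le[OF spectrum_real[OF lyapunov_value_in]]
  by (auto simp: subspace_def)

lemma filtration_mono:
  assumes "1 \<le> i"
  shows "filtration (Suc i) \<subseteq> filtration i"
proof (cases "Suc i \<le> spectrum_size")
  case True
  with lyapunov_value_less[of i "Suc i"] assms show ?thesis by (auto simp: filtration_def)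
next
  case False
  thus ?thesis using subspace_0[OF subspace_filtration[OF assms]] by (simp add: filtration_def)
qed

lemma multiplicity_eq:
  assumes "1 \<le> i"
  shows "lyapunov_multiplicity A i = dim (filtration i) - dim (filtration (Suc i))"
proof -
  have "lyapunov_space A j = sol ` filtration j" for j
    using solutions_eq_range unfolding lyapunov_space_def filtration_def chi_def by auto
  thus ?thesis by (simp add: lyapunov_multiplicity_def dim_sol_image)
qed

text \<open>A basis of the next smaller space is extended. The new vectors lie outside that space
  and no exponent lies strictly between the two values, so their exponent is exactly
  \<open>lyapunov_value A j\<close>.\<close>

lemma adapted_basis_step:
  assumes j: "1 \<le> j" "j \<le> spectrum_size"
    and bs: "distinct bs" "independent (set bs)" "span (set bs) = filtration (Suc j)"
  obtains ns where "distinct (ns @ bs)" "independent (set (ns @ bs))"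
    "span (set (ns @ bs)) = filtration j" "length ns = lyapunov_multiplicity A j"
    "\<And>c. c \<in> set ns \<Longrightarrow> chi c = lyapunov_value A j"
proof -
  have sub: "set bs \<subseteq> filtration j"
    using filtration_mono[OF j(1)] bs(3) span_superset by blast
  obtain B where B: "set bs \<subseteq> B" "B \<subseteq> filtration j" "independent B" "filtration j \<subseteq> span B"
    using maximal_independent_subset_extend[OF sub bs(2)] by blast
  have finB: "finite B" using B(3) by (rule independent_imp_finite)
  then obtain ns where ns: "set ns = B - set bs" "distinct ns"
    using finite_distinct_list[of "B - set bs"] by auto
  have set: "set (ns @ bs) = B" using ns B by auto
  have span: "span B = filtration j"
    using B subspace_filtration[OF j(1)] by (metis span_minimal subset_antisym)
  have "length ns = card (B - set bs)" using ns distinct_card by metis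
  also have "\<dots> = card B - card (set bs)" using B by (intro card_Diff_subset) auto
  also have "card B = dim (filtration j)" using B(3) span by (metis dim_span_eq_card_independent)
  also have "card (set bs) = dim (filtration (Suc j))" using bs by (metis dim_span_eq_card_independent)
  finally have len: "length ns = lyapunov_multiplicity A j" using multiplicity_eq[OF j(1)] by simp
  have "chi c = lyapunov_value A j" if "c \<in> set ns" for c
  proof -
    have c: "c \<in> B" "c \<notin> set bs" using that ns by auto
    have nc: "c \<notin> filtration (Suc j)"
    proof
      assume "c \<in> filtration (Suc j)"
      hence "c \<in> span (B - {c})" using bs(3) B(1) c(2) span_mono[of "set bs" "B - {c}"] by blast
      thus False using B(3) c(1) by (auto simp: dependent_def)
    qed
    have c0: "c \<noteq> 0" using B(3) c(1) dependent_zero by blast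
    hence "chi c \<in> lyapunov_spectrum A" by (auto simp: spectrum_eq)
    then obtain i where i: "1 \<le> i" "i \<le> spectrum_size" "chi c = lyapunov_value A i" using lyapunov_value_ex by blast
    have "chi c \<le> lyapunov_value A j" using B(2) c(1) j by (auto simp: filtration_def)
    hence "j \<le> i" using lyapunov_value_less[of i j] i j by (metis not_le)
    moreover have "\<not> Suc j \<le> i"
    proof
      assume ji: "Suc j \<le> i"
      hence "lyapunov_value A i \<le> lyapunov_value A (Suc j)"
        using lyapunov_value_less[of "Suc j" i] i by (cases "Suc j = i") (auto simp: less_imp_le)
      hence "c \<in> filtration (Suc j)" using i ji by (simp add: filtration_def)
      with nc show False by blast
    qed
    ultimately show ?thesis using i by (metis le_antisym not_less_eq_eq)
  qed
  with that[of ns] ns bs set span B len show thesis by auto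
qed

text \<open>Downward induction from the trivial space at \<open>Suc spectrum_size\<close>. New
  vectors go to the front, so the exponents of \<open>bs\<close> are literally the tail of the list
  behind \<open>lyapunov_counted\<close>.\<close>

lemma adapted_basis:
  assumes "1 \<le> j" "j \<le> Suc spectrum_size"
  shows "\<exists>bs. distinct bs \<and> independent (set bs) \<and> span (set bs) = filtration j \<and>
    map chi bs = concat (map (\<lambda>i. replicate (lyapunov_multiplicity A i) (lyapunov_value A i)) [j..<Suc spectrum_size]) \<and>
    sorted_wrt (\<ge>) (map chi bs)"
  using assms(2,1)
proof (induction j rule: inc_induct)
  case base
  show ?case by (intro exI[of _ "[]"]) (simp add: filtration_def independent_empty)
next
  case (step j)
  then obtain bs where bs: "distinct bs" "independent (set bs)" "span (set bs) = filtration (Suc j)"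
    and m: "map chi bs = concat (map (\<lambda>i. replicate (lyapunov_multiplicity A i) (lyapunov_value A i)) [Suc j..<Suc spectrum_size])"
    and s: "sorted_wrt (\<ge>) (map chi bs)"
    by auto
  have j: "1 \<le> j" "j \<le> spectrum_size" using step by auto
  obtain ns where ns: "distinct (ns @ bs)" "independent (set (ns @ bs))"
    "span (set (ns @ bs)) = filtration j" "length ns = lyapunov_multiplicity A j"
    "\<And>c. c \<in> set ns \<Longrightarrow> chi c = lyapunov_value A j"
    using adapted_basis_step[OF j bs] by blast
  have mn: "map chi ns = replicate (lyapunov_multiplicity A j) (lyapunov_value A j)"
    using ns(4,5) by (simp add: list_eq_iff_nth_eq)
  have "chi c \<le> lyapunov_value A j" if "c \<in> set (ns @ bs)" for c
  proof -
    have "c \<in> filtration j" using that ns(3) span_base by blast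
    thus ?thesis using j by (simp add: filtration_def)
  qed
  hence "sorted_wrt (\<ge>) (map chi (ns @ bs))"
    using s by (auto simp: mn sorted_wrt_append sorted_wrt_replicate)
  moreover have "[j..<Suc spectrum_size] = j # [Suc j..<Suc spectrum_size]" using j by (simp add: upt_rec)
  ultimately show ?case using ns m mn by (intro exI[of _ "ns @ bs"]) simp
qed

lemma lyapunov_basis:
  obtains bs ls where "distinct bs" "independent (set bs)" "length bs = CARD('n)" "length ls = CARD('n)"
    "sorted_wrt (\<ge>) ls"
    "\<And>k. k < CARD('n) \<Longrightarrow> chi (bs ! k) = ereal (ls ! k)"
    "\<And>k. k < CARD('n) \<Longrightarrow> lyapunov_counted A (Suc k) = ereal (ls ! k)"
proof -
  have "chi (axis undefined 1) \<in> lyapunov_spectrum A" by (auto simp: spectrum_eq)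
  hence spectrum_size: "1 \<le> spectrum_size" using finite_spectrum by (auto simp: Suc_le_eq card_gt_0_iff)
  have "chi c \<le> lyapunov_value A 1" for c
  proof (cases "c = 0")
    case False
    hence "chi c \<in> lyapunov_spectrum A" by (auto simp: spectrum_eq)
    then obtain i where "1 \<le> i" "i \<le> spectrum_size" "chi c = lyapunov_value A i" using lyapunov_value_ex by blast
    thus ?thesis using lyapunov_value_less[of 1 i] by (cases "i = 1") (auto simp: less_imp_le)
  qed (simp add: chi_0)
  hence F1: "filtration 1 = UNIV" using spectrum_size by (auto simp: filtration_def)
  obtain bs where bs: "distinct bs" "independent (set bs)" "span (set bs) = filtration 1"
    and m: "map chi bs = concat (map (\<lambda>i. replicate (lyapunov_multiplicity A i) (lyapunov_value A i)) [1..<Suc spectrum_size])"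
    and s: "sorted_wrt (\<ge>) (map chi bs)"
    using adapted_basis[of 1] by auto
  have "card (set bs) = dim (span (set bs))" using bs(2) by (metis dim_span_eq_card_independent)
  hence len: "length bs = CARD('n)" using bs F1 by (simp add: distinct_card)
  define ls where "ls = map (real_of_ereal \<circ> chi) bs"
  have nz: "chi c = ereal (real_of_ereal (chi c))" if "c \<in> set bs" for c
  proof (rule chi_real)
    show "c \<noteq> 0" using bs(2) that dependent_zero[of "set bs"] by auto
  qed
  show thesis
  proof (rule that[of bs ls])
    have "sorted_wrt (\<lambda>b c. chi c \<le> chi b) bs" using s by (simp add: sorted_wrt_map)
    hence "sorted_wrt (\<lambda>b c. real_of_ereal (chi c) \<le> real_of_ereal (chi b)) bs"
      by (rule sorted_wrt_mono_rel[rotated]) (metis nz ereal_less_eq(3))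
    thus "sorted_wrt (\<ge>) ls" by (simp add: ls_def sorted_wrt_map)
    show 1: "chi (bs ! k) = ereal (ls ! k)" if "k < CARD('n)" for k
      using nz[of "bs ! k"] that len by (simp add: ls_def)
    show "lyapunov_counted A (Suc k) = ereal (ls ! k)" if "k < CARD('n)" for k
      using 1[OF that] that len unfolding lyapunov_counted_def m[symmetric] by simp
  qed (use bs len in \<open>auto simp: ls_def\<close>)
qed

end

section \<open>Growth of the compound of a regular system\<close>

text \<open>The error is counted with \<open>CARD('i)\<close> rather than \<open>card I\<close>, so
  one choice of \<open>e\<close> serves all index sets.\<close>

lemma exp_sum_le_prod:
  fixes lam :: "'i::finite \<Rightarrow> real"
  assumes "\<And>i. i \<in> I \<Longrightarrow> 0 \<le> x i \<and> x i \<le> exp ((lam i + e) * t)" "e \<ge> 0" "t \<ge> 0"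
  shows "(\<Prod>i\<in>I. x i) \<le> exp (((\<Sum>i\<in>I. lam i) + real CARD('i) * e) * t)"
proof -
  have "(\<Prod>i\<in>I. x i) \<le> (\<Prod>i\<in>I. exp ((lam i + e) * t))" using assms(1) by (intro prod_mono) auto
  also have "\<dots> = exp (((\<Sum>i\<in>I. lam i) + real (card I) * e) * t)"
    by (simp add: exp_sum[symmetric] sum.distrib sum_distrib_right[symmetric])
  also have "\<dots> \<le> exp (((\<Sum>i\<in>I. lam i) + real CARD('i) * e) * t)"
    using assms by (auto intro!: mult_right_mono add_left_mono card_mono)
  finally show ?thesis .
qed

lemma adapted_basis_matrix:
  fixes A X :: "real \<Rightarrow> 'n::{finite,linorder} square"
  assumes "bounded_system A X a"
  obtains V :: "'n square" and lam :: "'n \<Rightarrow> real" where "invertible V" "antimono lam"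
    "\<And>i e. e > 0 \<Longrightarrow> eventually (\<lambda>t. norm (column i (X t ** V)) \<le> exp ((lam i + e) * t)) at_top"
    "\<And>k. k \<in> {1..CARD('n)} \<Longrightarrow> lyapunov_counted A k = ereal (lam (nth_index k))"
proof -
  interpret bounded_system A X a by fact
  obtain bs ls where bs: "distinct bs" "independent (set bs)" "length bs = CARD('n)"
    and ls: "length ls = CARD('n)" "sorted_wrt (\<ge>) ls"
    and chi: "\<And>k. k < CARD('n) \<Longrightarrow> chi (bs ! k) = ereal (ls ! k)"
    and lc: "\<And>k. k < CARD('n) \<Longrightarrow> lyapunov_counted A (Suc k) = ereal (ls ! k)"
    using lyapunov_basis by blast
  define lam where "lam i = ls ! (index_pos i - 1)" for i :: 'n
  define v where "v i = bs ! (index_pos i - 1)" for i :: 'n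
  define V where "V = (\<chi> i j. v j $ i)"
  have colV: "column j V = v j" for j by (simp add: V_def column_def vec_eq_iff)
  have "range v = set bs"
  proof
    show "range v \<subseteq> set bs" using index_pos_less bs(3) by (auto simp: v_def intro!: nth_mem)
    show "set bs \<subseteq> range v"
    proof
      fix b assume "b \<in> set bs"
      then obtain k where k: "k < CARD('n)" "b = bs ! k" using bs(3) by (auto simp: in_set_conv_nth)
      hence "v (nth_index (Suc k)) = b" by (simp add: v_def index_pos_nth_index)
      thus "b \<in> range v" by blast
    qed
  qed
  hence colsV: "columns V = set bs" by (auto simp: columns_def colV)
  have "card (set bs) = dim (UNIV :: (real, 'n) vec set)" using bs by (simp add: distinct_card)
  hence "span (set bs) = UNIV"
    using bs(2) by (metis card_eq_dim finite_set subset_UNIV top.extremum_uniqueI)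
  hence "\<exists>B. V ** B = mat 1"
    unfolding matrix_right_invertible_span_columns colsV span_vec_eq .
  hence V: "invertible V" by (simp add: invertible_right_inverse)
  show thesis
  proof (rule that[of V lam])
    show "antimono lam"
    proof (rule antimonoI)
      fix i j :: 'n assume "i \<le> j"
      hence le: "index_pos i - 1 \<le> index_pos j - 1" by (simp add: index_pos_le_iff diff_le_mono)
      show "lam j \<le> lam i"
      proof (cases "index_pos i - 1 = index_pos j - 1")
        case False
        with le have "index_pos i - 1 < index_pos j - 1" by simp
        from sorted_wrt_nth_less[OF ls(2) this] index_pos_less[of j] ls(1) show ?thesis
          by (simp add: lam_def)
      qed (simp add: lam_def)
    qed
    show "eventually (\<lambda>t. norm (column i (X t ** V)) \<le> exp ((lam i + e) * t)) at_top" if "e > 0" for i e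
    proof -
      have "column i (X t ** V) = X t *v v i" for t
        unfolding colV[symmetric] by (metis matrix_vector_mul_assoc matrix_vector_mult_basis)
      moreover have "chi (v i) \<le> ereal (lam i)"
        using chi[OF index_pos_less[of i]] by (simp add: v_def lam_def)
      ultimately show ?thesis using that unfolding chi_le_iff by simp
    qed
    show "lyapunov_counted A k = ereal (lam (nth_index k))" if "k \<in> {1..CARD('n)}" for k
    proof -
      have "k - 1 < CARD('n)" "Suc (k - 1) = k" using that by auto
      with lc[of "k - 1"] that show ?thesis by (simp add: lam_def index_pos_nth_index)
    qed
  qed (rule V)
qed

lemma compound_growth:
  fixes A X :: "real \<Rightarrow> 'n::{finite,linorder} square"
  assumes sys: "bounded_system A X a" and reg: "regular_system A X" and L: "L \<le> CARD('n)"
  defines "S \<equiv> first_indices L :: 'n set"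
  obtains \<sigma> where "(\<Sum>i=1..L. lyapunov_counted A i) = ereal \<sigma>"
    "\<And>e. e > 0 \<Longrightarrow> eventually (\<lambda>t. exp ((\<sigma> - e) * t) \<le> norm (compound S (X t))) at_top"
    "\<And>e. e > 0 \<Longrightarrow> eventually (\<lambda>t. norm (compound S (X t)) \<le> exp ((\<sigma> + e) * t)) at_top"
proof -
  interpret bounded_system A X a by fact
  obtain V :: "'n square" and lam :: "'n \<Rightarrow> real" where V: "invertible V" and anti: "antimono lam"
    and grow: "\<And>i e. e > 0 \<Longrightarrow> eventually (\<lambda>t. norm (column i (X t ** V)) \<le> exp ((lam i + e) * t)) at_top"
    and lc: "\<And>k. k \<in> {1..CARD('n)} \<Longrightarrow> lyapunov_counted A k = ereal (lam (nth_index k))"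
    using adapted_basis_matrix[OF sys] by blast
  have S: "down_closed S" unfolding S_def by (rule down_closed_first_indices[OF L])
  let ?d = "real CARD('n)"
  define \<sigma> where "\<sigma> = (\<Sum>i\<in>S. lam i)"
  have sum_lc: "(\<Sum>i=1..M. lyapunov_counted A i) = ereal (\<Sum>i\<in>first_indices M. lam i)" if "M \<le> CARD('n)" for M
  proof -
    have "(\<Sum>i=1..M. lyapunov_counted A i) = (\<Sum>i=1..M. ereal (lam (nth_index i)))"
      using that by (intro sum.cong refl lc) auto
    also have "\<dots> = (\<Sum>i\<in>first_indices M. ereal (lam i))"
      by (rule sum.reindex_bij_betw[OF bij_betw_first_indices[OF that]])
    finally show ?thesis by simp
  qed
  have full: "first_indices CARD('n) = (UNIV :: 'n set)"
    using bij_betw_nth_index[where 'n='n] by (simp only: first_indices_def bij_betw_def)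
  define \<tau> where "\<tau> = (\<Sum>i\<in>UNIV. lam i)"
  have \<tau>: "\<tau> = \<sigma> + (\<Sum>i\<in>-S. lam i)"
    unfolding \<tau>_def \<sigma>_def by (subst sum.union_disjoint[symmetric]) auto
  have growth: "eventually (\<lambda>t. \<forall>i. norm (column i (X t ** V)) \<le> exp ((lam i + e) * t)) at_top" if "e > 0" for e
    using grow[OF that] by (intro eventually_all_finite)
  show thesis
  proof (rule that[of \<sigma>])
    show "(\<Sum>i=1..L. lyapunov_counted A i) = ereal \<sigma>" using sum_lc[OF L] by (simp add: \<sigma>_def S_def)
  next
    fix e :: real assume e: "e > 0"
    \<comment> \<open>At most \<open>CARD('n)\<close> columns contribute an error \<open>e'\<close>
      each; what remains of \<open>e\<close> absorbs the constant \<open>c\<close>.\<close>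
    define e' where "e' = e / (?d + 1)"
    have e': "e' > 0" "?d * e' < e" using e by (auto simp: e'_def field_simps)
    obtain W where W: "V ** W = mat 1" using V by (auto simp: invertible_def)
    define c where "c = (real CARD('n\<Rightarrow>'n))\<^sup>2 / minor_weight S * fact (card S) * norm (compound S W)"
    have "\<sigma> + ?d * e' < \<sigma> + e" using e' by simp
    from eventually_scaled_exp_le[OF this, of c] growth[OF e'(1)] eventually_ge_at_top[of 0]
    show "eventually (\<lambda>t. norm (compound S (X t)) \<le> exp ((\<sigma> + e) * t)) at_top"
    proof eventually_elim
      case (elim t)
      have "\<bar>minor S f g (X t ** V)\<bar> \<le> fact (card S) * exp ((\<sigma> + ?d * e') * t)" for f g
      proof (cases "inj_on g S")
        \<comment> \<open>The selected columns are distinct and the exponents decrease, so the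
          exponents of these columns add up to at most those of the first \<open>L\<close>.\<close>
        case True
        have "card (g ` S) = card S" using True by (rule card_image)
        then obtain \<pi> where \<pi>: "bij_betw \<pi> S (g ` S)" "\<And>i. i \<in> S \<Longrightarrow> i \<le> \<pi> i"
          using down_closed_dominated[OF S] by blast
        have "(\<Sum>j\<in>g ` S. lam j) = (\<Sum>i\<in>S. lam (\<pi> i))" by (rule sum.reindex_bij_betw[OF \<pi>(1), symmetric])
        also have "\<dots> \<le> \<sigma>" unfolding \<sigma>_def using anti \<pi>(2) by (intro sum_mono) (auto dest: antimonoD)
        finally have le: "(\<Sum>j\<in>g ` S. lam j) \<le> \<sigma>" .
        have "(\<Prod>i\<in>S. norm (column (g i) (X t ** V))) = (\<Prod>j\<in>g ` S. norm (column j (X t ** V)))"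
          using True by (simp add: prod.reindex)
        also have "\<dots> \<le> exp (((\<Sum>j\<in>g ` S. lam j) + ?d * e') * t)"
          using elim e' by (intro exp_sum_le_prod) auto
        also have "\<dots> \<le> exp ((\<sigma> + ?d * e') * t)"
          using le elim by (simp add: mult_right_mono)
        finally have "fact (card S) * (\<Prod>i\<in>S. norm (column (g i) (X t ** V))) \<le>
            fact (card S) * exp ((\<sigma> + ?d * e') * t)" by (intro mult_left_mono) auto
        with minor_column_bound[of S f g "X t ** V"] show ?thesis by (rule order_trans)
      qed (simp add: minor_not_inj_cols)
      note b = norm_compound_le[of S "X t ** V", OF this]
      have "X t = X t ** V ** W" using W by (simp flip: matrix_mul_assoc)
      hence "norm (compound S (X t)) \<le> norm (compound S (X t ** V)) * norm (compound S W)"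
        by (metis compound_mult norm_matrix_mult_le)
      also have "\<dots> \<le> c * exp ((\<sigma> + ?d * e') * t)"
        using mult_right_mono[OF b, of "norm (compound S W)"] by (simp add: c_def mult_ac)
      also note elim(1)
      finally show ?case .
    qed
  next
    fix e :: real assume e: "e > 0"
    \<comment> \<open>One \<open>e'\<close> is lost in the determinant and at most
      \<open>CARD('n)\<close> further ones in the columns outside \<open>S\<close>; the rest of
      \<open>e\<close> absorbs \<open>k\<close>.\<close>
    define e' where "e' = e / (?d + 2)"
    have e': "e' > 0" "(?d + 1) * e' < e" using e by (auto simp: e'_def field_simps)
    obtain c where c: "c > 0" "\<And>M Q R. is_QR M Q R \<Longrightarrow> (\<Prod>i\<in>S. R $ i $ i) \<le> c * norm (wedge S M)"
      using prod_diagonal_QR_comparable[OF S] by blast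
    have detV: "det V \<noteq> 0" using V by (simp add: invertible_det_nz)
    define k where "k = c * norm (wedge S V) / \<bar>det V\<bar> + 1"
    have k: "k > 0" using c detV by (simp add: k_def add_nonneg_pos)
    \<comment> \<open>Regularity enters here: up to \<open>e'\<close> the determinant grows at least
      as fast as the sum of all exponents.\<close>
    have "ereal \<tau> = Liminf at_top (\<lambda>t. ereal (1 / t * ln \<bar>det (X t)\<bar>))"
      using reg sum_lc[of "CARD('n)"] full by (simp add: regular_system_def \<tau>_def)
    hence "eventually (\<lambda>t. ereal (\<tau> - e') < ereal (1 / t * ln \<bar>det (X t)\<bar>)) at_top"
      using e' by (intro less_LiminfD) (metis diff_less_eq ereal_less_eq(4) less_add_same_cancel1 less_ereal.simps(1))
    moreover have "\<sigma> - e < \<sigma> - (?d + 1) * e'" using e' by simp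
    note eventually_scaled_exp_le[OF this, of k]
    ultimately show "eventually (\<lambda>t. exp ((\<sigma> - e) * t) \<le> norm (compound S (X t))) at_top"
      using growth[OF e'(1)] eventually_gt_at_top[of 0]
    proof eventually_elim
      case (elim t)
      have inv: "invertible (X t ** V)" using invertible_X[of t] elim V by (simp add: invertible_mult)
      have detX: "\<bar>det (X t)\<bar> > 0" using invertible_X[of t] elim by (simp add: invertible_det_nz)
      have "(\<tau> - e') * t \<le> ln \<bar>det (X t)\<bar>" using elim by (simp add: field_simps)
      hence "exp ((\<tau> - e') * t) \<le> \<bar>det (X t)\<bar>" using detX by (metis exp_ln exp_le_cancel_iff)
      hence "exp ((\<tau> - e') * t) * \<bar>det V\<bar> \<le> \<bar>det (X t ** V)\<bar>"
        by (simp add: det_mul abs_mult mult_right_mono)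
      also obtain Q R where qr: "is_QR (X t ** V) Q R" using is_QR_exists[OF inv] by blast
      have "\<bar>det (X t ** V)\<bar> \<le> (\<Prod>i\<in>S. R $ i $ i) * (\<Prod>i\<in>-S. norm (column i (X t ** V)))"
        by (rule abs_det_le_QR[OF qr])
      also have "\<dots> \<le> (c * norm (wedge S (X t ** V))) * exp (((\<Sum>i\<in>-S. lam i) + ?d * e') * t)"
        using c qr elim e' by (intro mult_mono exp_sum_le_prod prod_nonneg mult_nonneg_nonneg) auto
      also have "\<dots> \<le> (c * (norm (compound S (X t)) * norm (wedge S V))) * exp (((\<Sum>i\<in>-S. lam i) + ?d * e') * t)"
        unfolding wedge_mult using c by (intro mult_right_mono mult_left_mono norm_matrix_vector_le) auto
      finally have "exp ((\<tau> - e') * t) \<le> c * norm (wedge S V) / \<bar>det V\<bar> *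
          norm (compound S (X t)) * exp (((\<Sum>i\<in>-S. lam i) + ?d * e') * t)"
        using detV by (simp add: field_simps)
      also have "\<dots> \<le> k * norm (compound S (X t)) * exp (((\<Sum>i\<in>-S. lam i) + ?d * e') * t)"
        unfolding k_def by (intro mult_right_mono) auto
      finally have "exp ((\<tau> - e') * t) * exp (- (((\<Sum>i\<in>-S. lam i) + ?d * e') * t)) \<le> k * norm (compound S (X t))"
      proof -
        assume "exp ((\<tau> - e') * t) \<le> k * norm (compound S (X t)) * exp (((\<Sum>i\<in>-S. lam i) + ?d * e') * t)"
        hence "exp ((\<tau> - e') * t) * exp (- (((\<Sum>i\<in>-S. lam i) + ?d * e') * t)) \<le>
            k * norm (compound S (X t)) * exp (((\<Sum>i\<in>-S. lam i) + ?d * e') * t) *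
            exp (- (((\<Sum>i\<in>-S. lam i) + ?d * e') * t))"
          by (rule mult_right_mono) simp
        thus ?thesis unfolding mult.assoc exp_minus by simp
      qed
      moreover have "(\<tau> - e') * t - ((\<Sum>i\<in>-S. lam i) + ?d * e') * t = (\<sigma> - (?d + 1) * e') * t"
        by (simp add: \<tau> algebra_simps)
      ultimately have "exp ((\<sigma> - (?d + 1) * e') * t) \<le> k * norm (compound S (X t))"
        by (simp flip: exp_add)
      with elim(2) have "k * exp ((\<sigma> - e) * t) \<le> k * norm (compound S (X t))" by linarith
      thus ?case using k by simp
    qed
  qed
qed

section \<open>Perturbed products\<close>

lemma matrix_diff_ldistrib: "A ** (B - C) = A ** B - A ** (C :: real^'k^'n)"
  and matrix_diff_rdistrib: "(D - E) ** C = D ** C - E ** (C :: real^'k^'n)"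
  by (simp_all add: vec_eq_iff matrix_matrix_mult_def sum_subtractf algebra_simps)

lemma matrix_mult_sum_right: "A ** (\<Sum>i\<in>I. f i) = (\<Sum>i\<in>I. A ** (f i :: real^'k^'n))"
proof (induction I rule: infinite_finite_induct)
  case (insert i I)
  thus ?case by (simp add: matrix_add_ldistrib)
qed simp_all

text \<open>Discrete variation of constants: \<open>B k j\<close> is the exact propagator from
  \<open>j\<close> to \<open>k\<close>, \<open>G n\<close> a perturbed step, \<open>Y n\<close> the
  perturbed propagator from \<open>N\<close>. For compounds \<open>B n n\<close> is only a
  projection, so \<open>proj\<close> and \<open>Y N = B N N\<close> replace statements about the
  identity.\<close>

lemma perturbed_product_expansion:
  fixes B :: "nat \<Rightarrow> nat \<Rightarrow> real^'m^'m" and G Y :: "nat \<Rightarrow> real^'m^'m"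
  assumes comp: "\<And>i j k. i \<le> j \<Longrightarrow> j \<le> k \<Longrightarrow> B k j ** B j i = B k i"
    and proj: "\<And>n. B (Suc n) (Suc n) ** G n = G n"
    and Y0: "Y N = B N N" and Y: "\<And>n. N \<le> n \<Longrightarrow> Y (Suc n) = G n ** Y n"
    and n: "N \<le> n"
  shows "Y n - B n N = (\<Sum>j=N..<n. B n (Suc j) ** ((G j - B (Suc j) j) ** Y j))"
  using n
proof (induction n rule: dec_induct)
  case base
  show ?case by (simp add: Y0)
next
  case (step n)
  have "B (Suc n) (Suc n) ** (G n - B (Suc n) n) = G n - B (Suc n) n"
    by (simp add: matrix_diff_ldistrib proj comp)
  hence 1: "B (Suc n) (Suc n) ** ((G n - B (Suc n) n) ** Y n) = (G n - B (Suc n) n) ** Y n"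
    by (simp add: matrix_mul_assoc)
  have 2: "B (Suc n) n ** (\<Sum>j=N..<n. B n (Suc j) ** ((G j - B (Suc j) j) ** Y j)) =
      (\<Sum>j=N..<n. B (Suc n) (Suc j) ** ((G j - B (Suc j) j) ** Y j))"
    unfolding matrix_mult_sum_right
    by (intro sum.cong refl) (simp add: matrix_mul_assoc comp)
  have "Y (Suc n) - B (Suc n) N = B (Suc n) n ** (Y n - B n N) + (G n - B (Suc n) n) ** Y n"
    using step.hyps by (simp add: Y comp matrix_diff_ldistrib matrix_diff_rdistrib)
  also have "\<dots> = (\<Sum>j=N..<n. B (Suc n) (Suc j) ** ((G j - B (Suc j) j) ** Y j)) +
      B (Suc n) (Suc n) ** ((G n - B (Suc n) n) ** Y n)"
    unfolding step.IH 1 2 ..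
  finally show ?case using step.hyps by simp
qed

text \<open>Each summand is the difference of two consecutive products.\<close>

lemma sum_prod_telescope:
  fixes x :: "nat \<Rightarrow> real"
  assumes "N \<le> n"
  shows "(\<Sum>j=N..<n. x j * (\<Prod>i=N..<j. 1 + x i)) = (\<Prod>i=N..<n. 1 + x i) - 1"
  using assms by (induction n rule: dec_induct) (simp_all add: algebra_simps)

text \<open>A discrete Gronwall argument relative to \<open>norm (B n N)\<close>: with the induction
  hypothesis for all earlier \<open>Y j\<close>, the bounds for the terms of the expansion form a
  telescoping sum.\<close>

lemma perturbed_product_bound:
  fixes B :: "nat \<Rightarrow> nat \<Rightarrow> real^'m^'m" and G Y :: "nat \<Rightarrow> real^'m^'m"
  assumes comp: "\<And>i j k. i \<le> j \<Longrightarrow> j \<le> k \<Longrightarrow> B k j ** B j i = B k i"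
    and proj: "\<And>n. B (Suc n) (Suc n) ** G n = G n"
    and fast: "\<And>i j k. i \<le> j \<Longrightarrow> j \<le> k \<Longrightarrow> norm (B k j) * norm (B j i) \<le> C * norm (B k i)"
    and low: "\<And>n. \<beta> \<le> norm (B (Suc n) n)" and \<beta>: "\<beta> > 0" and C: "C \<ge> 0"
    and err: "\<And>n. norm (G n - B (Suc n) n) \<le> e n"
    and Y0: "Y N = B N N" and Y: "\<And>n. N \<le> n \<Longrightarrow> Y (Suc n) = G n ** Y n"
    and n: "N \<le> n"
  shows "norm (Y n - B n N) \<le> norm (B n N) * ((\<Prod>j=N..<n. 1 + C\<^sup>2 / \<beta> * e j) - 1)"
  using n
proof (induction n rule: less_induct)
  case (less n)
  define D where "D = C\<^sup>2 / \<beta>"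
  have D: "D \<ge> 0" using \<beta> by (simp add: D_def)
  have e: "e j \<ge> 0" for j using err[of j] norm_ge_zero order_trans by blast
  define \<pi> where "\<pi> n = (\<Prod>j=N..<n. 1 + D * e j)" for n
  have \<pi>: "\<pi> j \<ge> 0" for j unfolding \<pi>_def using D e by (intro prod_nonneg) auto
  have Yj: "norm (Y j) \<le> norm (B j N) * \<pi> j" if "N \<le> j" "j < n" for j
  proof -
    have "norm (Y j) \<le> norm (Y j - B j N) + norm (B j N)" by (metis norm_triangle_sub add.commute)
    also have "\<dots> \<le> norm (B j N) * (\<pi> j - 1) + norm (B j N)"
      using less.IH[OF that(2,1)] by (simp add: \<pi>_def D_def)
    finally show ?thesis by (simp add: algebra_simps)
  qed
  \<comment> \<open>The intervals from \<open>N\<close> to \<open>j\<close> and from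
    \<open>Suc j\<close> to \<open>n\<close> are not adjacent. The step between them is inserted
    through its lower bound \<beta>, and \<open>fast\<close> is applied twice; hence
    \<open>D = C\<^sup>2 / \<beta>\<close>.\<close>
  have gap: "norm (B n (Suc j)) * norm (B j N) \<le> D * norm (B n N)" if "N \<le> j" "j < n" for j
  proof -
    have "norm (B n (Suc j)) * \<beta> * norm (B j N) \<le> norm (B n (Suc j)) * norm (B (Suc j) j) * norm (B j N)"
      by (intro mult_right_mono mult_left_mono low) auto
    also have "\<dots> \<le> C * norm (B n j) * norm (B j N)"
      using that by (intro mult_right_mono fast) auto
    also have "\<dots> \<le> C * (C * norm (B n N))"
      using that C unfolding mult.assoc by (intro mult_left_mono fast) auto
    finally show ?thesis using \<beta> by (simp add: D_def field_simps power2_eq_square)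
  qed
  have eq: "Y n - B n N = (\<Sum>j=N..<n. B n (Suc j) ** ((G j - B (Suc j) j) ** Y j))"
    by (rule perturbed_product_expansion[OF comp proj Y0 Y less.prems])
  have "norm (Y n - B n N) \<le> (\<Sum>j=N..<n. norm (B n (Suc j) ** ((G j - B (Suc j) j) ** Y j)))"
    unfolding eq by (rule norm_sum)
  also have "\<dots> \<le> (\<Sum>j=N..<n. norm (B n N) * (D * e j * \<pi> j))"
  proof (rule sum_mono)
    fix j assume j: "j \<in> {N..<n}"
    have "norm (B n (Suc j) ** ((G j - B (Suc j) j) ** Y j)) \<le>
        norm (B n (Suc j)) * (norm (G j - B (Suc j) j) * norm (Y j))"
      by (intro order_trans[OF norm_matrix_mult_le] mult_left_mono norm_matrix_mult_le) auto
    also have "\<dots> \<le> norm (B n (Suc j)) * (e j * (norm (B j N) * \<pi> j))"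
      using j e Yj by (intro mult_left_mono mult_mono err) auto
    also have "\<dots> = (norm (B n (Suc j)) * norm (B j N)) * (e j * \<pi> j)" by simp
    also have "\<dots> \<le> (D * norm (B n N)) * (e j * \<pi> j)"
      using j e \<pi> by (intro mult_right_mono gap) auto
    finally show "norm (B n (Suc j) ** ((G j - B (Suc j) j) ** Y j)) \<le> norm (B n N) * (D * e j * \<pi> j)"
      by (simp add: mult_ac)
  qed
  also have "\<dots> = norm (B n N) * (\<pi> n - 1)"
    unfolding \<pi>_def by (simp add: sum_distrib_left[symmetric] sum_prod_telescope[OF less.prems])
  finally show ?case by (simp add: \<pi>_def D_def)
qed

text \<open>The product is at most the exponential of a piece of a convergent tail. The bound 3/2
  leaves a relative deviation of 1/2, which is below 1, so perturbed and exact norms will bound each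
  other.\<close>

lemma summable_tail_product_le:
  fixes e :: "nat \<Rightarrow> real"
  assumes e: "summable e" "\<And>n. e n \<ge> 0" and D: "D \<ge> 0"
  shows "\<exists>N. \<forall>n\<ge>N. (\<Prod>j=N..<n. 1 + D * e j) \<le> 3 / 2"
proof -
  have "summable (\<lambda>j. D * e j)" using e by (simp add: summable_mult)
  moreover have "ln (3 / 2 :: real) > 0" by simp
  ultimately obtain N where N: "\<And>m n. m \<ge> N \<Longrightarrow> norm (\<Sum>j=m..<n. D * e j) < ln (3 / 2)"
    unfolding summable_Cauchy by metis
  show ?thesis
  proof (intro exI[of _ N] allI impI)
    fix n
    have "(\<Prod>j=N..<n. 1 + D * e j) \<le> (\<Prod>j=N..<n. exp (D * e j))"
      using e D by (intro prod_mono) (auto intro: exp_ge_add_one_self)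
    also have "\<dots> = exp (\<Sum>j=N..<n. D * e j)" by (simp add: exp_sum)
    also have "\<dots> \<le> exp (ln (3 / 2))" using N[of N n] by (simp del: exp_ln)
    finally show "(\<Prod>j=N..<n. 1 + D * e j) \<le> 3 / 2" by simp
  qed
qed

section \<open>Null sets from lines\<close>

text \<open>The translates of a compact piece of \<open>Z\<close> along \<open>w\<close> stay in a fixed ball and cover every
  point at most \<open>m\<close> times, so arbitrarily many of them have bounded total measure.\<close>
lemma null_set_finite_on_lines:
  fixes Z :: "'a::euclidean_space set"
  assumes Z: "closed Z"
    and lines: "\<And>x T. finite T \<Longrightarrow> (\<And>t. t \<in> T \<Longrightarrow> x + t *\<^sub>R w \<in> Z) \<Longrightarrow> card T \<le> m"
  shows "Z \<in> null_sets lborel"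
proof -
  have null: "emeasure lborel (Z \<inter> cball 0 (real r)) = 0" for r :: nat
  proof -
    define K where "K = Z \<inter> cball 0 (real r)"
    define U where "U = cball (0::'a) (real r + norm w)"
    have K: "compact K" unfolding K_def using Z by (simp add: closed_Int_compact)
    have Ks: "K \<in> sets lborel" using K by (simp add: borel_compact)
    have finK: "emeasure lborel K < \<infinity>" using K by (rule emeasure_compact_finite)
    have finU: "emeasure lborel U < \<infinity>" unfolding U_def by (rule emeasure_compact_finite) simp
    have bound: "of_nat M * emeasure lborel K \<le> of_nat m * emeasure lborel U" for M :: nat
    proof -
      define s where "s j = real j / real M" for j
      define A where "A j = {y. y - s j *\<^sub>R w \<in> K}" for j
      have A: "A j \<in> sets lborel" "emeasure lborel (A j) = emeasure lborel K" for j
      proof -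
        have *: "A j = (\<lambda>y. (- s j *\<^sub>R w) + y) -` K \<inter> space lborel" by (auto simp: A_def)
        show "A j \<in> sets lborel" unfolding * using Ks
          by (intro measurable_sets[of _ lborel borel]) auto
        have "emeasure lborel K = emeasure (distr lborel borel (\<lambda>y. (- s j *\<^sub>R w) + y)) K"
          by (metis lborel_distr_plus)
        also have "\<dots> = emeasure lborel (A j)" unfolding * using Ks by (subst emeasure_distr) auto
        finally show "emeasure lborel (A j) = emeasure lborel K" by simp
      qed
      have "of_nat M * emeasure lborel K = (\<Sum>j<M. emeasure lborel (A j))" by (simp add: A)
      also have "\<dots> = (\<Sum>j<M. \<integral>\<^sup>+ y. indicator (A j) y \<partial>lborel)"
        using A(1) by (simp add: nn_integral_indicator)
      also have "\<dots> = (\<integral>\<^sup>+ y. (\<Sum>j<M. indicator (A j) y) \<partial>lborel)"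
        using A(1) by (intro nn_integral_sum[symmetric]) auto
      also have "\<dots> \<le> (\<integral>\<^sup>+ y. of_nat m * indicator U y \<partial>lborel)"
      proof (rule nn_integral_mono)
        fix y :: 'a
        define J where "J = {j. j < M \<and> y \<in> A j}"
        have finJ: "finite J" by (simp add: J_def)
        have sum: "(\<Sum>j<M. indicator (A j) y :: ennreal) = of_nat (card J)"
        proof -
          have "(\<Sum>j<M. indicator (A j) y :: ennreal) = (\<Sum>j\<in>J. 1)"
            unfolding J_def by (rule sum.mono_neutral_cong_right) (auto simp: indicator_def)
          thus ?thesis by simp
        qed
        show "(\<Sum>j<M. indicator (A j) y :: ennreal) \<le> of_nat m * indicator U y"
        proof (cases "J = {}")
          case True
          thus ?thesis by (simp add: sum)
        next
          case False
          then obtain j where j: "j < M" "y - s j *\<^sub>R w \<in> K" by (auto simp: J_def A_def)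
          have "norm y \<le> norm (y - s j *\<^sub>R w) + norm (s j *\<^sub>R w)" by (metis norm_triangle_sub add.commute)
          also have "\<dots> \<le> real r + 1 * norm w"
          proof (intro add_mono)
            show "norm (y - s j *\<^sub>R w) \<le> real r" using j by (simp add: K_def)
            have "s j \<le> 1" "s j \<ge> 0" using j by (auto simp: s_def)
            thus "norm (s j *\<^sub>R w) \<le> 1 * norm w" unfolding norm_scaleR by (intro mult_right_mono) auto
          qed
          finally have yU: "y \<in> U" by (simp add: U_def)
          \<comment> \<open>That \<open>y\<close> lies in the \<open>j\<close>-th translate means
            that the parameter \<open>- s j\<close> on the line through \<open>y\<close> gives a
            point of \<open>Z\<close>; the parameters are distinct.\<close>
          have inj: "inj_on (\<lambda>j. - s j) J"
            by (rule inj_onI) (auto simp: s_def J_def field_simps)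
          have "card ((\<lambda>j. - s j) ` J) \<le> m"
            by (rule lines[where x = y]) (auto simp: J_def A_def K_def)
          hence "card J \<le> m" using inj by (simp add: card_image)
          thus ?thesis using yU by (simp add: sum)
        qed
      qed
      also have "\<dots> = of_nat m * emeasure lborel U"
        by (subst nn_integral_cmult_indicator) (auto simp: U_def)
      finally show ?thesis .
    qed
    have "measure lborel K = 0"
    proof (rule ccontr)
      assume "measure lborel K \<noteq> 0"
      hence pos: "measure lborel K > 0" by (simp add: order_less_le)
      obtain M :: nat where M: "real m * measure lborel U < real M * measure lborel K"
        using reals_Archimedean3[OF pos] by blast
      have "ennreal (real M * measure lborel K) \<le> ennreal (real m * measure lborel U)"
        using bound[of M] finK finU
        by (simp add: emeasure_eq_ennreal_measure less_top ennreal_mult ennreal_of_nat_eq_real_of_nat)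
      with M show False by (subst (asm) ennreal_le_iff) auto
    qed
    thus ?thesis using finK by (simp add: emeasure_eq_ennreal_measure less_top K_def)
  qed
  have "(\<Union>r::nat. Z \<inter> cball 0 (real r)) \<in> null_sets lborel"
    using null Z by (intro null_sets_UN) (auto simp: null_sets_def)
  moreover have "(\<Union>r::nat. Z \<inter> cball 0 (real r)) = Z"
  proof -
    have "\<exists>r::nat. norm x \<le> real r" for x :: 'a by (rule real_arch_simple)
    thus ?thesis by auto
  qed
  ultimately show ?thesis by simp
qed

section \<open>Polynomials and minors along a line\<close>

text \<open>Synthetic division at one point \<open>a\<close> of \<open>T\<close> keeps the leading
  coefficient and lowers the degree; the quotient at the other points is a divided difference,
  bounded by \<open>2 / \<bar>t - a\<bar> * e\<close>. The resulting constant depends on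
  \<open>T\<close> and \<open>m\<close> only.\<close>

lemma lead_coeff_bound:
  fixes T :: "real set"
  assumes "finite T" "card T = Suc m"
  shows "\<exists>C\<ge>0. \<forall>p e. degree p \<le> m \<longrightarrow> (\<forall>t\<in>T. \<bar>poly p t\<bar> \<le> e) \<longrightarrow> \<bar>coeff p m\<bar> \<le> C * e"
  using assms
proof (induction m arbitrary: T)
  case 0
  then obtain a where "T = {a}" by (auto simp: card_Suc_eq)
  hence "\<bar>coeff p 0\<bar> \<le> 1 * e" if "degree p \<le> 0" "\<forall>t\<in>T. \<bar>poly p t\<bar> \<le> e" for p e
    using that by (auto elim!: degree_eq_zeroE)
  thus ?case by (intro exI[of _ 1]) simp
next
  case (Suc m)
  then obtain a T' where T: "T = insert a T'" "a \<notin> T'" "card T' = Suc m"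
    by (metis card_Suc_eq)
  have fin: "finite T'" using Suc.prems(1) T(1) by simp
  obtain C where C: "C \<ge> 0"
    "\<And>p e. degree p \<le> m \<Longrightarrow> (\<forall>t\<in>T'. \<bar>poly p t\<bar> \<le> e) \<Longrightarrow> \<bar>coeff p m\<bar> \<le> C * e"
    using Suc.IH[OF fin T(3)] by blast
  define \<delta> where "\<delta> = (\<Sum>t\<in>T'. 2 / \<bar>t - a\<bar>)"
  have \<delta>: "\<delta> \<ge> 0" unfolding \<delta>_def by (intro sum_nonneg) auto
  have "\<bar>coeff p (Suc m)\<bar> \<le> C * \<delta> * e" if p: "degree p \<le> Suc m" "\<forall>t\<in>T. \<bar>poly p t\<bar> \<le> e" for p e
  proof -
    define q where "q = synthetic_div p a"
    have pq: "p = [:- a, 1:] * q + [:poly p a:]" unfolding q_def by (rule synthetic_div_correct'[symmetric])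
    have degq: "degree q \<le> m" using p by (simp add: q_def degree_synthetic_div)
    have e0: "e \<ge> 0" using p(2) T by (auto intro: order_trans[OF abs_ge_zero])
    have "coeff p (Suc m) = coeff q m - a * coeff q (Suc m)" by (subst pq) simp
    also have "coeff q (Suc m) = 0" using degq by (simp add: coeff_eq_0)
    finally have c: "coeff p (Suc m) = coeff q m" by simp
    have "\<bar>poly q t\<bar> \<le> \<delta> * e" if t: "t \<in> T'" for t
    proof -
      have ta: "t \<noteq> a" using t T by auto
      have "poly p t = (t - a) * poly q t + poly p a" by (subst pq) (simp add: algebra_simps)
      hence "(t - a) * poly q t = poly p t - poly p a" by simp
      hence "\<bar>t - a\<bar> * \<bar>poly q t\<bar> = \<bar>poly p t - poly p a\<bar>" by (metis abs_mult)
      also have "\<dots> \<le> 2 * e" using p(2) t T abs_triangle_ineq4[of "poly p t" "poly p a"] by force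
      finally have "\<bar>poly q t\<bar> \<le> 2 / \<bar>t - a\<bar> * e" using ta by (simp add: field_simps)
      also have "\<dots> \<le> \<delta> * e"
        unfolding \<delta>_def using t fin e0 by (intro mult_right_mono member_le_sum) auto
      finally show ?thesis .
    qed
    with C(2)[OF degq, of "\<delta> * e"] show ?thesis by (simp add: c mult.assoc)
  qed
  thus ?case using C(1) \<delta> by (intro exI[of _ "C * \<delta>"]) auto
qed

lemma degree_coeff_prod_linear:
  fixes u v :: "'i \<Rightarrow> real"
  assumes "finite I"
  shows "degree (\<Prod>i\<in>I. [:u i, v i:]) \<le> card I \<and> coeff (\<Prod>i\<in>I. [:u i, v i:]) (card I) = (\<Prod>i\<in>I. v i)"
  using assms
proof (induction I)
  case (insert a I)
  let ?p = "\<Prod>i\<in>I. [:u i, v i:]"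
  have "degree ([:u a, v a:] * ?p) \<le> degree [:u a, v a:] + degree ?p" by (rule degree_mult_le)
  also have "\<dots> \<le> Suc (card I)" using insert.IH by (auto intro: order_trans[OF add_mono[of _ 1]])
  finally have "degree ([:u a, v a:] * ?p) \<le> Suc (card I)" .
  moreover have "coeff ?p (Suc (card I)) = 0" using insert.IH by (intro coeff_eq_0) auto
  ultimately show ?case using insert by simp
qed simp

lemma minor_on_line:
  "\<exists>p. degree p \<le> card S \<and> coeff p (card S) = minor S f g W \<and>
    (\<forall>t. poly p t = minor S f g (U + t *\<^sub>R W))"
proof -
  let ?q = "\<lambda>\<sigma>. \<Prod>i\<in>S. [:U $ f i $ g (\<sigma> i), W $ f i $ g (\<sigma> i):]"
  let ?p = "\<Sum>\<sigma> | \<sigma> permutes S. smult (of_int (sign \<sigma>)) (?q \<sigma>)"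
  show ?thesis
  proof (intro exI[of _ ?p] conjI allI)
    show "degree ?p \<le> card S"
      by (intro degree_sum_le order_trans[OF degree_smult_le])
        (auto simp: finite_permutations degree_coeff_prod_linear)
    show "coeff ?p (card S) = minor S f g W"
      unfolding minor_def coeff_sum by (simp add: degree_coeff_prod_linear)
    show "poly ?p t = minor S f g (U + t *\<^sub>R W)" for t
      unfolding minor_def poly_sum by (simp add: poly_prod)
  qed
qed

text \<open>The order of the quantifiers matters: \<open>C\<close> is chosen before \<open>U\<close>
  and \<open>W\<close>, so one constant will serve all step numbers.\<close>

lemma minor_leading_bound:
  assumes "finite T" "card S < card T"
  shows "\<exists>C\<ge>0. \<forall>f g U W e. (\<forall>t\<in>T. \<bar>minor S f g (U + t *\<^sub>R W)\<bar> \<le> e) \<longrightarrow> \<bar>minor S f g W\<bar> \<le> C * e"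
proof -
  obtain T' where T': "T' \<subseteq> T" "card T' = Suc (card S)" "finite T'"
    using obtain_subset_with_card_n[of "Suc (card S)" T] assms by (auto simp: Suc_le_eq)
  obtain C where C: "C \<ge> 0"
    "\<And>p e. degree p \<le> card S \<Longrightarrow> (\<forall>t\<in>T'. \<bar>poly p t\<bar> \<le> e) \<Longrightarrow> \<bar>coeff p (card S)\<bar> \<le> C * e"
    using lead_coeff_bound[OF T'(3,2)] by blast
  have "\<bar>minor S f g W\<bar> \<le> C * e" if "\<forall>t\<in>T. \<bar>minor S f g (U + t *\<^sub>R W)\<bar> \<le> e" for f g U W e
  proof -
    obtain p where p: "degree p \<le> card S" "coeff p (card S) = minor S f g W"
      "\<And>t. poly p t = minor S f g (U + t *\<^sub>R W)"
      using minor_on_line[of S f g W U] by blast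
    show ?thesis using C(2)[OF p(1), of e] that T'(1) by (auto simp: p)
  qed
  with C(1) show ?thesis by blast
qed

lemma continuous_on_minor [continuous_intros]:
  "continuous_on D h \<Longrightarrow> continuous_on D (\<lambda>x. minor S f g (h x))"
  unfolding minor_def by (intro continuous_intros)

text \<open>Along the direction \<open>mat 1\<close> the determinant is a polynomial of degree
  \<open>CARD('n)\<close> with leading coefficient 1; the leading bound is used with
  \<open>e = 0\<close>.\<close>

lemma null_set_noninvertible: "{v :: real^'n^'n. det v = 0} \<in> null_sets lborel"
proof -
  let ?Z = "{v :: real^'n^'n. minor UNIV id id v = 0}"
  have det: "det v = minor UNIV id id v" for v :: "real^'n^'n"
    by (simp add: det_def minor_def)
  have "closed ?Z" by (intro closed_Collect_eq continuous_intros)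
  hence "?Z \<in> null_sets lborel"
  proof (rule null_set_finite_on_lines[where w = "mat 1" and m = "CARD('n)"])
    fix x :: "real^'n^'n" and T :: "real set"
    assume T: "finite T" "\<And>t. t \<in> T \<Longrightarrow> x + t *\<^sub>R mat 1 \<in> ?Z"
    show "card T \<le> CARD('n)"
    proof (rule ccontr)
      assume "\<not> card T \<le> CARD('n)"
      then obtain C where "\<And>f g U W e. (\<forall>t\<in>T. \<bar>minor (UNIV :: 'n set) f g (U + t *\<^sub>R W)\<bar> \<le> e) \<Longrightarrow>
          \<bar>minor UNIV f g W\<bar> \<le> C * e"
        using minor_leading_bound[OF T(1), of "UNIV :: 'n set"] by (metis not_le)
      from this[of id id x "mat 1" 0] T(2) have "minor UNIV id id (mat 1 :: real^'n^'n) = 0" by simp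
      thus False by (simp flip: det)
    qed
  qed
  thus ?thesis by (simp add: det)
qed

section \<open>The numerical solution\<close>

lemma norm_compound_pos:
  fixes M :: "real^'n^'n"
  assumes "invertible M"
  shows "norm (compound S M) > 0"
proof -
  have "compound S M \<noteq> 0"
  proof
    assume "compound S M = 0"
    hence "compound S (M ** matrix_inv M) = 0" unfolding compound_mult by (simp add: matrix_matrix_mult_def vec_eq_iff)
    hence "compound S (mat 1 :: real^'n^'n) = 0" using assms by (simp add: matrix_inv_right)
    thus False by (simp add: compound_mat_1_nonzero)
  qed
  thus ?thesis by simp
qed

lemma strongly_fast_invertible_compound:
  fixes A X :: "real \<Rightarrow> 'n::{finite,linorder} square"
  assumes sys: "bounded_system A X a" and fast: "strongly_fast_invertible L X" and L: "L \<le> CARD('n)"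
  defines "S \<equiv> first_indices L :: 'n set"
  obtains C where "C \<ge> 0" "\<And>t s r. r \<ge> 0 \<Longrightarrow> r \<le> s \<Longrightarrow> s \<le> t \<Longrightarrow>
    norm (compound S (cauchy_matrix X t s)) * norm (compound S (cauchy_matrix X s r)) \<le>
      C * norm (compound S (cauchy_matrix X t r))"
proof -
  interpret bounded_system A X a by fact
  let ?pr = "\<lambda>M :: 'n square. \<Prod>k=1..L. singular_value k M"
  obtain c where c: "c > 0" "\<And>M. ?pr M \<le> c * norm (compound S M)" "\<And>M. norm (compound S M) \<le> c * ?pr M"
    using singular_values_comparable_norm_compound[OF L] unfolding S_def by blast
  obtain C0 where C0: "\<And>t s r. r \<ge> 0 \<Longrightarrow> r \<le> s \<Longrightarrow> s \<le> t \<Longrightarrow>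
      (\<Prod>k=1..L. singular_value k (cauchy_matrix X t s) * singular_value k (cauchy_matrix X s r) /
        singular_value k (cauchy_matrix X t r)) \<le> C0"
    using fast unfolding strongly_fast_invertible_def bdd_above_def by blast
  define C1 where "C1 = max C0 0"
  show thesis
  \<comment> \<open>One factor \<open>c\<close> for each of the three products of singular values
    that is exchanged for a compound norm.\<close>
  proof (rule that[of "c ^ 3 * C1"])
    show "c ^ 3 * C1 \<ge> 0" using c by (simp add: C1_def)
    fix t s r :: real assume r: "r \<ge> 0" "r \<le> s" "s \<le> t"
    let ?N = "\<lambda>M. norm (compound S M)"
    let ?ts = "cauchy_matrix X t s" and ?sr = "cauchy_matrix X s r" and ?tr = "cauchy_matrix X t r"
    have nn: "?pr M \<ge> 0" for M
    proof -
      have "0 \<le> c * ?pr M" using c(3)[of M] norm_ge_zero order_trans by blast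
      thus ?thesis using c(1) by (simp add: zero_le_mult_iff)
    qed
    \<comment> \<open>The quotient can be multiplied out only if its denominator is nonzero;
      division by 0 would yield 0 and make the bound empty.\<close>
    have "invertible ?tr"
    proof -
      have "?tr ** cauchy_matrix X r t = mat 1"
        using r cauchy_matrix_trans[of r t t] cauchy_matrix_refl[of t] by simp
      thus ?thesis by (auto simp: invertible_right_inverse)
    qed
    hence "0 < c * ?pr ?tr" using norm_compound_pos c(3) less_le_trans by blast
    hence pos: "?pr ?tr > 0" using c(1) by (simp add: zero_less_mult_iff)
    have "?pr ?ts * ?pr ?sr / ?pr ?tr \<le> C1"
      using C0[OF r] by (simp add: prod_dividef prod.distrib C1_def)
    hence 1: "?pr ?ts * ?pr ?sr \<le> C1 * ?pr ?tr" using pos by (simp add: field_simps)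
    have "?N ?ts * ?N ?sr \<le> (c * ?pr ?ts) * (c * ?pr ?sr)"
      using c(1) nn by (intro mult_mono c(3)) auto
    also have "\<dots> = c\<^sup>2 * (?pr ?ts * ?pr ?sr)" by (simp add: power2_eq_square)
    also have "\<dots> \<le> c\<^sup>2 * (C1 * ?pr ?tr)" using 1 by (rule mult_left_mono) simp
    also have "\<dots> \<le> c\<^sup>2 * (C1 * (c * ?N ?tr))"
      by (intro mult_left_mono c(2)) (auto simp: C1_def)
    finally show "?N ?ts * ?N ?sr \<le> c ^ 3 * C1 * ?N ?tr"
      by (simp add: power2_eq_square power3_eq_cube mult_ac)
  qed
qed

primrec step_product :: "(real \<Rightarrow> real \<Rightarrow> real^'n^'n) \<Rightarrow> (nat \<Rightarrow> real) \<Rightarrow> nat \<Rightarrow> real^'n^'n" where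
  "step_product \<Phi> h 0 = mat 1"
| "step_product \<Phi> h (Suc n) = step_matrix \<Phi> h (Suc n) ** step_product \<Phi> h n"

lemma invertible_mat_1: "invertible (mat 1 :: real^'n^'n)"
  by (auto simp: invertible_def)

lemma grid_time_0 [simp]: "grid_time h 0 = 0"
  and grid_time_Suc: "grid_time h (Suc n) = grid_time h n + h (Suc n)"
  by (simp_all add: grid_time_def)

lemma step_product_comparable:
  fixes A X :: "real \<Rightarrow> 'n::{finite,linorder} square"
  assumes sys: "bounded_system A X a" and fast: "strongly_fast_invertible L X" and L: "L \<le> CARD('n)"
    and one_step: "one_step_method hmax \<Phi>" and consistent: "consistent_of_order hmax X \<Phi> p" and p: "p > 0"
    and h: "\<And>n. n \<ge> 1 \<Longrightarrow> 0 < h n \<and> h n \<le> hmax"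
    and sum: "summable (\<lambda>n. h (Suc n) powr (p + 1))"
  defines "S \<equiv> first_indices L :: 'n set"
  shows "\<exists>c>0. \<exists>N. \<forall>n\<ge>N. norm (compound S (step_product \<Phi> h n)) \<le> c * norm (compound S (X (grid_time h n))) \<and>
    norm (compound S (X (grid_time h n))) \<le> c * norm (compound S (step_product \<Phi> h n))"
proof -
  interpret bounded_system A X a by fact
  let ?N = "\<lambda>M. norm (compound S M)"
  let ?P = "step_product \<Phi> h"
  define t where "t = grid_time h"
  have tSuc: "t (Suc n) = t n + h (Suc n)" for n by (simp add: t_def grid_time_Suc)
  have hpos: "0 < h (Suc n)" "h (Suc n) \<le> hmax" for n using h[of "Suc n"] by auto
  have tmono: "t i \<le> t j" if "i \<le> j" for i j
    using that by (rule lift_Suc_mono_le[rotated]) (use hpos in \<open>simp add: tSuc less_imp_le\<close>)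
  have t0: "t n \<ge> 0" for n using tmono[of 0 n] by (simp add: t_def)
  have step: "step_matrix \<Phi> h (Suc n) = \<Phi> (t n) (h (Suc n))" for n
    by (simp add: step_matrix_def t_def)
  have inv_step: "invertible (step_matrix \<Phi> h (Suc n))" for n
    using one_step t0[of n] hpos[of n] unfolding step one_step_method_def by auto
  have inv_P: "invertible (?P n)" for n
    by (induction n) (auto simp: invertible_mat_1 intro!: invertible_mult inv_step)
  define B where "B k j = compound S (cauchy_matrix X (t k) (t j))" for k j
  define G where "G n = compound S (step_matrix \<Phi> h (Suc n))" for n
  have comp: "B k j ** B j i = B k i" for i j k
    unfolding B_def compound_mult[symmetric] cauchy_matrix_trans[OF t0] ..
  have proj: "B (Suc n) (Suc n) ** G n = G n" for n
    unfolding B_def G_def compound_mult[symmetric] cauchy_matrix_refl[OF t0] by simp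
  obtain C where C: "C \<ge> 0" "\<And>i j k. i \<le> j \<Longrightarrow> j \<le> k \<Longrightarrow> norm (B k j) * norm (B j i) \<le> C * norm (B k i)"
    using strongly_fast_invertible_compound[OF sys fast L] t0 tmono unfolding S_def B_def by metis
  obtain c0 where c0: "c0 > 0" "\<And>t h. t \<ge> 0 \<Longrightarrow> h \<in> {0..hmax} \<Longrightarrow>
      onorm ((*v) (\<Phi> t h - cauchy_matrix X (t + h) t)) \<le> c0 * h powr (p + 1)"
    using consistent unfolding consistent_of_order_def by blast
  have hmax: "hmax > 0" using hpos[of 0] by linarith
  define w where "w = (real CARD('n\<Rightarrow>'n))\<^sup>2 / minor_weight S"
  have w: "w \<ge> 0" using minor_weight_pos[of S] by (simp add: w_def)
  \<comment> \<open>Bounds the entries of exact and numerical one-step matrices alike: the exact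
    flow over a time of at most \<open>hmax\<close>, plus the largest local error.\<close>
  define b where "b = exp (a * hmax) + c0 * hmax powr (p + 1)"
  have "1 \<le> exp (a * hmax)" using a_nonneg hmax by simp
  hence b1: "1 \<le> b" using c0(1) by (simp add: b_def add_increasing2)
  have cm_bound: "\<bar>cauchy_matrix X u v $ i $ j\<bar> \<le> exp (a * hmax)"
    if "u \<ge> 0" "v \<ge> 0" "\<bar>u - v\<bar> \<le> hmax" for u v i j
  proof -
    have "\<bar>cauchy_matrix X u v $ i $ j\<bar> \<le> exp (a * \<bar>u - v\<bar>)"
      using that by (intro cauchy_matrix_bound) auto
    also have "\<dots> \<le> exp (a * hmax)" using that a_nonneg by (simp add: mult_left_mono)
    finally show ?thesis .
  qed
  \<comment> \<open>Bounds the compound of the backward step from \<open>t (Suc n)\<close> to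
    \<open>t n\<close>. Backward and forward step compose to the identity, which gives the lower
    bound \<beta> for the forward step; the summand 1 ensures positivity.\<close>
  define \<kappa> where "\<kappa> = w * (fact (card S) * exp (a * hmax) ^ card S) + 1"
  have \<kappa>: "\<kappa> > 0" using w by (simp add: \<kappa>_def add_nonneg_pos)
  define \<beta> where "\<beta> = ?N (mat 1) / \<kappa>"
  have \<beta>: "\<beta> > 0" using \<kappa> norm_compound_pos[OF invertible_mat_1, of S] by (simp add: \<beta>_def)
  have low: "\<beta> \<le> norm (B (Suc n) n)" for n
  proof -
    have "compound S (mat 1) = B n (Suc n) ** B (Suc n) n"
      unfolding comp by (simp add: B_def cauchy_matrix_refl t0)
    hence "?N (mat 1) \<le> norm (B n (Suc n)) * norm (B (Suc n) n)" by (simp add: norm_matrix_mult_le)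
    also have "norm (B n (Suc n)) \<le> w * (fact (card S) * exp (a * hmax) ^ card S)"
      unfolding B_def w_def
      by (rule norm_compound_entry_bound, rule cm_bound) (use t0 hpos[of n] in \<open>auto simp: tSuc\<close>)
    also have "\<dots> \<le> \<kappa>" by (simp add: \<kappa>_def)
    finally show ?thesis using \<kappa> by (simp add: \<beta>_def field_simps mult_right_mono)
  qed
  define D where "D = w * (fact (card S) * (real (card S) * b ^ card S * c0))"
  define e where "e n = D * h (Suc n) powr (p + 1)" for n
  have D: "D \<ge> 0" unfolding D_def using w b1 c0(1) by (intro mult_nonneg_nonneg) auto
  have err: "norm (G n - B (Suc n) n) \<le> e n" for n
  proof -
    let ?M = "\<Phi> (t n) (h (Suc n))" and ?X = "cauchy_matrix X (t (Suc n)) (t n)"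
    let ?e = "c0 * h (Suc n) powr (p + 1)"
    have d: "\<bar>?M $ i $ j - ?X $ i $ j\<bar> \<le> ?e" for i j
    proof -
      have "\<bar>(?M - ?X) $ i $ j\<bar> \<le> onorm ((*v) (?M - ?X))" by (rule matrix_component_le_onorm)
      also have "\<dots> \<le> ?e" using c0(2)[of "t n" "h (Suc n)"] t0[of n] hpos[of n] by (simp add: tSuc)
      finally show ?thesis by simp
    qed
    have X: "\<bar>?X $ i $ j\<bar> \<le> exp (a * hmax)" for i j
      using t0 hpos[of n] by (intro cm_bound) (auto simp: tSuc)
    have "h (Suc n) powr (p + 1) \<le> hmax powr (p + 1)"
      using hpos[of n] p by (intro powr_mono2) auto
    hence "?e \<le> c0 * hmax powr (p + 1)" using c0(1) by simp
    moreover have "0 \<le> c0 * hmax powr (p + 1)" using c0(1) by simp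
    ultimately have bd: "\<bar>?M $ i $ j\<bar> \<le> b" "\<bar>?X $ i $ j\<bar> \<le> b" for i j
      using d[of i j] X[of i j] unfolding b_def by linarith+
    have "norm (G n - B (Suc n) n) \<le> w * (fact (card S) * (real (card S) * b ^ card S * ?e))"
      unfolding G_def B_def step w_def using c0(1) by (intro compound_lipschitz b1 bd d) auto
    thus ?thesis by (simp add: e_def D_def mult_ac)
  qed
  have "summable e" unfolding e_def using sum by (rule summable_mult)
  moreover have "e n \<ge> 0" for n using D by (simp add: e_def)
  ultimately obtain N where N: "\<And>n. n \<ge> N \<Longrightarrow> (\<Prod>j=N..<n. 1 + C\<^sup>2 / \<beta> * e j) \<le> 3 / 2"
    using summable_tail_product_le[of e "C\<^sup>2 / \<beta>"] \<beta> by auto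
  \<comment> \<open>The numerical propagator starting at \<open>N\<close>; at \<open>n = N\<close>
    it is the compound of the identity, that is, \<open>B N N\<close>.\<close>
  define Y where "Y n = compound S (?P n ** matrix_inv (?P N))" for n
  have near: "norm (Y n - B n N) \<le> norm (B n N) * (1 / 2)" if n: "N \<le> n" for n
  proof -
    have "norm (Y n - B n N) \<le> norm (B n N) * ((\<Prod>j=N..<n. 1 + C\<^sup>2 / \<beta> * e j) - 1)"
    proof (rule perturbed_product_bound[where B = B and G = G and Y = Y and N = N and C = C and \<beta> = \<beta> and e = e])
      show "Y N = B N N"
        by (simp add: Y_def B_def cauchy_matrix_refl t0 matrix_inv_right inv_P)
      show "Y (Suc n) = G n ** Y n" for n
        by (simp add: Y_def G_def compound_mult[symmetric] matrix_mul_assoc)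
    qed (use comp proj C low \<beta> err n in blast)+
    also have "\<dots> \<le> norm (B n N) * (1 / 2)" using N[OF n] by (intro mult_left_mono) auto
    finally show ?thesis .
  qed
  \<comment> \<open>These four norms are the cost of passing between propagators from
    \<open>N\<close> and from time 0.\<close>
  define a1 where "a1 = ?N (?P N)"
  define a2 where "a2 = ?N (matrix_inv (?P N))"
  define x1 where "x1 = ?N (X (t N))"
  define x2 where "x2 = ?N (matrix_inv (X (t N)))"
  have nn: "a1 \<ge> 0" "a2 \<ge> 0" "x1 \<ge> 0" "x2 \<ge> 0" by (simp_all add: a1_def a2_def x1_def x2_def)
  define c where "c = 3 / 2 * x2 * a1 + 2 * x1 * a2 + 1"
  have "?N (?P n) \<le> c * ?N (X (t n)) \<and> ?N (X (t n)) \<le> c * ?N (?P n)" if n: "N \<le> n" for n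
  proof
    have Y_le: "norm (Y n) \<le> 3 / 2 * norm (B n N)"
      using near[OF n] norm_triangle_sub[of "Y n" "B n N"] by simp
    have B_le: "norm (B n N) \<le> 2 * norm (Y n)"
      using near[OF n] norm_triangle_sub[of "B n N" "Y n"] by (simp add: norm_minus_commute)
    have "?P n = ?P n ** matrix_inv (?P N) ** ?P N"
      using inv_P by (simp add: matrix_inv_left flip: matrix_mul_assoc)
    hence "?N (?P n) \<le> norm (Y n) * a1"
      unfolding Y_def a1_def by (metis compound_mult norm_matrix_mult_le)
    also have "\<dots> \<le> 3 / 2 * norm (B n N) * a1" using Y_le nn by (intro mult_right_mono) auto
    also have "norm (B n N) \<le> ?N (X (t n)) * x2"
      unfolding B_def cauchy_matrix_def compound_mult x2_def by (rule norm_matrix_mult_le)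
    hence "3 / 2 * norm (B n N) * a1 \<le> 3 / 2 * (?N (X (t n)) * x2) * a1"
      using nn by (intro mult_right_mono mult_left_mono) auto
    also have "\<dots> = (3 / 2 * x2 * a1) * ?N (X (t n))" by simp
    also have "\<dots> \<le> c * ?N (X (t n))" unfolding c_def using nn by (intro mult_right_mono) auto
    finally show "?N (?P n) \<le> c * ?N (X (t n))" .
    have "X (t n) = cauchy_matrix X (t n) (t N) ** X (t N)"
      unfolding cauchy_matrix_def using invertible_X[OF t0]
      by (simp add: matrix_inv_left flip: matrix_mul_assoc)
    hence "?N (X (t n)) \<le> norm (B n N) * x1"
      unfolding B_def x1_def by (metis compound_mult norm_matrix_mult_le)
    also have "\<dots> \<le> 2 * norm (Y n) * x1" using B_le nn by (intro mult_right_mono) auto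
    also have "norm (Y n) \<le> ?N (?P n) * a2"
      unfolding Y_def a2_def compound_mult by (rule norm_matrix_mult_le)
    hence "2 * norm (Y n) * x1 \<le> 2 * (?N (?P n) * a2) * x1"
      using nn by (intro mult_right_mono mult_left_mono) auto
    also have "\<dots> = (2 * x1 * a2) * ?N (?P n)" by simp
    also have "\<dots> \<le> c * ?N (?P n)" unfolding c_def using nn by (intro mult_right_mono) auto
    finally show "?N (X (t n)) \<le> c * ?N (?P n)" .
  qed
  moreover have "c > 0" unfolding c_def using nn by (intro add_nonneg_pos) auto
  ultimately show ?thesis unfolding t_def by blast
qed

section \<open>Exceptional tuples of initial vectors\<close>

lemma large_minor_exists:
  fixes M :: "real^'n^'n"
  shows "\<exists>f g. norm (compound S M) \<le> (real CARD('n\<Rightarrow>'n))\<^sup>2 / minor_weight S * \<bar>minor S f g M\<bar>"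
proof -
  let ?m = "\<lambda>x. \<bar>minor S (fst x) (snd x) M\<bar>"
  have fin: "finite (range ?m)" by simp
  hence "Max (range ?m) \<in> range ?m" by (intro Max_in) auto
  then obtain x where x: "Max (range ?m) = ?m x" by blast
  have "\<bar>minor S f g M\<bar> \<le> ?m x" for f g
    using Max_ge[OF fin rangeI[of ?m "(f, g)"]] by (simp add: x)
  from norm_compound_le[OF this] show ?thesis by blast
qed

lemma null_set_slow_growth:
  fixes P :: "nat \<Rightarrow> real^'n^'n" and t :: "nat \<Rightarrow> real"
  assumes t: "filterlim t at_top sequentially"
    and grow: "eventually (\<lambda>n. exp (s * t n) \<le> norm (compound S (P n))) sequentially" and rs: "r < s"
  shows "{v. \<forall>n\<ge>N. \<forall>f. \<bar>minor S f id (P n ** transpose v)\<bar> \<le> exp (r * t n)} \<in> null_sets lborel"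
    (is "?Z \<in> _")
proof -
  define w where "w = (real CARD('n\<Rightarrow>'n))\<^sup>2 / minor_weight S"
  have w: "w \<ge> 0" using minor_weight_pos[of S] by (simp add: w_def)
  have "\<forall>n. \<exists>x. norm (compound S (P n)) \<le> w * \<bar>minor S (fst x) (snd x) (P n)\<bar>"
    using large_minor_exists[of S] unfolding w_def by (metis fst_conv snd_conv)
  then obtain x where x: "\<And>n. norm (compound S (P n)) \<le> w * \<bar>minor S (fst (x n)) (snd (x n)) (P n)\<bar>"
    by metis
  \<comment> \<open>There are finitely many pairs of index functions, so one pair is dominant for
    infinitely many \<open>n\<close>. This suffices because \<open>?Z\<close> demands its bound for
    all \<open>n \<ge> N\<close>.\<close>
  have "\<exists>n0\<in>UNIV. infinite {n \<in> UNIV. x n = x n0}"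
    by (rule pigeonhole_infinite) auto
  then obtain n0 where "infinite {n. x n = x n0}" by auto
  then obtain f g where fg: "infinite {n. x n = (f, g)}" by (metis surj_pair)
  \<comment> \<open>Column \<open>j\<close> of \<open>P n ** W\<close> is column \<open>g j\<close>
    of \<open>P n\<close>. The direction in the space of tuples is \<open>transpose W\<close>, since
    the rows of \<open>v\<close> are the initial vectors.\<close>
  define W :: "real^'n^'n" where "W = (\<chi> i j. if i = g j then 1 else 0)"
  have W: "minor S f id (M ** W) = minor S f g M" for M
  proof -
    have "(M ** W) $ i $ j = M $ i $ g j" for i j
      by (simp add: W_def matrix_matrix_mult_def if_distrib cong: if_cong)
    thus ?thesis by (simp add: minor_def)
  qed
  have tr: "transpose (v + c *\<^sub>R transpose W) = transpose v + c *\<^sub>R W" for v :: "real^'n^'n" and c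
    by (simp add: transpose_def vec_eq_iff)
  have line: "P n ** transpose (v + c *\<^sub>R transpose W) = P n ** transpose v + c *\<^sub>R (P n ** W)" for n v c
    unfolding tr by (simp add: vec_eq_iff matrix_matrix_mult_def sum.distrib sum_distrib_left algebra_simps)
  have eq: "?Z = (\<Inter>n\<in>{N..}. \<Inter>f. {v. \<bar>minor S f id (P n ** transpose v)\<bar> \<le> exp (r * t n)})" by auto
  have "closed {v. \<bar>minor S f id (P n ** transpose v)\<bar> \<le> exp (r * t n)}" for n f
    unfolding transpose_def matrix_matrix_mult_def
    by (intro closed_Collect_le continuous_intros)
  hence "closed ?Z" unfolding eq by (intro closed_INT ballI)
  thus ?thesis
  proof (rule null_set_finite_on_lines[where w = "transpose W" and m = "card S"])
    fix v :: "real^'n^'n" and T :: "real set"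
    assume T: "finite T" "\<And>c. c \<in> T \<Longrightarrow> v + c *\<^sub>R transpose W \<in> ?Z"
    show "card T \<le> card S"
    proof (rule ccontr)
      assume "\<not> card T \<le> card S"
      then obtain C where C: "C \<ge> 0" "\<And>f g U W e. (\<forall>c\<in>T. \<bar>minor S f g (U + c *\<^sub>R W)\<bar> \<le> e) \<Longrightarrow>
          \<bar>minor S f g W\<bar> \<le> C * e"
        using minor_leading_bound[OF T(1), of S] by (metis not_le)
      have upper: "\<bar>minor S f g (P n)\<bar> \<le> C * exp (r * t n)" if "n \<ge> N" for n
      proof -
        have "\<forall>c\<in>T. \<bar>minor S f id (P n ** transpose v + c *\<^sub>R (P n ** W))\<bar> \<le> exp (r * t n)"
          using T(2) that by (auto simp: line)
        from C(2)[OF this] show ?thesis by (simp add: W)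
      qed
      have "eventually (\<lambda>n. (w * C + 1) * exp (r * t n) \<le> exp (s * t n)) sequentially"
        using eventually_compose_filterlim[OF eventually_scaled_exp_le[OF rs] t] .
      with grow eventually_ge_at_top[of N]
      have "eventually (\<lambda>n. x n \<noteq> (f, g)) sequentially"
      proof eventually_elim
        case (elim n)
        show ?case
        proof
          assume "x n = (f, g)"
          hence "norm (compound S (P n)) \<le> w * \<bar>minor S f g (P n)\<bar>" using x[of n] by simp
          also have "\<dots> \<le> w * (C * exp (r * t n))" using upper elim w by (intro mult_left_mono) auto
          also have "\<dots> < (w * C + 1) * exp (r * t n)" by (simp add: algebra_simps)
          finally show False using elim by linarith
        qed
      qed
      hence "finite {n. x n = (f, g)}"
        by (simp add: eventually_cofinite flip: cofinite_eq_sequentially)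
      with fg show False by blast
    qed
  qed
qed

section \<open>Telescoping of the QR recursion\<close>

lemma upper_triangular_mult:
  fixes R T :: "'n::{finite,linorder} square"
  assumes "upper_triangular R" "upper_triangular T"
  shows "upper_triangular (R ** T)" "(R ** T) $ i $ i = R $ i $ i * T $ i $ i"
proof -
  have z: "R $ i $ k * T $ k $ j = 0" if "\<not> (i \<le> k \<and> k \<le> j)" for i j k
    using assms that by (auto simp: upper_triangular_def not_le)
  show "upper_triangular (R ** T)"
    unfolding upper_triangular_def
  proof (intro allI impI)
    fix i j :: 'n assume "j < i"
    hence "R $ i $ k * T $ k $ j = 0" for k by (intro z) auto
    thus "(R ** T) $ i $ j = 0"
      unfolding matrix_matrix_mult_def by (simp only: vec_lambda_beta sum.neutral_const)
  qed
  have "(R ** T) $ i $ i = (\<Sum>k\<in>{i}. R $ i $ k * T $ k $ i)"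
    unfolding matrix_matrix_mult_def vec_lambda_beta
  proof (rule sum.mono_neutral_right)
    show "\<forall>k\<in>UNIV - {i}. R $ i $ k * T $ k $ i = 0"
      by (intro ballI z) auto
  qed auto
  thus "(R ** T) $ i $ i = R $ i $ i * T $ i $ i" by simp
qed

text \<open>Inserting each decomposition into the product leaves the last orthogonal factor times
  the product of all triangular ones, whose diagonals multiply. Orthogonality starts at
  \<open>n = 1\<close>, because the initial matrix is merely invertible.\<close>

lemma benettin_factorization:
  fixes v :: "'n::{finite,linorder} square"
  assumes step: "\<And>n. invertible (step_matrix \<Phi> h (Suc n))" and v: "invertible (transpose v)"
  shows "\<exists>R. step_product \<Phi> h n ** transpose v = benettin_V \<Phi> h v n ** R \<and>
    invertible (benettin_V \<Phi> h v n) \<and> upper_triangular R \<and>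
    (\<forall>i. R $ i $ i = (\<Prod>k=1..n. benettin_R \<Phi> h v k $ i $ i)) \<and>
    (\<forall>i. \<forall>k\<in>{1..n}. benettin_R \<Phi> h v k $ i $ i > 0) \<and>
    (n > 0 \<longrightarrow> orthogonal_matrix (benettin_V \<Phi> h v n))"
proof (induction n)
  case 0
  have "upper_triangular (mat 1 :: 'n square)" "\<And>i. (mat 1 :: 'n square) $ i $ i = 1"
    by (simp_all add: upper_triangular_def mat_def)
  thus ?case by (intro exI[of _ "mat 1"]) (simp add: v)
next
  case (Suc n)
  let ?V = "benettin_V \<Phi> h v" and ?R = "benettin_R \<Phi> h v"
  obtain R where R: "step_product \<Phi> h n ** transpose v = ?V n ** R" "invertible (?V n)"
    "upper_triangular R" "\<And>i. R $ i $ i = (\<Prod>k=1..n. ?R k $ i $ i)"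
    "\<And>i k. k \<in> {1..n} \<Longrightarrow> ?R k $ i $ i > 0"
    using Suc by auto
  have "invertible (step_matrix \<Phi> h (Suc n) ** ?V n)" using step R(2) by (rule invertible_mult)
  from is_QR_QR[OF this]
  have qr: "is_QR (step_matrix \<Phi> h (Suc n) ** ?V n) (?V (Suc n)) (?R (Suc n))"
    by (simp add: benettin_R_def)
  have eq: "step_matrix \<Phi> h (Suc n) ** ?V n = ?V (Suc n) ** ?R (Suc n)"
    and o: "orthogonal_matrix (?V (Suc n))" and pos: "\<And>i. ?R (Suc n) $ i $ i > 0"
    using qr by (auto simp: is_QR_def)
  note up = upper_triangular_mult[OF is_QR_upper[OF qr] R(3)]
  show ?case
  proof (intro exI[of _ "?R (Suc n) ** R"] conjI allI ballI impI)
    show "step_product \<Phi> h (Suc n) ** transpose v = ?V (Suc n) ** (?R (Suc n) ** R)"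
      using R(1) eq by (metis matrix_mul_assoc step_product.simps(2))
    show "invertible (?V (Suc n))" using o by (auto simp: orthogonal_matrix_def invertible_def)
    show "upper_triangular (?R (Suc n) ** R)" by (rule up(1))
    show "(?R (Suc n) ** R) $ i $ i = (\<Prod>k=1..Suc n. ?R k $ i $ i)" for i
      by (simp add: up(2) R(4) mult.commute)
    show "?R k $ i $ i > 0" if "k \<in> {1..Suc n}" for i k
      using that R(5)[of k i] pos[of i] by (cases "k = Suc n") auto
    show "orthogonal_matrix (?V (Suc n))" by (rule o)
  qed
qed

text \<open>The accumulated triangular factor belongs to a QR decomposition of the whole product, so
  the sums of logarithms merge into the logarithm of a single volume.\<close>

lemma benettin_output_sum:
  fixes v :: "'n::{finite,linorder} square"
  assumes step: "\<And>n. invertible (step_matrix \<Phi> h (Suc n))" and v: "invertible (transpose v)"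
    and L: "L \<le> CARD('n)" and n: "n > 0"
  defines "S \<equiv> first_indices L :: 'n set"
  obtains Q R where "is_QR (step_product \<Phi> h n ** transpose v) Q R" "(\<Prod>i\<in>S. R $ i $ i) > 0"
    "(\<Sum>i=1..L. benettin_output \<Phi> h v i n) = ln (\<Prod>i\<in>S. R $ i $ i) / grid_time h n"
proof -
  let ?V = "benettin_V \<Phi> h v" and ?R = "benettin_R \<Phi> h v"
  obtain R where R: "step_product \<Phi> h n ** transpose v = ?V n ** R" "upper_triangular R"
    "\<And>i. R $ i $ i = (\<Prod>k=1..n. ?R k $ i $ i)"
    "\<And>i k. k \<in> {1..n} \<Longrightarrow> ?R k $ i $ i > 0" "orthogonal_matrix (?V n)"
    using benettin_factorization[OF step v, of n] n by auto
  have pos: "R $ i $ i > 0" for i unfolding R(3) using R(4) by (intro prod_pos) auto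
  have "(\<Sum>i=1..L. benettin_output \<Phi> h v i n) = (\<Sum>i\<in>S. (\<Sum>k=1..n. ln (?R k $ i $ i)) / grid_time h n)"
    unfolding benettin_output_def S_def
    by (subst sum.reindex_bij_betw[OF bij_betw_first_indices[OF L], symmetric]) simp
  also have "\<dots> = (\<Sum>i\<in>S. ln (R $ i $ i)) / grid_time h n"
  proof -
    have "?R k $ i $ i \<noteq> 0" if "k \<in> {1..n}" for i k using R(4)[OF that, of i] by simp
    hence "(\<Sum>k=1..n. ln (?R k $ i $ i)) = ln (R $ i $ i)" for i
      unfolding R(3) by (subst ln_prod) auto
    thus ?thesis by (simp add: sum_divide_distrib)
  qed
  also have "(\<Sum>i\<in>S. ln (R $ i $ i)) = ln (\<Prod>i\<in>S. R $ i $ i)"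
    using less_imp_neq[OF pos, THEN not_sym] by (subst ln_prod) auto
  finally show thesis
    using R pos by (intro that[of "?V n" R]) (auto simp: is_QR_def upper_triangular_def intro: prod_pos)
qed


lemma bounded_system_exists:
  assumes "bounded (A ` {0..})" "fundamental_matrix A X"
  obtains a where "bounded_system A X a"
proof -
  obtain a where a: "\<And>t. t \<ge> 0 \<Longrightarrow> norm (A t) \<le> a"
    using assms(1) unfolding bounded_iff by auto
  have "norm (A t *v x) \<le> a * norm x" if "t \<ge> 0" for t x
    using norm_matrix_vector_le[of "A t" x] mult_right_mono[OF a[OF that] norm_ge_zero[of x]]
    by linarith
  with assms(2) show thesis by (intro that[of a]) (simp add: bounded_system_def)
qed

text \<open>The constant that relates numerical and exact compounds is absorbed by giving away half
  of \<open>e\<close>.\<close>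

lemma step_product_growth:
  fixes A X :: "real \<Rightarrow> 'n::{finite,linorder} square"
  assumes sys: "bounded_system A X a" and reg: "regular_system A X"
    and fast: "strongly_fast_invertible L X" and L: "L \<le> CARD('n)"
    and one_step: "one_step_method hmax \<Phi>" and consistent: "consistent_of_order hmax X \<Phi> p" and p: "p > 0"
    and h: "\<And>n. n \<ge> 1 \<Longrightarrow> 0 < h n \<and> h n \<le> hmax"
    and t: "filterlim (grid_time h) at_top sequentially"
    and sum: "summable (\<lambda>n. h (Suc n) powr (p + 1))"
  defines "S \<equiv> first_indices L :: 'n set"
  obtains \<sigma> where "(\<Sum>i=1..L. lyapunov_counted A i) = ereal \<sigma>"
    "\<And>e. e > 0 \<Longrightarrow> eventually (\<lambda>n. exp ((\<sigma> - e) * grid_time h n) \<le>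
       norm (compound S (step_product \<Phi> h n))) sequentially"
    "\<And>e. e > 0 \<Longrightarrow> eventually (\<lambda>n. norm (compound S (step_product \<Phi> h n)) \<le>
       exp ((\<sigma> + e) * grid_time h n)) sequentially"
proof -
  obtain \<sigma> where \<sigma>: "(\<Sum>i=1..L. lyapunov_counted A i) = ereal \<sigma>"
    and lower: "\<And>e. e > 0 \<Longrightarrow> eventually (\<lambda>t. exp ((\<sigma> - e) * t) \<le> norm (compound S (X t))) at_top"
    and upper: "\<And>e. e > 0 \<Longrightarrow> eventually (\<lambda>t. norm (compound S (X t)) \<le> exp ((\<sigma> + e) * t)) at_top"
    using compound_growth[OF sys reg L] unfolding S_def by blast
  obtain c N where c: "c > 0"
    and PX: "\<And>n. n \<ge> N \<Longrightarrow> norm (compound S (step_product \<Phi> h n)) \<le> c * norm (compound S (X (grid_time h n)))"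
    and XP: "\<And>n. n \<ge> N \<Longrightarrow> norm (compound S (X (grid_time h n))) \<le> c * norm (compound S (step_product \<Phi> h n))"
    using step_product_comparable[OF sys fast L one_step consistent p h sum] unfolding S_def by blast
  note at_grid = eventually_compose_filterlim[OF _ t]
  show thesis
  proof (rule that[OF \<sigma>])
    fix e :: real assume e: "e > 0"
    have "\<sigma> - e < \<sigma> - e / 2" "\<sigma> + e / 2 < \<sigma> + e" "e / 2 > 0" using e by auto
    note scaled = at_grid[OF eventually_scaled_exp_le[OF this(1), of c]]
      at_grid[OF eventually_scaled_exp_le[OF this(2), of c]]
      and half = at_grid[OF lower[OF this(3)]] at_grid[OF upper[OF this(3)]]
    from scaled(1) half(1) eventually_ge_at_top[of N]
    show "eventually (\<lambda>n. exp ((\<sigma> - e) * grid_time h n) \<le>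
       norm (compound S (step_product \<Phi> h n))) sequentially"
    proof eventually_elim
      case (elim n)
      hence "c * exp ((\<sigma> - e) * grid_time h n) \<le> c * norm (compound S (step_product \<Phi> h n))"
        using XP[of n] by linarith
      thus ?case using c by simp
    qed
    from scaled(2) half(2) eventually_ge_at_top[of N]
    show "eventually (\<lambda>n. norm (compound S (step_product \<Phi> h n)) \<le>
       exp ((\<sigma> + e) * grid_time h n)) sequentially"
    proof eventually_elim
      case (elim n)
      have "norm (compound S (step_product \<Phi> h n)) \<le> c * norm (compound S (X (grid_time h n)))"
        using elim PX by simp
      also have "\<dots> \<le> c * exp ((\<sigma> + e / 2) * grid_time h n)" using elim c by (intro mult_left_mono) auto
      also note elim(1)
      finally show ?case .
    qed
  qed
qed

text \<open>The bound from above uses only that the tuple is invertible; \<open>generic\<close> is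
  needed from below and says that \<open>v\<close> avoids every exceptional set.\<close>

lemma limsup_benettin:
  fixes v :: "'n::{finite,linorder} square"
  assumes L: "L \<le> CARD('n)" and t: "filterlim (grid_time h) at_top sequentially"
    and step: "\<And>n. invertible (step_matrix \<Phi> h (Suc n))" and v: "invertible (transpose v)"
  defines "S \<equiv> first_indices L :: 'n set"
  assumes upper: "\<And>e. e > 0 \<Longrightarrow> eventually (\<lambda>n. norm (compound S (step_product \<Phi> h n)) \<le>
       exp ((\<sigma> + e) * grid_time h n)) sequentially"
    and generic: "\<And>k N. \<exists>n\<ge>N. \<exists>f. exp ((\<sigma> - 1 / real (Suc k)) * grid_time h n) <
       \<bar>minor S f id (step_product \<Phi> h n ** transpose v)\<bar>"
  shows "limsup (\<lambda>n. ereal (\<Sum>i=1..L. benettin_output \<Phi> h v i n)) = ereal \<sigma>"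
proof (rule antisym)
  let ?t = "grid_time h"
  let ?out = "\<lambda>n. \<Sum>i=1..L. benettin_output \<Phi> h v i n"
  let ?W = "\<lambda>n. wedge S (step_product \<Phi> h n ** transpose v)"
  note at_grid = eventually_compose_filterlim[OF _ t]
  obtain c where c: "c > 0"
    and QR: "\<And>M Q R. is_QR M Q R \<Longrightarrow> (\<Prod>i\<in>S. R $ i $ i) \<le> c * norm (wedge S M) \<and>
      norm (wedge S M) \<le> c * (\<Prod>i\<in>S. R $ i $ i)"
    using prod_diagonal_QR_comparable[OF down_closed_first_indices[OF L]] unfolding S_def by blast
  \<comment> \<open>Exponentiated, the output sum is the volume spanned by the propagated vectors,
    up to the constant \<open>c\<close>.\<close>
  have out: "exp (?out n * ?t n) \<le> c * norm (?W n) \<and> norm (?W n) \<le> c * exp (?out n * ?t n)"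
    if n: "n > 0" and tn: "?t n > 0" for n
  proof -
    obtain Q R where qr: "is_QR (step_product \<Phi> h n ** transpose v) Q R" "(\<Prod>i\<in>S. R $ i $ i) > 0"
      "?out n = ln (\<Prod>i\<in>S. R $ i $ i) / ?t n"
      using benettin_output_sum[OF step v L n] unfolding S_def by blast
    have "exp (?out n * ?t n) = (\<Prod>i\<in>S. R $ i $ i)" using qr(2,3) tn by simp
    with QR[OF qr(1)] show ?thesis by simp
  qed
  have tpos: "eventually (\<lambda>n. ?t n > 0) sequentially" by (rule at_grid[OF eventually_gt_at_top])
  show "limsup (\<lambda>n. ereal (?out n)) \<le> ereal \<sigma>"
    unfolding Limsup_le_iff
  proof (intro allI impI)
    fix y assume "ereal \<sigma> < y"
    then obtain r where r: "\<sigma> < r" "ereal r < y" using ereal_dense2 by force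
    define e where "e = (r - \<sigma>) / 2"
    have e: "e > 0" "\<sigma> + e < r" using r by (auto simp: e_def field_simps)
    from upper[OF e(1)] at_grid[OF eventually_scaled_exp_le[OF e(2), of "c * norm (wedge S (transpose v))"]]
      tpos eventually_gt_at_top[of 0]
    show "eventually (\<lambda>n. ereal (?out n) < y) sequentially"
    proof eventually_elim
      case (elim n)
      have "exp (?out n * ?t n) \<le> c * norm (?W n)" using out elim by blast
      also have "\<dots> \<le> c * (norm (compound S (step_product \<Phi> h n)) * norm (wedge S (transpose v)))"
        unfolding wedge_mult using c by (intro mult_left_mono norm_matrix_vector_le) auto
      also have "\<dots> \<le> c * (exp ((\<sigma> + e) * ?t n) * norm (wedge S (transpose v)))"
        using elim c by (intro mult_left_mono mult_right_mono) auto
      also have "\<dots> = c * norm (wedge S (transpose v)) * exp ((\<sigma> + e) * ?t n)" by simp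
      also note elim(2)
      finally have "?out n \<le> r" using elim by simp
      hence "ereal (?out n) \<le> ereal r" by simp
      thus ?case using r(2) by (rule le_less_trans)
    qed
  qed
  show "ereal \<sigma> \<le> limsup (\<lambda>n. ereal (?out n))"
  proof (rule ccontr)
    assume "\<not> ereal \<sigma> \<le> limsup (\<lambda>n. ereal (?out n))"
    then obtain r where r: "limsup (\<lambda>n. ereal (?out n)) < ereal r" "r < \<sigma>"
      using ereal_dense2[of "limsup (\<lambda>n. ereal (?out n))" "ereal \<sigma>"] by (auto simp: not_le)
    obtain k where k: "1 / real (Suc k) < \<sigma> - r"
      using reals_Archimedean[of "\<sigma> - r"] r(2) by (auto simp: inverse_eq_divide)
    hence "r < \<sigma> - 1 / real (Suc k)" by simp
    from Limsup_lessD[OF r(1)] at_grid[OF eventually_scaled_exp_le[OF this, of c]]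
      tpos eventually_gt_at_top[of 0]
    have "eventually (\<lambda>n. norm (?W n) \<le> exp ((\<sigma> - 1 / real (Suc k)) * ?t n)) sequentially"
    proof eventually_elim
      case (elim n)
      have "norm (?W n) \<le> c * exp (?out n * ?t n)" using out elim by blast
      also have "\<dots> \<le> c * exp (r * ?t n)" using elim c by simp
      also note elim(2)
      finally show ?case .
    qed
    then obtain N where N: "\<And>n. n \<ge> N \<Longrightarrow> norm (?W n) \<le> exp ((\<sigma> - 1 / real (Suc k)) * ?t n)"
      unfolding eventually_sequentially by blast
    obtain n f where n: "n \<ge> N" "exp ((\<sigma> - 1 / real (Suc k)) * ?t n) <
        \<bar>minor S f id (step_product \<Phi> h n ** transpose v)\<bar>"
      using generic by blast
    have "\<bar>minor S f id (step_product \<Phi> h n ** transpose v)\<bar> \<le> norm (?W n)"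
      using component_le_norm_cart[of "?W n" f] by (simp add: wedge_def)
    with N[OF n(1)] n(2) show False by linarith
  qed
qed

theorem theorem4p10:
  fixes A X :: "real \<Rightarrow> 'n::{finite,linorder} square"
    and \<Phi> :: "real \<Rightarrow> real \<Rightarrow> 'n square"
    and h :: "nat \<Rightarrow> real"
    and hmax p :: real
    and L :: nat
  assumes "continuous_on {0..} A"
    and "bounded (A ` {0..})"
    and "fundamental_matrix A X"
    and "1 \<le> L" and "L \<le> CARD('n)"
    and "regular_system A X"
    and "strongly_fast_invertible L X"
    and "0 < hmax"
    and "one_step_method hmax \<Phi>"
    and "0 < p"
    and "consistent_of_order hmax X \<Phi> p"
    and "\<And>n. n \<ge> 1 \<Longrightarrow> 0 < h n \<and> h n \<le> hmax"
    and "filterlim (grid_time h) at_top sequentially"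
    and "summable (\<lambda>n. h (Suc n) powr (p + 1))"
  shows "AE v in (lebesgue :: ('n square) measure).
           limsup (\<lambda>n. ereal (\<Sum>i=1..L. benettin_output \<Phi> h v i n)) =
             (\<Sum>i=1..L. lyapunov_counted A i)"
proof -
  obtain a where sys: "bounded_system A X a"
    using bounded_system_exists assms(2,3) by blast
  define S :: "'n set" where "S = first_indices L"
  let ?t = "grid_time h" and ?P = "step_product \<Phi> h"
  obtain \<sigma> where \<sigma>: "(\<Sum>i=1..L. lyapunov_counted A i) = ereal \<sigma>"
    and lower: "\<And>e. e > 0 \<Longrightarrow> eventually (\<lambda>n. exp ((\<sigma> - e) * ?t n) \<le> norm (compound S (?P n))) sequentially"
    and upper: "\<And>e. e > 0 \<Longrightarrow> eventually (\<lambda>n. norm (compound S (?P n)) \<le> exp ((\<sigma> + e) * ?t n)) sequentially"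
    using step_product_growth[OF sys assms(6,7,5,9,11,10,12,13,14)] unfolding S_def by blast
  have t0: "?t n \<ge> 0" for n
    unfolding grid_time_def using assms(12) by (intro sum_nonneg) (auto simp: less_imp_le)
  have step: "invertible (step_matrix \<Phi> h (Suc n))" for n
    using assms(9) assms(12)[of "Suc n"] t0[of n] by (simp add: step_matrix_def one_step_method_def)
  \<comment> \<open>Only countably many sets arise: \<open>k\<close> fixes the loss in the exponent
    and \<open>N\<close> the time from which growth is slow. Half of that loss is used for the
    growth of the compound, which keeps the two rates apart.\<close>
  let ?Z = "\<lambda>k N. {v. \<forall>n\<ge>N. \<forall>f. \<bar>minor S f id (?P n ** transpose v)\<bar> \<le> exp ((\<sigma> - 1 / real (Suc k)) * ?t n)}"
  have "?Z k N \<in> null_sets lborel" for k N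
  proof (rule null_set_slow_growth[OF assms(13)])
    show "eventually (\<lambda>n. exp ((\<sigma> - 1 / (2 * real (Suc k))) * ?t n) \<le> norm (compound S (?P n))) sequentially"
      by (rule lower) simp
    show "\<sigma> - 1 / real (Suc k) < \<sigma> - 1 / (2 * real (Suc k))" by (simp add: field_simps)
  qed
  hence "{v. det v = 0} \<union> (\<Union>k. \<Union>N. ?Z k N) \<in> null_sets lborel" (is "?bad \<in> _")
    by (intro null_sets.Un null_set_noninvertible null_sets_UN)
  hence "?bad \<in> null_sets lebesgue" by (rule null_sets_completionI)
  moreover have "limsup (\<lambda>n. ereal (\<Sum>i=1..L. benettin_output \<Phi> h v i n)) = (\<Sum>i=1..L. lyapunov_counted A i)"
    if v: "v \<notin> ?bad" for v
    unfolding \<sigma>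
  proof (rule limsup_benettin[OF assms(5,13) step])
    show "invertible (transpose v)" using v by (simp add: invertible_det_nz)
    show "eventually (\<lambda>n. norm (compound (first_indices L) (?P n)) \<le> exp ((\<sigma> + e) * ?t n)) sequentially"
      if "e > 0" for e using upper[OF that] by (simp add: S_def)
    show "\<exists>n\<ge>N. \<exists>f. exp ((\<sigma> - 1 / real (Suc k)) * ?t n) <
       \<bar>minor (first_indices L) f id (?P n ** transpose v)\<bar>" for k N
    proof -
      have "v \<notin> ?Z k N" using v by blast
      thus ?thesis by (auto simp: S_def not_le)
    qed
  qed
  ultimately show ?thesis by (intro AE_I'[of ?bad] subsetI) blast+
qed

end
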